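(* In the setting described in the context, let $\kappa:[-1,1]\to\mathbb{R}$ be given by $\mathbb{E}[T_1(x)T_1(y)]=\kappa(\langle x,y\rangle)$, $x,y\in\mathbb{S}^d$, and assume $\kappa\in C^1$. Let $X_L$ ($L\ge1$) be the spectral random variable of $T_L$. **Low-disorder.** If $\kappa'(1)<1$, then: (a) If $\kappa$ is infinitely differentiable in a neighborhood of $1$, then all moments of $X_L$ are finite and decay exponentially to zero as $L$ diverges; in particular, for every integer $n\ge1$, $$\mathbb{E}[X_L^n]=O(\kappa'(1)^L)\quad\text{as }L\to\infty .$$ (b) If $\kappa$ is differentiable only $r$ times in a neighborhood of $1$, then $X_L$ has only $2r$ finite moments, and these satisfy $\mathbb{E}[X_L^n]=O(\kappa'(1)^L)$ as $L\to\infty$ ($1\le n\le 2r$). **Sparse.** If $\kappa'(1)=1$, then $$\lim_{L\to\infty}\mathbb{E}[X_L]=0,\qquad 1\le\mathbb{E}[X_L^2]\le d .$$ Furthermore: (a) If $\kappa$ is infinitely differentiable in a neighborhood of $1$, then all moments of $X_L$ are finite, and the moments of order greater than two grow polynomially in $L$; in particular, for every $n\ge2$ there exists a constant $c_n>0$ not depending on $L$ such that $$\mathbb{E}[X_L^{2n}]=L^{n-1}(c_n+o(1))\quad\text{as }L\to\infty .$$ (b) If $\kappa$ is only $r$ times differentiable in a neighborhood of $1$, then $X_L$ has only $2r$ finite moments, and these grow as in (a), i.e. $\mathbb{E}[X_L^{2n}]=L^{n-1}(c_n+o(1))$ with $c_n>0$ for $2\le n\le r$. **High-disorder.** If $\kappa'(1)>1$,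 then $$\lim_{L\to\infty}\mathbb{P}(X_L=0)<1,\qquad\text{and hence}\qquad\liminf_{L\to\infty}\mathbb{E}[X_L]>0 .$$ Furthermore: (a) If $\kappa$ is infinitely differentiable in a neighborhood of $1$, then all moments of $X_L$ are finite and diverge exponentially as $L$ diverges; in particular, for every $n\ge1$ there exists a constant $c_n>0$ not depending on $L$ such that $$\mathbb{E}[X_L^{2n}]=\kappa'(1)^{nL}(c_n+o(1))\quad\text{as }L\to\infty .$$ (b) If $\kappa$ is only $r$ times differentiable in a neighborhood of $1$, then $X_L$ has only $2r$ finite moments, and these grow as in (a), i.e. $\mathbb{E}[X_L^{2n}]=\kappa'(1)^{nL}(c_n+o(1))$ with $c_n>0$ for $1\le n\le r$.
   Context: Let $d\ge2$ be an integer, $\mathbb{S}^d\subset\mathbb{R}^{d+1}$ the unit sphere, and $\sigma:\mathbb{R}\to\mathbb{R}$ a function with $0<\Gamma_\sigma:=\mathbb{E}[\sigma(Z)^2]<\infty$, $Z\sim\mathcal{N}(0,1)$. Let $\Gamma_b,\Gamma_{W_0}>0$ with $\Gamma_b+\Gamma_{W_0}=1$, and $\Gamma_W=(1-\Gamma_b)\Gamma_\sigma^{-1}$. A random neural network is $x\in\mathbb{S}^d\mapsto W^{(0)}x+b^{(1)}$ for layer $0$, and at layer $s\ge1$ it is $W^{(s)}\sigma(\,\cdot\,)+b^{(s+1)}$ applied (with $\sigma$ acting componentwise) to the output of layer $s-1$. All entries are independent centered Gaussians: biases have variance $\Gamma_b$, entries of $W^{(0)}$ have variance $\Gamma_{W_0}$,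 and entries of $W^{(s)}$ have variance $\Gamma_W/n_s$, where $n_s$ is the width of layer $s$. $T_L:\mathbb{S}^d\to\mathbb{R}$ denotes a component of the infinite-width Gaussian limit at layer $L$. Concretely: - $\kappa_1=\kappa$, where $\kappa(u)=\Gamma_b+\Gamma_W\,\mathbb{E}[\sigma(Z_1)\sigma(Z_2)]$ with $(Z_1,Z_2)$ centered Gaussian, unit variances and covariance $\Gamma_b+\Gamma_{W_0}u$; in particular $\kappa(1)=1$. - $\kappa_L=\kappa\circ\kappa_{L-1}$ for $L\ge2$ (so $\kappa_L$ is the composition of $L$ copies of $\kappa$). - $T_L$ is a centered Gaussian field on $\mathbb{S}^d$ with covariance $\mathbb{E}[T_L(x)T_L(y)]=\kappa_L(\langle x,y\rangle)$. Normalized Gegenbauer polynomials: $(G_{\ell,d})_{\ell\ge0}$ is the unique sequence of polynomials with $\deg G_{\ell,d}=\ell$, $G_{\ell,d}(1)=1$, and $\int_{-1}^1G_{\ell,d}(x)G_{\ell',d}(x)(1-x^2)^{d/2-1}\,dx=0$ for $\ell\ne\ell'$. By Schoenberg's theorem $\kappa_L(t)=\sum_{\ell\ge0}D_{\ell;\kappa_L}G_{\ell,d}(t)$ with unique $D_{\ell;\kappa_L}\ge0$, and $\sum_\ell D_{\ell;\kappa_L}=\kappa_L(1)=1$. The spectral random variable $X_L$ takes values in $\{0,1,2,\dots\}$ with $\mathbb{P}(X_L=\ell)=D_{\ell;\kappa_L}$. Neighborhoods of $1$ are relative to $[-1,1]$ (one-sided derivatives at $1$). "Only $2r$ finite moments"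 refers to the moments of order $1,\dots,2r$.
   Formalization: "X_L has only 2r finite moments" is stated as: moments of order 1,…,2r are finite and all of order at least 2r+2 are infinite; order 2r+1 is left open, since it is finite for some activations (e.g. when κ has a (1-u)^(r+3/4) singularity at 1). *)

theory Defs
  imports "HOL-Probability.Probability" "HOL-Computational_Algebra.Polynomial"
    "HOL-Library.Landau_Symbols"
begin

definition Gamma_sigma :: "(real \<Rightarrow> real) \<Rightarrow> real" where
  "Gamma_sigma \<sigma> = (\<integral>z. (\<sigma> z)\<^sup>2 \<partial>std_normal_distribution)"

definition admissible_activation :: "(real \<Rightarrow> real) \<Rightarrow> bool" where
  "admissible_activation \<sigma> \<longleftrightarrow>
     \<sigma> \<in> borel_measurable borel \<and>
     integrable std_normal_distribution (\<lambda>z. (\<sigma> z)\<^sup>2) \<and>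
     0 < Gamma_sigma \<sigma>"

(* For independent standard normal Z, W and \<rho> \<in> [-1, 1], the pair
   (Z, \<rho> Z + sqrt (1 - \<rho>^2) W) is the centered Gaussian pair with unit variances
   and covariance \<rho>; the degenerate case \<rho> = 1 is included. *)
definition gaussian_pair_expectation :: "(real \<Rightarrow> real) \<Rightarrow> real \<Rightarrow> real" where
  "gaussian_pair_expectation \<sigma> \<rho> =
     (\<integral>p. \<sigma> (fst p) * \<sigma> (\<rho> * fst p + sqrt (1 - \<rho>\<^sup>2) * snd p)
        \<partial>(std_normal_distribution \<Otimes>\<^sub>M std_normal_distribution))"

(* The factor (1 - \<Gamma>b) / Gamma_sigma \<sigma> is the weight variance parameter \<Gamma>_W. Only the values
   for u \<in> [-1, 1] are meaningful. *)
definition network_kernel :: "(real \<Rightarrow> real) \<Rightarrow> real \<Rightarrow> real \<Rightarrow> real \<Rightarrow> real" where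
  "network_kernel \<sigma> \<Gamma>b \<Gamma>W0 u =
     \<Gamma>b + (1 - \<Gamma>b) / Gamma_sigma \<sigma> * gaussian_pair_expectation \<sigma> (\<Gamma>b + \<Gamma>W0 * u)"

definition centered_normal :: "real \<Rightarrow> real measure" where
  "centered_normal v =
     (if v = 0 then return borel 0
      else density lborel (\<lambda>x. ennreal (normal_density 0 (sqrt v) x)))"

definition centered_gaussian_field :: "'a measure \<Rightarrow> 's set \<Rightarrow> ('s \<Rightarrow> 'a \<Rightarrow> real) \<Rightarrow> bool" where
  "centered_gaussian_field M S T \<longleftrightarrow>
     prob_space M \<and>
     (\<forall>x\<in>S. T x \<in> borel_measurable M) \<and>
     (\<forall>A c. finite A \<and> A \<subseteq> S \<longrightarrow>
        (\<exists>v\<ge>0. distr M borel (\<lambda>\<omega>. \<Sum>x\<in>A. c x * T x \<omega>) = centered_normal v))"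

definition isotropic_covariance ::
    "'a measure \<Rightarrow> ('v::euclidean_space \<Rightarrow> 'a \<Rightarrow> real) \<Rightarrow> (real \<Rightarrow> real) \<Rightarrow> bool" where
  "isotropic_covariance M T k \<longleftrightarrow>
     (\<forall>x\<in>sphere 0 1. \<forall>y\<in>sphere 0 1. (\<integral>\<omega>. T x \<omega> * T y \<omega> \<partial>M) = k (x \<bullet> y))"

(* These conditions determine the sequence uniquely. *)
definition normalized_gegenbauer :: "nat \<Rightarrow> (nat \<Rightarrow> real poly) \<Rightarrow> bool" where
  "normalized_gegenbauer d G \<longleftrightarrow>
     (\<forall>l. degree (G l) = l \<and> poly (G l) 1 = 1) \<and>
     (\<forall>l m. l \<noteq> m \<longrightarrow>
        (LINT x:{-1..1}|lborel.
           poly (G l) x * poly (G m) x * (1 - x\<^sup>2) powr (real d / 2 - 1)) = 0)"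

(* For a field on the unit sphere with covariance k <x, y>, the probabilities P(X = l) are the
   coefficients in the Schoenberg expansion of k along the normalized Gegenbauer
   polynomials G. They are nonnegative since they are probabilities. *)
definition spectral_random_variable ::
    "(nat \<Rightarrow> real poly) \<Rightarrow> 'a measure \<Rightarrow> ('v::euclidean_space \<Rightarrow> 'a \<Rightarrow> real) \<Rightarrow>
     'b measure \<Rightarrow> ('b \<Rightarrow> nat) \<Rightarrow> bool" where
  "spectral_random_variable G M T N X \<longleftrightarrow>
     X \<in> measurable N (count_space UNIV) \<and>
     (\<exists>k. isotropic_covariance M T k \<and>
        (\<forall>t\<in>{-1..1}.
           (\<lambda>l. measure N {\<omega> \<in> space N. X \<omega> = l} * poly (G l) t) sums k t))"

definition moment :: "'b measure \<Rightarrow> ('b \<Rightarrow> nat) \<Rightarrow> nat \<Rightarrow> real" where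
  "moment N X n = (\<integral>\<omega>. real (X \<omega>) ^ n \<partial>N)"

definition finite_moment :: "'b measure \<Rightarrow> ('b \<Rightarrow> nat) \<Rightarrow> nat \<Rightarrow> bool" where
  "finite_moment N X n \<longleftrightarrow> integrable N (\<lambda>\<omega>. real (X \<omega>) ^ n)"

(* The moments of order 1, ..., 2r are finite and none of order at least 2r + 2 is;
   equivalently, the finite even moments are those up to order 2r. Order 2r + 1 is left
   open: if r is the exact order of differentiability of the covariance at 1, that moment
   is infinite for some activations (ReLU) and finite for others. *)
definition only_2r_finite_moments :: "'b measure \<Rightarrow> ('b \<Rightarrow> nat) \<Rightarrow> nat \<Rightarrow> bool" where
  "only_2r_finite_moments N X r \<longleftrightarrow>
     (\<forall>n\<in>{1..2 * r}. finite_moment N X n) \<and> (\<forall>n\<ge>2 * r + 2. \<not> finite_moment N X n)"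

(* Derivatives are taken within S, hence are one-sided at the endpoints of an interval. *)
definition times_differentiable_on :: "nat \<Rightarrow> (real \<Rightarrow> real) \<Rightarrow> real set \<Rightarrow> bool" where
  "times_differentiable_on n f S \<longleftrightarrow>
     (\<exists>F. (\<forall>x\<in>S. F 0 x = f x) \<and>
          (\<forall>k<n. \<forall>x\<in>S. (F k has_real_derivative F (Suc k) x) (at x within S)))"

definition times_differentiable_near_1 :: "nat \<Rightarrow> (real \<Rightarrow> real) \<Rightarrow> bool" where
  "times_differentiable_near_1 n f \<longleftrightarrow>
     (\<exists>\<epsilon>. 0 < \<epsilon> \<and> \<epsilon> \<le> 2 \<and> times_differentiable_on n f {1 - \<epsilon>..1})"

definition infinitely_differentiable_near_1 :: "(real \<Rightarrow> real) \<Rightarrow> bool" where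
  "infinitely_differentiable_near_1 f \<longleftrightarrow>
     (\<exists>\<epsilon>. 0 < \<epsilon> \<and> \<epsilon> \<le> 2 \<and> (\<forall>n. times_differentiable_on n f {1 - \<epsilon>..1}))"

definition only_times_differentiable_near_1 :: "nat \<Rightarrow> (real \<Rightarrow> real) \<Rightarrow> bool" where
  "only_times_differentiable_near_1 r f \<longleftrightarrow>
     times_differentiable_near_1 r f \<and> \<not> times_differentiable_near_1 (Suc r) f"

(* f L = g L * (c + o(1)) as L \<rightarrow> \<infinity>, with a constant c > 0. *)
definition leading_order :: "(nat \<Rightarrow> real) \<Rightarrow> (nat \<Rightarrow> real) \<Rightarrow> bool" where
  "leading_order f g \<longleftrightarrow>
     (\<exists>c>0. \<exists>e. e \<longlonglongrightarrow> 0 \<and> (\<forall>L\<ge>1. f L = g L * (c + e L)))"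

definition decays_exponentially :: "(nat \<Rightarrow> real) \<Rightarrow> bool" where
  "decays_exponentially f \<longleftrightarrow> (\<exists>\<rho>. 0 < \<rho> \<and> \<rho> < 1 \<and> f \<in> O(\<lambda>L. \<rho> ^ L))"

definition grows_polynomially :: "(nat \<Rightarrow> real) \<Rightarrow> bool" where
  "grows_polynomially f \<longleftrightarrow>
     (\<exists>a b. 0 < a \<and> 0 < b \<and> f \<in> \<Omega>(\<lambda>L. real L powr a) \<and> f \<in> O(\<lambda>L. real L powr b))"

definition diverges_exponentially :: "(nat \<Rightarrow> real) \<Rightarrow> bool" where
  "diverges_exponentially f \<longleftrightarrow>
     (\<exists>a b. 1 < a \<and> 1 < b \<and> f \<in> \<Omega>(\<lambda>L. a ^ L) \<and> f \<in> O(\<lambda>L. b ^ L))"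

end

theory Submission
  imports Defs "HOL-Real_Asymp.Real_Asymp"
begin

text \<open>
  The Sturm--Liouville equation of the Gegenbauer polynomials shows that all their derivatives attain
  their maximal absolute value on \<open>[-1, 1]\<close> at \<open>1\<close>, and that the \<open>n\<close>-th derivative of the one of degree
  \<open>l\<close> at \<open>1\<close> is asymptotic to a positive multiple of \<open>l ^ (2 n)\<close>. Hence \<open>E X_L ^ (2 n)\<close> is finite iff the
  covariance \<open>\<kappa> ^^ L\<close> is \<open>n\<close> times differentiable near \<open>1\<close>, and it is then comparable to the \<open>n\<close>-th derivative
  at \<open>1\<close>. The chain rule gives a recursion in \<open>L\<close> for the Taylor coefficients of \<open>\<kappa> ^^ L\<close> at the fixed
  point \<open>1\<close>; its dominant terms depend on whether the multiplier \<open>\<kappa>' 1\<close> is below, equal to or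
  above \<open>1\<close>. The probability \<open>P (X_L = 0)\<close> is the weighted mean of \<open>\<kappa> ^^ L\<close> over \<open>[-1, 1]\<close>, so its limit
  follows from the pointwise limits of the iterates. These exist because \<open>\<kappa>\<close> is monotone on \<open>[0, 1]\<close> and
  pushes negative points up by at least \<open>\<Gamma>b\<close>. Both facts are closed conditions on the activation in
  \<open>L\<^sup>2\<close> of the Gaussian measure, and for trigonometric polynomials they are read off from a
  power series with nonnegative coefficients.
\<close>

unbundle no vec_syntax
unbundle fps_syntax

section \<open>Recursions for sequences of power series\<close>

text \<open>To turn differentiability into finite moments, a bounded difference quotient at
  \<open>1\<close> is enough: in a series with nonnegative coefficients whose terms are all largest
  at \<open>1\<close>, it already forces the differentiated series to converge. The chain rule shows
  that iterates are at least as smooth as \<open>\<kappa>\<close>. The obstacle is the converse,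
  that \<open>\<kappa> ^^ L\<close> is not smoother than \<open>\<kappa>\<close>: it rests on all
  derivatives being dominated by their values at \<open>1\<close>, together with
  \<open>\<kappa>' 1 > 0\<close>.

  Positive leading constants need a positive second derivative of \<open>\<kappa>\<close> at
  \<open>1\<close>. If it vanished while \<open>\<kappa>' 1 \<ge> 1\<close>, the kernel would be the
  identity, which the positive bias variance excludes by its effect at \<open>-1\<close>.

  The correlation \<open>\<Gamma>b + \<Gamma>W0 * u\<close> can be negative, so monotonicity of
  \<open>\<kappa>\<close> is available only on \<open>[0, 1]\<close>; this is why orbits are first
  driven there. Derivatives at \<open>1\<close> control only even moments. Bounds for odd orders
  come from monotonicity in the order and, from below, from an interpolation inequality.\<close>

lemma linear_recursion_tendsto:
  fixes x y :: "nat \<Rightarrow> real"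
  assumes rec: "\<And>L. L \<ge> m \<Longrightarrow> x (Suc L) = a * x L + y L"
    and a: "0 \<le> a" "a < 1" and y: "y \<longlonglongrightarrow> Y"
  shows "x \<longlonglongrightarrow> Y / (1 - a)"
proof -
  define z where "z L = x L - Y / (1 - a)" for L
  define e where "e L = y L - Y" for L
  have zrec: "z (Suc L) = a * z L + e L" if "L \<ge> m" for L
  proof -
    define q where "q = Y / (1 - a)"
    have "q = a * q + Y"
      using a by (simp add: q_def field_simps)
    then show ?thesis using rec[OF that]
      unfolding z_def e_def q_def[symmetric] by (simp add: algebra_simps)
  qed
  have e0: "e \<longlonglongrightarrow> 0"
    unfolding e_def using tendsto_diff[OF y tendsto_const[of Y]] by simp
  have "z \<longlonglongrightarrow> 0"
  proof (rule LIMSEQ_I)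
    fix \<epsilon> :: real assume \<epsilon>: "\<epsilon> > 0"
    \<comment> \<open>Errors below \<open>(1 - a) * (\<epsilon> / 2)\<close> never accumulate beyond
      \<open>\<epsilon> / 2\<close>, because \<open>a * (\<epsilon> / 2) + (1 - a) * (\<epsilon> /
      2) = \<epsilon> / 2\<close>.\<close>
    have "eventually (\<lambda>L. \<bar>e L\<bar> < (1 - a) * (\<epsilon> / 2)) sequentially"
      using tendstoD[OF e0, of "(1 - a) * (\<epsilon> / 2)"] a \<epsilon> by (simp add: dist_real_def)
    then obtain N1 where N1: "\<And>L. L \<ge> N1 \<Longrightarrow> \<bar>e L\<bar> < (1 - a) * (\<epsilon> / 2)"
      by (auto simp: eventually_sequentially)
    define N where "N = max m N1"
    have bound: "\<bar>z (N + k)\<bar> \<le> a ^ k * \<bar>z N\<bar> + \<epsilon> / 2" for k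
    proof (induction k)
      case 0
      show ?case using \<epsilon> by simp
    next
      case (Suc k)
      have "\<bar>z (N + Suc k)\<bar> \<le> a * \<bar>z (N + k)\<bar> + \<bar>e (N + k)\<bar>"
        using zrec[of "N + k"] a by (simp add: N_def abs_mult order_trans[OF abs_triangle_ineq])
      also have "\<dots> \<le> a * (a ^ k * \<bar>z N\<bar> + \<epsilon> / 2) + (1 - a) * (\<epsilon> / 2)"
        using Suc.IH less_imp_le[OF N1[of "N + k"]] a by (intro add_mono mult_left_mono) (simp_all add: N_def)
      also have "\<dots> = a ^ Suc k * \<bar>z N\<bar> + \<epsilon> / 2" by (simp add: field_simps)
      finally show ?case .
    qed
    have "(\<lambda>m. a ^ m * \<bar>z N\<bar>) \<longlonglongrightarrow> 0 * \<bar>z N\<bar>"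
      by (intro tendsto_intros LIMSEQ_realpow_zero a)
    then have "eventually (\<lambda>m. a ^ m * \<bar>z N\<bar> < \<epsilon> / 2) sequentially"
      using \<epsilon> by (intro order_tendstoD(2)) auto
    then obtain M where M: "\<And>m. m \<ge> M \<Longrightarrow> a ^ m * \<bar>z N\<bar> < \<epsilon> / 2"
      by (auto simp: eventually_sequentially)
    show "\<exists>no. \<forall>n\<ge>no. norm (z n - 0) < \<epsilon>"
    proof (intro exI[of _ "N + M"] allI impI)
      fix n assume "n \<ge> N + M"
      then have "N + (n - N) = n" "a ^ (n - N) * \<bar>z N\<bar> < \<epsilon> / 2"
        using M[of "n - N"] by simp_all
      then show "norm (z n - 0) < \<epsilon>"
        using bound[of "n - N"] by simp
    qed
  qed
  then have "(\<lambda>L. z L + Y / (1 - a)) \<longlonglongrightarrow> 0 + Y / (1 - a)" by (intro tendsto_intros)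
  then show ?thesis by (simp add: z_def)
qed

lemma power_increment_asymp:
  "(\<lambda>L::nat. (real (Suc L) ^ Suc m - real L ^ Suc m) / real L ^ m) \<longlonglongrightarrow> real (Suc m)"
proof (induction m)
  case 0
  show ?case by simp
next
  case (Suc m)
  \<comment> \<open>With \<open>S = L + 1\<close>, this is \<open>S ^ (m+2) - L ^ (m+2) = (S ^ (m+1)
    - L ^ (m+1)) * S + L ^ (m+1)\<close> divided by \<open>L ^ (m+1)\<close>.\<close>
  have "(\<lambda>L::nat. (real (Suc L) ^ Suc m - real L ^ Suc m) / real L ^ m * (real (Suc L) / real L) + 1)
      \<longlonglongrightarrow> real (Suc m) * 1 + 1"
    by (intro tendsto_intros Suc.IH) real_asymp
  moreover have "eventually (\<lambda>L::nat. (real (Suc L) ^ Suc m - real L ^ Suc m) / real L ^ m * (real (Suc L) / real L) + 1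
      = (real (Suc L) ^ Suc (Suc m) - real L ^ Suc (Suc m)) / real L ^ Suc m) sequentially"
    using eventually_gt_at_top[of "0::nat"]
    by eventually_elim (simp add: field_simps)
  ultimately show ?case
    by (rule Lim_transform_eventually[THEN tendsto_eq_rhs]) simp
qed

text \<open>The Stolz-Cesaro theorem for the denominators \<open>L ^ (m+1)\<close>, whose increments
  are asymptotic to \<open>(m+1) * L ^ m\<close>. Subtracting \<open>D' * b\<close> from
  \<open>x\<close> reduces it to the limit 0, where small relative increments telescope.\<close>

lemma stolz_cesaro_power:
  fixes x :: "nat \<Rightarrow> real"
  assumes lim: "(\<lambda>L. (x (Suc L) - x L) / real L ^ m) \<longlonglongrightarrow> D"
  shows "(\<lambda>L. x L / real L ^ Suc m) \<longlonglongrightarrow> D / real (Suc m)"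
proof -
  define b where "b L = real L ^ Suc m" for L
  define D' where "D' = D / real (Suc m)"
  define z where "z L = x L - D' * b L" for L
  have b: "(\<lambda>L. (b (Suc L) - b L) / real L ^ m) \<longlonglongrightarrow> real (Suc m)"
    unfolding b_def by (rule power_increment_asymp)
  have "(\<lambda>L. (x (Suc L) - x L) / real L ^ m - D' * ((b (Suc L) - b L) / real L ^ m))
      \<longlonglongrightarrow> D - D' * real (Suc m)"
    by (intro tendsto_intros lim b)
  also have "D - D' * real (Suc m) = 0" by (simp add: D'_def del: of_nat_Suc)
  also have "(\<lambda>L. (x (Suc L) - x L) / real L ^ m - D' * ((b (Suc L) - b L) / real L ^ m))
      = (\<lambda>L. (z (Suc L) - z L) / real L ^ m)"
    unfolding z_def by (simp add: diff_divide_distrib right_diff_distrib fun_eq_iff)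
  finally have z: "(\<lambda>L. (z (Suc L) - z L) / real L ^ m) \<longlonglongrightarrow> 0" .
  have "(\<lambda>L. z L / b L) \<longlonglongrightarrow> 0"
  proof (rule LIMSEQ_I)
    fix \<epsilon> :: real assume \<epsilon>: "\<epsilon> > 0"
    obtain N1 where N1: "\<And>L. L \<ge> N1 \<Longrightarrow> \<bar>(z (Suc L) - z L) / real L ^ m\<bar> < \<epsilon> / 2"
      using tendstoD[OF z, of "\<epsilon> / 2"] \<epsilon> by (auto simp: eventually_sequentially dist_real_def)
    define N where "N = Suc N1"
    have step: "\<bar>z (Suc L) - z L\<bar> \<le> \<epsilon> / 2 * (b (Suc L) - b L)" if "L \<ge> N" for L
    proof -
      have L: "L > 0" "L \<ge> N1" using that by (auto simp: N_def)
      have "\<bar>z (Suc L) - z L\<bar> \<le> \<epsilon> / 2 * real L ^ m"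
        using N1[OF L(2)] L(1) by (simp add: abs_divide field_simps)
      also have "real L ^ m \<le> b (Suc L) - b L"
      proof -
        have "real L ^ m * real L + real L ^ m = real L ^ m * real (Suc L)" by (simp add: algebra_simps)
        also have "\<dots> \<le> real (Suc L) ^ m * real (Suc L)"
          by (intro mult_right_mono power_mono) auto
        finally show ?thesis by (simp add: b_def algebra_simps)
      qed
      finally show ?thesis using \<epsilon> by simp
    qed
    have bound: "\<bar>z (N + k)\<bar> \<le> \<bar>z N\<bar> + \<epsilon> / 2 * b (N + k)" for k
    proof (induction k)
      case 0
      show ?case using \<epsilon> by (simp add: b_def)
    next
      case (Suc k)
      then show ?case using step[of "N + k"] by (simp add: algebra_simps abs_if split: if_splits)
    qed
    have "(\<lambda>L. \<bar>z N\<bar> / b L) \<longlonglongrightarrow> 0"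
      unfolding b_def
      by (intro tendsto_divide_0[OF tendsto_const] filterlim_at_top_imp_at_infinity
           filterlim_pow_at_top filterlim_real_sequentially) auto
    then have "eventually (\<lambda>L. \<bar>z N\<bar> / b L < \<epsilon> / 2) sequentially"
      using \<epsilon> by (intro order_tendstoD(2)) auto
    then obtain M where M: "\<And>L. L \<ge> M \<Longrightarrow> \<bar>z N\<bar> / b L < \<epsilon> / 2"
      by (auto simp: eventually_sequentially)
    show "\<exists>no. \<forall>n\<ge>no. norm (z n / b n - 0) < \<epsilon>"
    proof (intro exI[of _ "N + M"] allI impI)
      fix n assume n: "n \<ge> N + M"
      then have b0: "b n > 0" by (auto simp: b_def N_def)
      have "\<bar>z n\<bar> / b n \<le> \<bar>z N\<bar> / b n + \<epsilon> / 2"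
        using bound[of "n - N"] n b0 by (simp add: field_simps)
      also have "\<dots> < \<epsilon> / 2 + \<epsilon> / 2" using M[of n] n by linarith
      finally show "norm (z n / b n - 0) < \<epsilon>"
        using b0 by (simp add: abs_divide)
    qed
  qed
  then have "(\<lambda>L. z L / b L + D') \<longlonglongrightarrow> 0 + D'" by (intro tendsto_intros)
  moreover have "eventually (\<lambda>L. z L / b L + D' = x L / b L) sequentially"
    using eventually_gt_at_top[of "0::nat"]
    by eventually_elim (simp add: z_def b_def field_simps)
  ultimately have "(\<lambda>L. x L / b L) \<longlonglongrightarrow> 0 + D'"
    by (rule Lim_transform_eventually)
  then show ?thesis by (simp add: D'_def b_def)
qed

lemma fps_power_tendsto:
  fixes v :: "nat \<Rightarrow> real fps"
  assumes "\<And>j. j \<le> n \<Longrightarrow> (\<lambda>L. v L $ j) \<longlonglongrightarrow> C $ j"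
  shows "(\<lambda>L. (v L ^ k) $ n) \<longlonglongrightarrow> (C ^ k) $ n"
  using assms
proof (induction k arbitrary: n)
  case 0
  show ?case by simp
next
  case (Suc k)
  show ?case
    unfolding power_Suc fps_mult_nth
    by (intro tendsto_sum tendsto_mult Suc) auto
qed

text \<open>Without constant terms, the coefficient of order \<open>n\<close> of a power of exponent at least two
  depends only on the coefficients of order below \<open>n\<close>.\<close>

lemma fps_power_tendsto_strict:
  fixes v :: "nat \<Rightarrow> real fps"
  assumes lim: "\<And>j. j < n \<Longrightarrow> (\<lambda>L. v L $ j) \<longlonglongrightarrow> C $ j"
    and zero: "\<And>L. v L $ 0 = 0" "C $ 0 = 0" and k: "k \<ge> 2"
  shows "(\<lambda>L. (v L ^ k) $ n) \<longlonglongrightarrow> (C ^ k) $ n"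
proof -
  obtain k' where k': "k = Suc k'" "k' \<noteq> 0" using k by (cases k) auto
  have "(\<lambda>L. v L $ i * (v L ^ k') $ (n - i)) \<longlonglongrightarrow> C $ i * (C ^ k') $ (n - i)" if i: "i \<le> n" for i
  proof -
    consider "i = 0" | "i = n" | "0 < i" "i < n" using i by linarith
    then show ?thesis
    proof cases
      case 1
      then show ?thesis using zero by simp
    next
      case 2
      then show ?thesis using zero k' by (simp add: fps_power_zeroth power_0_left)
    next
      case 3
      then show ?thesis by (intro tendsto_mult lim fps_power_tendsto) auto
    qed
  qed
  then show ?thesis
    unfolding k' power_Suc fps_mult_nth by (intro tendsto_sum) auto
qed

text \<open>Each regime renormalises the Taylor coefficients in this form. With \<open>l\<close> the
  multiplier, \<open>(a, b)\<close> is \<open>(1/l^L, 1)\<close> in the supercritical,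
  \<open>(1/L, L)\<close> in the critical and \<open>(1, 1/l^L)\<close> in the subcritical
  case.\<close>

lemma fps_power_scale:
  fixes u :: "real fps"
  shows "(Abs_fps (\<lambda>n. u $ n * a ^ n * b) ^ k) $ n = (u ^ k) $ n * a ^ n * b ^ k"
proof (induction k arbitrary: n)
  case 0
  show ?case by (cases n) auto
next
  case (Suc k)
  have "(Abs_fps (\<lambda>n. u $ n * a ^ n * b) ^ Suc k) $ n
      = (\<Sum>i=0..n. u $ i * a ^ i * b * ((u ^ k) $ (n - i) * a ^ (n - i) * b ^ k))"
    unfolding power_Suc fps_mult_nth by (simp add: Suc)
  also have "\<dots> = (\<Sum>i=0..n. u $ i * (u ^ k) $ (n - i) * a ^ n * b ^ Suc k)"
    by (intro sum.cong refl) (auto simp: power_add[symmetric] mult_ac)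
  finally show ?case
    by (simp add: fps_mult_nth sum_distrib_right)
qed

lemma fps_power_nonneg:
  fixes C :: "real fps"
  assumes "\<And>j. C $ j \<ge> 0"
  shows "(C ^ k) $ n \<ge> 0"
proof (induction k arbitrary: n)
  case 0
  show ?case by (cases n) auto
next
  case (Suc k)
  then show ?case unfolding power_Suc fps_mult_nth using assms by (intro sum_nonneg) auto
qed

text \<open>The single product of the coefficients of orders 1 and \<open>n - 1\<close> suffices.
  Through the quadratic term of the recursion this makes the leading constants positive.\<close>

lemma fps_square_pos:
  fixes C :: "real fps"
  assumes "\<And>j. C $ j \<ge> 0" "C $ 1 > 0" "C $ (n - 1) > 0" "n \<ge> 2"
  shows "(C ^ 2) $ n > 0"
proof -
  have "0 < C $ 1 * C $ (n - 1)" using assms by simp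
  also have "\<dots> \<le> (\<Sum>i=0..n. C $ i * C $ (n - i))"
    using assms by (intro member_le_sum) auto
  finally show ?thesis by (simp add: power2_eq_square fps_mult_nth)
qed

text \<open>Here \<open>u L\<close> stands for the Taylor series at the fixed point of the
  \<open>L\<close>-th iterate without its constant term, and \<open>rec\<close> is the composition
  \<open>P oo u L\<close> written coefficientwise. Everything is restricted to orders up to
  \<open>r\<close>, since the iterated function may have no further derivatives.\<close>

locale jet_recursion =
  fixes u :: "nat \<Rightarrow> real fps" and P :: "real fps" and r :: nat
  assumes zero: "u L $ 0 = 0"
    and rec: "L \<ge> 1 \<Longrightarrow> n \<le> r \<Longrightarrow> u (Suc L) $ n = (\<Sum>k=0..n. P $ k * (u L ^ k) $ n)"
    and init: "n \<le> r \<Longrightarrow> u 1 $ n = P $ n"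
    and nonneg: "n \<le> r \<Longrightarrow> P $ n \<ge> 0"
begin



lemma rec': 
  assumes "L \<ge> 1" "1 \<le> n" "n \<le> r" 
  shows "u (Suc L) $ n = P $ 1 * u L $ n + (\<Sum>k=2..n. P $ k * (u L ^ k) $ n)"
proof -
  have "{0..n} = insert 0 (insert 1 {2..n})" using assms by auto
  then show ?thesis using rec[OF assms(1,3)] assms by simp
qed

lemma first: "L \<ge> 1 \<Longrightarrow> 1 \<le> r \<Longrightarrow> u L $ 1 = (P $ 1) ^ L"
proof (induction L rule: dec_induct)
  case base
  then show ?case using init[of 1] by simp
next
  case (step L)
  then show ?case using rec'[of L 1] by simp
qed

text \<open>With \<open>l\<close> the multiplier, the normalised coefficient \<open>v L $ n\<close>
  satisfies a linear recursion with factor \<open>l ^ (1 - n)\<close>, a contraction for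
  \<open>n \<ge> 2\<close>. Its forcing term involves only lower orders and converges to a positive
  limit because \<open>P $ 2 > 0\<close>.\<close>

lemma supercritical:
  assumes "P $ 1 > 1" "r \<ge> 2 \<Longrightarrow> P $ 2 > 0" "1 \<le> n" "n \<le> r"
  shows "\<exists>c>0. (\<lambda>L. u L $ n / (P $ 1) ^ (n * L)) \<longlonglongrightarrow> c"
  using assms(3,4)
proof (induction n rule: less_induct)
  case (less n)
  let ?l = "P $ 1"
  show ?case
  proof (cases "n = 1")
    case True
    have "(\<lambda>L. u L $ n / ?l ^ (n * L)) \<longlonglongrightarrow> 1"
      by (rule tendsto_eventually, use eventually_ge_at_top[of 1] in eventually_elim)
        (use first True less.prems assms(1) in auto)
    then show ?thesis by (intro exI[of _ 1]) simp
  next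
    case False
    then have n: "n \<ge> 2" using less.prems by simp
    have "\<exists>c. \<forall>j\<in>{1..<n}. c j > 0 \<and> (\<lambda>L. u L $ j / ?l ^ (j * L)) \<longlonglongrightarrow> c j"
      by (rule bchoice) (use less in auto)
    then obtain c where c': "\<forall>j\<in>{1..<n}. c j > 0 \<and> (\<lambda>L. u L $ j / ?l ^ (j * L)) \<longlonglongrightarrow> c j" by blast
    have c: "c j > 0" "(\<lambda>L. u L $ j / ?l ^ (j * L)) \<longlonglongrightarrow> c j" if "1 \<le> j" "j < n" for j
      using c' that by simp_all
    \<comment> \<open>Setting the entries from order \<open>n\<close> on to 0 is harmless: in powers
      of exponent at least two, the coefficient of order \<open>n\<close> sees only entries below
      \<open>n\<close>.\<close>
    define C where "C = Abs_fps (\<lambda>j. if 1 \<le> j \<and> j < n then c j else 0)"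
    define v where "v L = Abs_fps (\<lambda>j. u L $ j * (inverse ?l ^ L) ^ j * 1)" for L
    have vC: "(\<lambda>L. v L $ j) \<longlonglongrightarrow> C $ j" if "j < n" for j
    proof (cases "j = 0")
      case True
      then show ?thesis by (simp add: v_def C_def zero)
    next
      case False
      then show ?thesis using c(2)[of j] that
        by (simp add: v_def C_def divide_inverse power_inverse power_mult[symmetric] mult.commute)
    qed
    have "(\<lambda>L. \<Sum>k=2..n. P $ k * (v L ^ k) $ n) \<longlonglongrightarrow> (\<Sum>k=2..n. P $ k * (C ^ k) $ n)"
      by (intro tendsto_intros fps_power_tendsto_strict vC) (auto simp: v_def C_def zero)
    moreover have Cn: "C $ j \<ge> 0" for j using c(1)[of j] by (simp add: C_def less_imp_le)
    have "(\<Sum>k=2..n. P $ k * (C ^ k) $ n) > 0"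
    proof (rule sum_pos2[of _ 2])
      have "(C ^ 2) $ n > 0"
        by (rule fps_square_pos[OF Cn]) (use c(1) n in \<open>auto simp: C_def\<close>)
      then show "0 < P $ 2 * (C ^ 2) $ n" using assms(2) n less.prems by simp
    qed (use n less.prems nonneg fps_power_nonneg[OF Cn] in auto)
    ultimately obtain D where D: "D > 0" "(\<lambda>L. \<Sum>k=2..n. P $ k * (v L ^ k) $ n) \<longlonglongrightarrow> D"
      by blast
    have "(\<lambda>L. v L $ n) \<longlonglongrightarrow> (inverse ?l ^ n * D) / (1 - ?l * inverse ?l ^ n)"
    proof (rule linear_recursion_tendsto[where m = 1])
      fix L :: nat assume L: "L \<ge> 1"
      have e: "(inverse ?l ^ Suc L) ^ n = inverse ?l ^ n * (inverse ?l ^ L) ^ n"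
        by (simp add: power_mult_distrib)
      have "v (Suc L) $ n = (?l * u L $ n + (\<Sum>k=2..n. P $ k * (u L ^ k) $ n)) * (inverse ?l ^ Suc L) ^ n"
        unfolding v_def using rec'[OF L less.prems] by simp
      also have "\<dots> = inverse ?l ^ n * (?l * (u L $ n * (inverse ?l ^ L) ^ n) + 
         (\<Sum>k=2..n. P $ k * ((u L ^ k) $ n * (inverse ?l ^ L) ^ n)))"
        unfolding e by (simp add: algebra_simps sum_distrib_left sum_distrib_right)
      also have "\<dots> = ?l * inverse ?l ^ n * v L $ n + inverse ?l ^ n * (\<Sum>k=2..n. P $ k * (v L ^ k) $ n)"
        unfolding v_def fps_power_scale by (simp add: algebra_simps)
      finally show "v (Suc L) $ n = ?l * inverse ?l ^ n * v L $ n + inverse ?l ^ n * (\<Sum>k=2..n. P $ k * (v L ^ k) $ n)" .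
    next
      have "?l * inverse ?l ^ n = inverse ?l ^ (n - 1)"
        using n assms(1) by (cases n) auto
      also have "\<dots> < 1" using n assms(1) by (intro power_less_one_iff[THEN iffD2] conjI) (auto simp: field_simps power_less_one_iff)
      finally show "?l * inverse ?l ^ n < 1" .
    qed (use assms(1) D in \<open>auto intro!: tendsto_intros\<close>)
    moreover have "(inverse ?l ^ n * D) / (1 - ?l * inverse ?l ^ n) > 0"
    proof -
      have "?l * inverse ?l ^ n = inverse ?l ^ (n - 1)"
        using n assms(1) by (cases n) auto
      also have "\<dots> < 1" using n assms(1) by (auto simp: field_simps power_less_one_iff)
      finally show ?thesis using D assms(1) by simp
    qed
    moreover have "v L $ n = u L $ n / ?l ^ (n * L)" for L
      by (simp add: v_def divide_inverse power_inverse power_mult[symmetric] mult.commute)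
    ultimately show ?thesis by auto
  qed
qed

text \<open>With multiplier 1 the linear term cancels in \<open>u (Suc L) $ n - u L $ n\<close>. The
  term with \<open>u L ^ k\<close> is of order \<open>L ^ (n - k)\<close>, so the quadratic one
  dominates and summation raises the exponent \<open>n - 2\<close> to \<open>n - 1\<close>.\<close>

lemma critical:
  assumes "P $ 1 = 1" "r \<ge> 2 \<Longrightarrow> P $ 2 > 0" "1 \<le> n" "n \<le> r"
  shows "\<exists>c>0. (\<lambda>L. u L $ n / real L ^ (n - 1)) \<longlonglongrightarrow> c"
  using assms(3,4)
proof (induction n rule: less_induct)
  case (less n)
  show ?case
  proof (cases "n = 1")
    case True
    have "(\<lambda>L. u L $ n / real L ^ (n - 1)) \<longlonglongrightarrow> 1"
      by (rule tendsto_eventually, use eventually_ge_at_top[of 1] in eventually_elim)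
        (use first True less.prems assms(1) in auto)
    then show ?thesis by (intro exI[of _ 1]) simp
  next
    case False
    then have n: "n \<ge> 2" using less.prems by simp
    have "\<exists>c. \<forall>j\<in>{1..<n}. c j > 0 \<and> (\<lambda>L. u L $ j / real L ^ (j - 1)) \<longlonglongrightarrow> c j"
      by (rule bchoice) (use less in auto)
    then obtain c where c': "\<forall>j\<in>{1..<n}. c j > 0 \<and> (\<lambda>L. u L $ j / real L ^ (j - 1)) \<longlonglongrightarrow> c j" by blast
    have c: "c j > 0" "(\<lambda>L. u L $ j / real L ^ (j - 1)) \<longlonglongrightarrow> c j" if "1 \<le> j" "j < n" for j
      using c' that by simp_all
    define C where "C = Abs_fps (\<lambda>j. if 1 \<le> j \<and> j < n then c j else 0)"
    \<comment> \<open>A product instead of the quotient by \<open>L ^ (j - 1)\<close>, so that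
      \<open>fps_power_scale\<close> applies and no truncated subtraction occurs at
      \<open>j = 0\<close>.\<close>
    define v where "v L = Abs_fps (\<lambda>j. u L $ j * inverse (real L) ^ j * real L)" for L
    have v: "v L $ j = u L $ j / real L ^ (j - 1)" if "j \<ge> 1" "L \<ge> 1" for j L
      using that by (cases j) (auto simp: v_def field_simps)
    have vC: "(\<lambda>L. v L $ j) \<longlonglongrightarrow> C $ j" if "j < n" for j
    proof (cases "j = 0")
      case True
      then show ?thesis by (simp add: v_def C_def zero)
    next
      case False
      have "eventually (\<lambda>L. u L $ j / real L ^ (j - 1) = v L $ j) sequentially"
        using eventually_ge_at_top[of 1] by eventually_elim (use v False in auto)
      from Lim_transform_eventually[OF c(2)[of j] this] show ?thesis using that False
        by (simp add: C_def)
    qed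
    have Cn: "C $ j \<ge> 0" for j using c(1)[of j] by (simp add: C_def less_imp_le)
    have C2: "(C ^ 2) $ n > 0"
      by (rule fps_square_pos[OF Cn]) (use c(1) n in \<open>auto simp: C_def\<close>)
    define D where "D = P $ 2 * (C ^ 2) $ n"
    have D: "D > 0" using assms(2) n less.prems C2 by (simp add: D_def)
    have "(\<lambda>L. (u (Suc L) $ n - u L $ n) / real L ^ (n - 2)) \<longlonglongrightarrow> D"
    proof -
      have "(\<lambda>L. P $ k * ((v L ^ k) $ n * inverse (real L) ^ (k - 2)))
          \<longlonglongrightarrow> (if k = 2 then D else 0)" if "k \<in> {2..n}" for k
      proof -
        have "(\<lambda>L. (v L ^ k) $ n) \<longlonglongrightarrow> (C ^ k) $ n"
          by (rule fps_power_tendsto_strict[OF vC]) (use that in \<open>auto simp: v_def C_def zero\<close>)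
        \<comment> \<open>The limit \<open>0 ^ (k - 2)\<close> is 1 for \<open>k = 2\<close> and 0
          otherwise, which selects the quadratic term.\<close>
        moreover have "(\<lambda>L::nat. inverse (real L) ^ (k - 2)) \<longlonglongrightarrow> 0 ^ (k - 2)"
          by (intro tendsto_power lim_inverse_n)
        ultimately have "(\<lambda>L. P $ k * ((v L ^ k) $ n * inverse (real L) ^ (k - 2)))
            \<longlonglongrightarrow> P $ k * ((C ^ k) $ n * 0 ^ (k - 2))" by (rule tendsto_mult[OF tendsto_const tendsto_mult])
        also have "P $ k * ((C ^ k) $ n * 0 ^ (k - 2)) = (if k = 2 then D else 0)"
          using that by (auto simp: D_def)
        finally show ?thesis .
      qed
      then have "(\<lambda>L. \<Sum>k=2..n. P $ k * ((v L ^ k) $ n * inverse (real L) ^ (k - 2)))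
         \<longlonglongrightarrow> (\<Sum>k=2..n. if k = 2 then D else 0)" by (intro tendsto_sum)
      also have "(\<Sum>k=2..n. if k = 2 then D else 0) = D" using n by simp
      finally show ?thesis
      proof (rule Lim_transform_eventually)
        show "eventually (\<lambda>L. (\<Sum>k=2..n. P $ k * ((v L ^ k) $ n * inverse (real L) ^ (k - 2)))
           = (u (Suc L) $ n - u L $ n) / real L ^ (n - 2)) sequentially"
          using eventually_ge_at_top[of 1]
        proof eventually_elim
          fix L :: nat assume L: "L \<ge> 1"
          have "(v L ^ k) $ n * inverse (real L) ^ (k - 2) = (u L ^ k) $ n / real L ^ (n - 2)" if "k \<in> {2..n}" for k
          proof -
            define i j where "i = k - 2" and "j = n - 2"
            have i: "k = i + 2" and j: "n = j + 2" using that n by (auto simp: i_def j_def)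
            show ?thesis unfolding v_def fps_power_scale i j using L
              by (simp add: field_simps power_add power2_eq_square)
          qed
          then show "(\<Sum>k=2..n. P $ k * ((v L ^ k) $ n * inverse (real L) ^ (k - 2)))
             = (u (Suc L) $ n - u L $ n) / real L ^ (n - 2)"
            using rec'[OF L less.prems] assms(1) by (simp add: sum_divide_distrib)
        qed
      qed
    qed
    from stolz_cesaro_power[OF this] 
    have "(\<lambda>L. u L $ n / real L ^ (n - 1)) \<longlonglongrightarrow> D / real (n - 1)"
      using n by (simp add: Suc_diff_Suc numeral_2_eq_2)
    then show ?thesis using D n by (intro exI[of _ "D / real (n - 1)"]) auto
  qed
qed

text \<open>All orders decay at the same rate: after division by the \<open>L\<close>-th power of
  the multiplier, the nonlinear terms are still geometrically small, so the increments are summable.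
  The limit may be 0, hence only an upper bound results.\<close>

lemma subcritical:
  assumes "0 < P $ 1" "P $ 1 < 1" "1 \<le> n" "n \<le> r"
  shows "\<exists>c. (\<lambda>L. u L $ n / (P $ 1) ^ L) \<longlonglongrightarrow> c"
  using assms(3,4)
proof (induction n rule: less_induct)
  case (less n)
  let ?l = "P $ 1"
  have "\<exists>c. \<forall>j\<in>{1..<n}. (\<lambda>L. u L $ j / ?l ^ L) \<longlonglongrightarrow> c j"
    by (rule bchoice) (use less in auto)
  then obtain c where c': "\<forall>j\<in>{1..<n}. (\<lambda>L. u L $ j / ?l ^ L) \<longlonglongrightarrow> c j" by blast
  have c: "(\<lambda>L. u L $ j / ?l ^ L) \<longlonglongrightarrow> c j" if "1 \<le> j" "j < n" for j
    using c' that by simp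
  define C where "C = Abs_fps (\<lambda>j. if 1 \<le> j \<and> j < n then c j else 0)"
  define v where "v L = Abs_fps (\<lambda>j. u L $ j * 1 ^ j * inverse (?l ^ L))" for L
  have vC: "(\<lambda>L. v L $ j) \<longlonglongrightarrow> C $ j" if "j < n" for j
    using c[of j] that by (cases "j = 0") (simp_all add: v_def C_def zero divide_inverse)
  have "convergent (\<lambda>L. (v L ^ k) $ n)" if "k \<in> {2..n}" for k
    unfolding convergent_def by (intro exI, rule fps_power_tendsto_strict[OF vC]) (use that in \<open>auto simp: v_def C_def zero\<close>)
  then have "Bseq (\<lambda>L. (v L ^ k) $ n)" if "k \<in> {2..n}" for k
    using that by (blast intro: convergent_imp_Bseq)
  then have "\<exists>B. \<forall>k\<in>{2..n}. \<forall>L. \<bar>(v L ^ k) $ n\<bar> \<le> B k"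
    by (intro bchoice) (force simp: Bseq_def)
  then obtain B where B: "\<And>k L. k \<in> {2..n} \<Longrightarrow> \<bar>(v L ^ k) $ n\<bar> \<le> B k" by blast
  \<comment> \<open>The division by the multiplier comes from normalising the step
    \<open>Suc L\<close> by one more power of it than the step \<open>L\<close>.\<close>
  define K where "K = (\<Sum>k=2..n. P $ k * B k) / ?l"
  have diff: "\<bar>v (Suc L) $ n - v L $ n\<bar> \<le> K * ?l ^ L" if L: "L \<ge> 1" for L
  proof -
    have "v (Suc L) $ n - v L $ n = (\<Sum>k=2..n. P $ k * (u L ^ k) $ n) * inverse (?l ^ Suc L)"
      unfolding v_def using rec'[OF L less.prems] assms by (simp add: field_simps)
    also have "\<dots> = (\<Sum>k=2..n. P $ k * ((v L ^ k) $ n * ?l ^ (L * (k - 1)))) / ?l"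
      unfolding sum_divide_distrib sum_distrib_right
    proof (intro sum.cong refl)
      fix k assume k: "k \<in> {2..n}"
      then obtain i where i: "k = Suc i" by (cases k) auto
      show "P $ k * (u L ^ k) $ n * inverse (?l ^ Suc L) = P $ k * ((v L ^ k) $ n * ?l ^ (L * (k - 1))) / ?l"
        unfolding v_def fps_power_scale i using assms
        by (simp add: field_simps power_mult[symmetric] power_add[symmetric])
    qed
    also have "\<bar>\<dots>\<bar> \<le> (\<Sum>k=2..n. P $ k * (B k * ?l ^ L)) / ?l"
    proof -
      have "\<bar>\<Sum>k=2..n. P $ k * ((v L ^ k) $ n * ?l ^ (L * (k - 1)))\<bar> \<le> (\<Sum>k=2..n. P $ k * (B k * ?l ^ L))"
      proof (rule order_trans[OF sum_abs sum_mono])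
        fix k assume k: "k \<in> {2..n}"
        have "?l ^ (L * (k - 1)) \<le> ?l ^ L"
          using k assms by (intro power_decreasing) auto
        then have "\<bar>(v L ^ k) $ n\<bar> * ?l ^ (L * (k - 1)) \<le> B k * ?l ^ L"
          using B[OF k, of L] assms by (intro mult_mono) auto
        then show "\<bar>P $ k * ((v L ^ k) $ n * ?l ^ (L * (k - 1)))\<bar> \<le> P $ k * (B k * ?l ^ L)"
          using nonneg[of k] k less.prems assms by (auto simp: abs_mult intro!: mult_left_mono)
      qed
      then show ?thesis using assms by (simp add: divide_right_mono)
    qed
    also have "\<dots> = K * ?l ^ L" by (simp add: K_def sum_distrib_right mult.assoc)
    finally show ?thesis .
  qed
  have "summable (\<lambda>L. v (Suc L) $ n - v L $ n)"
  proof (rule summable_comparison_test')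
    show "summable (\<lambda>L. K * ?l ^ L)" using assms by (intro summable_mult summable_geometric) auto
  qed (use diff in auto)
  then have "convergent (\<lambda>L. v L $ n - v 0 $ n)"
    unfolding summable_iff_convergent sum_lessThan_telescope[of "\<lambda>L. v L $ n"] .
  then have "convergent (\<lambda>L. v L $ n)"
    unfolding convergent_diff_const_right_iff .
  then show ?case by (auto simp: convergent_def v_def divide_inverse)
qed

end

section \<open>Normalized Gegenbauer polynomials\<close>

definition jacobi_weight :: "nat \<Rightarrow> real \<Rightarrow> real" where
  "jacobi_weight d x = (1 - x\<^sup>2) powr (real d / 2 - 1)"

lemma jacobi_weight_measurable [measurable]: "jacobi_weight d \<in> borel_measurable borel"
  unfolding jacobi_weight_def by measurable

lemma jacobi_weight_nonneg: "jacobi_weight d x \<ge> 0"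
  by (simp add: jacobi_weight_def)

lemma jacobi_weight_pos: "x \<in> {-1<..<1} \<Longrightarrow> jacobi_weight d x > 0"
  by (auto simp: jacobi_weight_def abs_square_less_1 abs_square_eq_1)

lemma jacobi_weight_le_1:
  assumes "d \<ge> 2" "x \<in> {-1..1}"
  shows "jacobi_weight d x \<le> 1"
proof -
  have "x\<^sup>2 \<le> 1" using assms by (simp add: abs_square_le_1 abs_le_iff)
  then show ?thesis unfolding jacobi_weight_def using assms by (intro powr_le1) auto
qed

lemma set_integrable_weight:
  assumes d: "d \<ge> 2" and f: "f \<in> borel_measurable borel"
    and bd: "\<And>x. x \<in> {-1..1} \<Longrightarrow> \<bar>f x\<bar> \<le> B"
  shows "set_integrable lborel {-1..1} (\<lambda>x. f x * jacobi_weight d x)"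
  unfolding set_integrable_def
proof (rule Bochner_Integration.integrable_bound)
  show "integrable lborel (\<lambda>x. indicator {-1..1::real} x *\<^sub>R B)"
    by (intro integrable_indicator) auto
  show "(\<lambda>x. indicator {-1..1} x *\<^sub>R (f x * jacobi_weight d x)) \<in> borel_measurable lborel"
    using f by measurable
  show "AE x in lborel. norm (indicator {-1..1} x *\<^sub>R (f x * jacobi_weight d x))
      \<le> norm (indicator {-1..1::real} x *\<^sub>R B)"
  proof (intro AE_I2)
    fix x :: real
    show "norm (indicator {-1..1} x *\<^sub>R (f x * jacobi_weight d x))
      \<le> norm (indicator {-1..1::real} x *\<^sub>R B)"
    proof (cases "x \<in> {-1..1}")
      case True
      have "\<bar>f x\<bar> * jacobi_weight d x \<le> B * 1"
        using bd[OF True] jacobi_weight_le_1[OF d True] jacobi_weight_nonneg[of d x]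
        by (intro mult_mono) auto
      then show ?thesis using True jacobi_weight_nonneg[of d x] by (simp add: abs_mult)
    qed simp
  qed
qed

lemma set_integrable_weight_continuous:
  assumes "d \<ge> 2" and f: "continuous_on {-1..1} f"
  shows "set_integrable lborel {-1..1} (\<lambda>x. f x * jacobi_weight d x)"
proof -
  have "bounded (f ` {-1..1})"
    using f by (intro compact_imp_bounded compact_continuous_image) auto
  then obtain B where B: "\<forall>x\<in>{-1..1}. \<bar>f x\<bar> \<le> B"
    by (auto simp: bounded_iff)
  \<comment> \<open>Continuity is known only on \<open>[-1, 1]\<close>; the cut-off yields a Borel
    function on the whole line.\<close>
  define g where "g x = indicator {-1..1} x *\<^sub>R f x" for x
  have "set_integrable lborel {-1..1} (\<lambda>x. g x * jacobi_weight d x)"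
  proof (rule set_integrable_weight[OF assms(1)])
    show "g \<in> borel_measurable borel"
      using borel_measurable_continuous_on_indicator[OF _ f] unfolding g_def by simp
    show "\<bar>g x\<bar> \<le> B" if "x \<in> {-1..1}" for x using B that by (simp add: g_def)
  qed
  then show ?thesis
    by (rule set_integrable_cong[THEN iffD1, rotated -1]) (auto simp: g_def)
qed

text \<open>The conclusion concerns the open interval because the weight vanishes at the
  endpoints.\<close>

lemma weight_integral_eq_0_AE:
  assumes int: "set_integrable lborel {-1..1} (\<lambda>x. f x * jacobi_weight d x)"
    and nn: "\<And>x. x \<in> {-1..1} \<Longrightarrow> f x \<ge> 0"
    and zero: "(LINT x:{-1..1}|lborel. f x * jacobi_weight d x) = 0"
  shows "AE x in lborel. x \<in> {-1<..<1} \<longrightarrow> f x = 0"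
proof -
  have "AE x in lborel. indicator {-1..1} x *\<^sub>R (f x * jacobi_weight d x) = 0"
    using zero int unfolding set_lebesgue_integral_def set_integrable_def
    by (subst (asm) integral_nonneg_eq_0_iff_AE)
      (auto simp: indicator_def jacobi_weight_nonneg nn)
  then show ?thesis
  proof eventually_elim
    fix x assume *: "indicator {-1..1} x *\<^sub>R (f x * jacobi_weight d x) = 0"
    show "x \<in> {-1<..<1} \<longrightarrow> f x = 0"
    proof
      assume "x \<in> {-1<..<1}"
      with * jacobi_weight_pos[of x d] show "f x = 0" by (auto simp: indicator_def)
    qed
  qed
qed

lemma not_AE_interval:
  assumes "a < (b::real)" shows "\<not> (AE x in lborel. x \<notin> {a<..<b})"
proof
  assume "AE x in lborel. x \<notin> {a<..<b}"
  then have "{a<..<b} \<in> null_sets lborel"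
    by (subst AE_iff_null_sets) auto
  then have "emeasure lborel {a<..<b} = 0" by blast
  then show False using assms by simp
qed

text \<open>A nonzero polynomial has finitely many roots, so its square cannot vanish almost
  everywhere on an interval. This makes the weighted inner product definite.\<close>

lemma poly_weight_pos:
  assumes d: "d \<ge> 2"
    and zero: "(LINT x:{-1..1}|lborel. poly q x * poly q x * jacobi_weight d x) = 0"
  shows "q = 0"
proof (rule ccontr)
  assume q: "q \<noteq> 0"
  have "AE x in lborel. x \<in> {-1<..<1} \<longrightarrow> poly q x * poly q x = 0"
    using zero by (intro weight_integral_eq_0_AE[where d = d] set_integrable_weight_continuous[OF d] continuous_intros) auto
  moreover have "AE x in lborel. x \<notin> {x. poly q x = 0}"
    by (intro AE_not_in finite_imp_null_set_lborel poly_roots_finite q)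
  ultimately have "AE x in lborel. x \<notin> {-1<..<(1::real)}"
    by eventually_elim auto
  then show False using not_AE_interval[of "-1" 1] by simp
qed

locale gegenbauer =
  fixes d :: nat and G :: "nat \<Rightarrow> real poly"
  assumes d2: "d \<ge> 2" and G: "normalized_gegenbauer d G"
begin

section \<open>Orthogonality and the Gegenbauer differential equation\<close>

definition ip :: "real poly \<Rightarrow> real poly \<Rightarrow> real" where
  "ip p q = (LINT x:{-1..1}|lborel. poly p x * poly q x * jacobi_weight d x)"

text \<open>Unlike a bound on \<open>degree\<close>, this expresses being zero as the case
  \<open>n = 0\<close>, where inductions can start.\<close>

definition deg_below :: "nat \<Rightarrow> real poly \<Rightarrow> bool" where
  "deg_below n p \<longleftrightarrow> (\<forall>i\<ge>n. coeff p i = 0)"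

lemma deg_G: "degree (G l) = l" and G_at_1: "poly (G l) 1 = 1"
  using G by (auto simp: normalized_gegenbauer_def)

lemma lead_G: "coeff (G l) l \<noteq> 0"
  using deg_G[of l] G_at_1[of l] by (metis leading_coeff_0_iff poly_0 zero_neq_one)

lemma coeff_G_above: "i > l \<Longrightarrow> coeff (G l) i = 0"
  using deg_G[of l] by (simp add: coeff_eq_0)

lemma ip_integrable: "set_integrable lborel {-1..1} (\<lambda>x. poly p x * poly q x * jacobi_weight d x)"
  by (intro set_integrable_weight_continuous d2 continuous_intros)

lemma ip_commute: "ip p q = ip q p"
  by (simp add: ip_def mult.commute)

lemma ip_add: "ip p (q + r) = ip p q + ip p r"
  unfolding ip_def
  by (subst set_integral_add(2)[symmetric]) (simp_all add: ip_integrable distrib_left distrib_right left_diff_distrib)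

lemma ip_smult: "ip p (smult c q) = c * ip p q"
  unfolding ip_def by (subst set_integral_mult_right[symmetric]) (simp add: algebra_simps)

lemma ip_G_orth: "l \<noteq> m \<Longrightarrow> ip (G l) (G m) = 0"
  using G by (auto simp: normalized_gegenbauer_def ip_def jacobi_weight_def)

text \<open>Orthogonality within the sequence spreads to all polynomials of lower degree, since
  subtracting a multiple of \<open>G n\<close> removes the coefficient of order
  \<open>n\<close>.\<close>

lemma ip_G_deg_below: "deg_below n q \<Longrightarrow> n \<le> l \<Longrightarrow> ip (G l) q = 0"
proof (induction n arbitrary: q)
  case 0
  then have "q = 0" by (auto simp: deg_below_def poly_eq_iff)
  then show ?case using ip_smult[of "G l" 0 0] by simp
next
  case (Suc n)
  define c where "c = coeff q n / coeff (G n) n"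
  have "deg_below n (q + smult (- c) (G n))"
    unfolding deg_below_def
  proof (intro allI impI)
    fix i assume i: "i \<ge> n"
    show "coeff (q + smult (- c) (G n)) i = 0"
    proof (cases "i = n")
      case True
      then show ?thesis using lead_G[of n] by (simp add: c_def)
    next
      case False
      then show ?thesis using Suc.prems i coeff_G_above[of n i] by (simp add: deg_below_def)
    qed
  qed
  from Suc.IH[OF this] Suc.prems have "ip (G l) (q + smult (- c) (G n)) = 0" by simp
  then show ?case using ip_G_orth[of l n] Suc.prems by (simp add: ip_add ip_smult del: smult_minus_left)
qed

text \<open>The tool for proving identities about \<open>G l\<close>: it suffices that the leading
  terms cancel and that the rest is orthogonal to all lower degrees.\<close>

lemma orth_self_eq_0:
  assumes "deg_below l q" "\<And>r. deg_below l r \<Longrightarrow> ip q r = 0"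
  shows "q = 0"
  using poly_weight_pos[OF d2, of q] assms unfolding ip_def by blast

text \<open>The Laplace-Beltrami operator of the \<open>d\<close>-dimensional sphere on functions of
  one coordinate: \<open>(1 - x^2) p'' - d x p'\<close>.\<close>

definition A :: "real poly \<Rightarrow> real poly" where
  "A p = [:1, 0, -1:] * pderiv (pderiv p) - [:0, real d:] * pderiv p"

lemma coeff_A: "coeff (A p) i =
    real ((i + 2) * (i + 1)) * coeff p (i + 2) - real i * (real i + real d - 1) * coeff p i"
proof -
  consider "i = 0" | "i = 1" | j where "i = Suc (Suc j)"
    by (metis One_nat_def not0_implies_Suc)
  then show ?thesis
    by cases (auto simp: A_def coeff_pderiv coeff_pCons numeral_2_eq_2 algebra_simps split: nat.split)
qed

text \<open>\<open>A\<close> is a Sturm--Liouville operator: \<open>w (A p) = ((1 - x^2)^(d/2) p')'\<close>.\<close>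

lemma ip_A_symmetric: "ip (A p) q = ip p (A q)"
proof -
  define F where "F x = (1 - x\<^sup>2) powr (real d / 2) *
    (poly (pderiv p) x * poly q x - poly p x * poly (pderiv q) x)" for x
  define f where "f x = (poly (A p) x * poly q x - poly p x * poly (A q) x) * jacobi_weight d x" for x
  have f_int: "set_integrable lborel {-1..1} f"
    unfolding f_def by (intro set_integrable_weight_continuous d2 continuous_intros)
  have "(f has_integral (F 1 - F (-1))) {-1..1}"
  proof (rule fundamental_theorem_of_calculus_interior)
    have "(1::real) - x\<^sup>2 \<ge> 0" if "x \<in> {-1..1}" for x
      using that by (simp add: abs_square_le_1 abs_le_iff)
    then show "continuous_on {-1..1} F"
      unfolding F_def using d2 by (intro continuous_intros continuous_on_powr') auto
    fix x :: real assume x: "x \<in> {-1<..<1}"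
    then have pos: "1 - x\<^sup>2 > 0" by (simp add: abs_square_less_1 abs_less_iff)
    have e: "(1 - x\<^sup>2) powr (real d / 2) = (1 - x\<^sup>2) * jacobi_weight d x"
      using pos by (simp add: jacobi_weight_def powr_diff)
    have "((\<lambda>x. (1 - x\<^sup>2) powr (real d / 2)) has_real_derivative - (real d * x * jacobi_weight d x)) (at x)"
      using pos by (auto intro!: derivative_eq_intros simp: jacobi_weight_def)
    moreover have "((\<lambda>x. poly (pderiv p) x * poly q x - poly p x * poly (pderiv q) x) has_real_derivative
        poly (pderiv (pderiv p)) x * poly q x - poly p x * poly (pderiv (pderiv q)) x) (at x)"
      by (auto intro!: derivative_eq_intros poly_DERIV)
    ultimately have "(F has_real_derivative f x) (at x)"
      unfolding F_def
      by (rule DERIV_cong[OF DERIV_mult]) (simp only: e, simp add: f_def A_def power2_eq_square algebra_simps)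
    then show "(F has_vector_derivative f x) (at x)"
      by (simp add: has_real_derivative_iff_has_vector_derivative)
  qed simp
  moreover have "F 1 = 0" "F (-1) = 0" using d2 by (auto simp: F_def)
  ultimately have "integral {-1..1} f = 0" by (simp add: integral_unique)
  then have "(LINT x:{-1..1}|lborel. f x) = 0"
    using set_borel_integral_eq_integral(2)[OF f_int] by simp
  moreover have "(LINT x:{-1..1}|lborel. f x) = ip (A p) q - ip p (A q)"
    unfolding ip_def f_def
    by (subst set_integral_diff(2)[symmetric]) (simp_all add: ip_integrable distrib_left distrib_right left_diff_distrib)
  ultimately show ?thesis by simp
qed

text \<open>\<open>ev l 0\<close> is the eigenvalue \<open>l (l + d - 1)\<close> of the negative
  Laplacian on spherical harmonics of degree \<open>l\<close>; \<open>ev l k\<close> takes its place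
  in the equation of the \<open>k\<close>-th derivative.\<close>

definition ev :: "nat \<Rightarrow> nat \<Rightarrow> real" where
  "ev l k = real l * (real l + real d - 1) - real k * (real k + real d - 1)"

lemma ev_factor: "ev l k = (real l - real k) * (real l + real k + real d - 1)"
  by (simp add: ev_def algebra_simps)

text \<open>The factor \<open>ev l 0\<close> cancels the leading coefficient of
  \<open>A (G l)\<close>, and symmetry of \<open>A\<close>, which does not raise degrees, gives
  orthogonality to everything of lower degree.\<close>

lemma gegenbauer_ode: "A (G l) + smult (ev l 0) (G l) = 0"
proof (rule orth_self_eq_0[of l])
  show "deg_below l (A (G l) + smult (ev l 0) (G l))"
    unfolding deg_below_def
  proof (intro allI impI)
    fix i assume i: "i \<ge> l"
    show "coeff (A (G l) + smult (ev l 0) (G l)) i = 0"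
      using i coeff_G_above[of l "i + 2"] coeff_G_above[of l i]
      by (cases "i = l") (auto simp: coeff_A ev_def algebra_simps)
  qed
  fix r assume r: "deg_below l r"
  have "deg_below l (A r)" using r by (auto simp: deg_below_def coeff_A)
  then have "ip (G l) (A r) = 0" "ip (G l) r = 0"
    using r ip_G_deg_below by auto
  then show "ip (A (G l) + smult (ev l 0) (G l)) r = 0"
    unfolding ip_commute[of _ r] ip_add ip_smult
    using ip_A_symmetric[of "G l" r] by (simp add: ip_commute)
qed

text \<open>The same scheme with the reflection of the variable in place of \<open>A\<close>: it is
  symmetric because the weight is even, and it multiplies the leading coefficient by
  \<open>(-1) ^ l\<close>.\<close>

lemma gegenbauer_parity: "poly (G l) (- x) = (- 1) ^ l * poly (G l) x"
proof -
  define R where "R p = pcompose p [:0, -1:]" for p :: "real poly"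
  have polyR: "poly (R p) x = poly p (- x)" for p x by (simp add: R_def poly_pcompose)
  have coeffR: "coeff (R p) i = (- 1) ^ i * coeff p i" for p i
    unfolding R_def by (simp add: coeff_pcompose_linear)
  have ipR: "ip (R p) q = ip p (R q)" for p q
  proof -
    have "ip p (R q) = (\<integral>x. indicator {-1..1} x *\<^sub>R (poly p x * poly q (- x) * jacobi_weight d x) \<partial>lborel)"
      by (simp add: ip_def polyR set_lebesgue_integral_def)
    also have "\<dots> = (\<integral>x. indicator {-1..1} (0 + (-1) * x) *\<^sub>R
        (poly p (0 + (-1) * x) * poly q (- (0 + (-1) * x)) * jacobi_weight d (0 + (-1) * x)) \<partial>lborel)"
      by (subst lborel_integral_real_affine[where c = "-1" and t = 0]) auto
    also have "\<dots> = ip (R p) q"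
      unfolding ip_def polyR set_lebesgue_integral_def
      by (intro Bochner_Integration.integral_cong refl) (auto simp: indicator_def jacobi_weight_def)
    finally show ?thesis by simp
  qed
  have "R (G l) + smult (- ((- 1) ^ l)) (G l) = 0"
  proof (rule orth_self_eq_0[of l])
    show "deg_below l (R (G l) + smult (- ((- 1) ^ l)) (G l))"
      unfolding deg_below_def
    proof (intro allI impI)
      fix i assume "i \<ge> l"
      then show "coeff (R (G l) + smult (- ((- 1) ^ l)) (G l)) i = 0"
        using coeff_G_above[of l i] by (cases "i = l") (auto simp: coeffR)
    qed
    fix r assume r: "deg_below l r"
    have "deg_below l (R r)" using r by (auto simp: deg_below_def coeffR)
    then have "ip (G l) (R r) = 0" "ip (G l) r = 0"
      using r ip_G_deg_below by auto
    then show "ip (R (G l) + smult (- ((- 1) ^ l)) (G l)) r = 0"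
      unfolding ip_commute[of _ r] ip_add ip_smult
      using ipR[of "G l" r] by (simp add: ip_commute)
  qed
  then have "poly (R (G l) + smult (- ((- 1) ^ l)) (G l)) x = 0" by simp
  then show ?thesis by (simp add: polyR)
qed

text \<open>Sonine's argument: \<open>p^2 + (1 - x^2) p'^2 / b\<close> increases away from the origin.\<close>

lemma sonine_bound:
  fixes p :: "real poly"
  assumes ode: "[:1, 0, -1:] * pderiv (pderiv p) - [:0, a:] * pderiv p + smult b p = 0"
    and a: "a \<ge> 1" and b: "b > 0" and par: "\<bar>poly p (-1)\<bar> = \<bar>poly p 1\<bar>"
    and x: "x \<in> {-1..1}"
  shows "\<bar>poly p x\<bar> \<le> \<bar>poly p 1\<bar>"
proof -
  define S where "S x = (poly p x)\<^sup>2 + (1 - x\<^sup>2) / b * (poly (pderiv p) x)\<^sup>2" for x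
  have dS: "(S has_real_derivative (2 * (a - 1) / b * x * (poly (pderiv p) x)\<^sup>2)) (at x)" for x
  proof -
    have "poly ([:1, 0, -1:] * pderiv (pderiv p) - [:0, a:] * pderiv p + smult b p) x = 0"
      using ode by simp
    then have o: "(1 - x\<^sup>2) * poly (pderiv (pderiv p)) x = a * x * poly (pderiv p) x - b * poly p x"
      by (simp add: power2_eq_square algebra_simps)
    have "(S has_real_derivative 2 * poly p x * poly (pderiv p) x +
       (- (2 * x) / b * (poly (pderiv p) x)\<^sup>2
        + (2 / b * poly (pderiv p) x) * ((1 - x\<^sup>2) * poly (pderiv (pderiv p)) x))) (at x)"
      unfolding S_def by (rule derivative_eq_intros refl poly_DERIV | use b in \<open>simp add: field_simps power2_eq_square\<close>)+
    also have "2 * poly p x * poly (pderiv p) x +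
       (- (2 * x) / b * (poly (pderiv p) x)\<^sup>2
        + (2 / b * poly (pderiv p) x) * ((1 - x\<^sup>2) * poly (pderiv (pderiv p)) x)) =
        2 * (a - 1) / b * x * (poly (pderiv p) x)\<^sup>2"
      unfolding o using b by (simp add: field_simps power2_eq_square)
    finally show ?thesis .
  qed
  have "S x \<le> (poly p 1)\<^sup>2"
  proof (cases "x \<ge> 0")
    case True
    have "S x \<le> S 1"
    proof (rule DERIV_nonneg_imp_nondecreasing[of x 1 S])
      show "\<exists>y. DERIV S t :> y \<and> y \<ge> 0" if "x \<le> t" "t \<le> 1" for t
        using dS[of t] a b that True by (intro exI[of _ "2 * (a - 1) / b * t * (poly (pderiv p) t)\<^sup>2"]) auto
    qed (use x in auto)
    then show ?thesis by (simp add: S_def)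
  next
    case False
    have "S x \<le> S (-1)"
    proof (rule DERIV_nonpos_imp_nonincreasing[of "-1" x S])
      show "\<exists>y. DERIV S t :> y \<and> y \<le> 0" if "-1 \<le> t" "t \<le> x" for t
      proof (rule exI, rule conjI, rule dS)
        have "2 * (a - 1) / b * t \<le> 0"
          using a b that False by (intro mult_nonneg_nonpos) auto
        then show "2 * (a - 1) / b * t * (poly (pderiv p) t)\<^sup>2 \<le> 0"
          by (rule mult_nonpos_nonneg) simp
      qed
    qed (use x in auto)
    moreover have "(poly p (-1))\<^sup>2 = (poly p 1)\<^sup>2"
      using par by (simp only: power2_eq_iff abs_eq_iff)
    ultimately show ?thesis by (simp add: S_def)
  qed
  moreover have "(poly p x)\<^sup>2 \<le> S x"
    using x b by (simp add: S_def abs_square_le_1 abs_le_iff)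
  ultimately have "(poly p x)\<^sup>2 \<le> (poly p 1)\<^sup>2" by linarith
  then show ?thesis by (simp add: abs_le_square_iff)
qed

section \<open>Derivatives of Gegenbauer polynomials\<close>

definition Gd :: "nat \<Rightarrow> nat \<Rightarrow> real \<Rightarrow> real" where
  "Gd k l x = poly ((pderiv ^^ k) (G l)) x"

lemma Gd_0 [simp]: "Gd 0 l = poly (G l)"
  by (simp add: Gd_def fun_eq_iff)

lemma Gd_deriv: "(Gd k l has_real_derivative Gd (Suc k) l x) (at x within S)"
  unfolding Gd_def by (auto intro: has_field_derivative_at_within)

text \<open>Each differentiation replaces the dimension parameter by one larger by 2: derivatives of
  Gegenbauer polynomials are multiples of Gegenbauer polynomials for higher spheres. Hence Sonine's
  bound applies to every order.\<close>

lemma Gd_ode: "[:1, 0, -1:] * (pderiv ^^ (k + 2)) (G l) - [:0, real d + 2 * real k:] * (pderiv ^^ (k + 1)) (G l)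
    + smult (ev l k) ((pderiv ^^ k) (G l)) = 0"
proof (induction k)
  case 0
  show ?case using gegenbauer_ode[of l] by (simp add: A_def numeral_2_eq_2)
next
  case (Suc k)
  define p where "p = (pderiv ^^ k) (G l)"
  have IH: "[:1, 0, -1:] * pderiv (pderiv p) - [:0, real d + 2 * real k:] * pderiv p + smult (ev l k) p = 0"
    using Suc by (simp add: p_def)
  have e: "ev l (Suc k) = ev l k - (real d + 2 * real k)"
    by (simp add: ev_def algebra_simps)
  have "[:1, 0, -1:] * pderiv (pderiv (pderiv p)) - [:0, real d + 2 * real (Suc k):] * pderiv (pderiv p)
      + smult (ev l (Suc k)) (pderiv p)
    = pderiv ([:1, 0, -1:] * pderiv (pderiv p) - [:0, real d + 2 * real k:] * pderiv p + smult (ev l k) p)"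
    unfolding poly_eq_poly_eq_iff[symmetric] e
    by (rule ext) (simp add: pderiv_add pderiv_diff pderiv_mult pderiv_smult pderiv_minus pderiv_pCons algebra_simps)
  then show ?case unfolding IH by (simp add: p_def)
qed

text \<open>At \<open>1\<close> the second-order term of the equation drops out, which leaves a
  recursion in \<open>k\<close>.\<close>

lemma Gd_one_Suc: "Gd (Suc k) l 1 = ev l k / (real d + 2 * real k) * Gd k l 1"
proof -
  have "poly ([:1, 0, -1:] * (pderiv ^^ (k + 2)) (G l) - [:0, real d + 2 * real k:] * (pderiv ^^ (k + 1)) (G l)
    + smult (ev l k) ((pderiv ^^ k) (G l))) 1 = 0" by (simp only: Gd_ode poly_0)
  then show ?thesis using d2 by (simp add: Gd_def field_simps)
qed

lemma Gd_one: "Gd k l 1 = (\<Prod>j<k. ev l j / (real d + 2 * real j))"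
  by (induction k) (auto simp: Gd_one_Suc G_at_1)

lemma pderiv_iter_G_0: "k > l \<Longrightarrow> (pderiv ^^ k) (G l) = 0"
proof -
  have "deg_below (Suc l - k) ((pderiv ^^ k) (G l))" for k
  proof (induction k)
    case 0
    then show ?case using coeff_G_above by (auto simp: deg_below_def)
  next
    case (Suc k)
    then show ?case by (auto simp: deg_below_def coeff_pderiv)
  qed
  moreover assume "k > l"
  ultimately have "deg_below 0 ((pderiv ^^ k) (G l))" by (metis Suc_leI diff_is_0_eq)
  then show ?thesis by (auto simp: deg_below_def poly_eq_iff)
qed

lemma Gd_eq_0: "k > l \<Longrightarrow> Gd k l x = 0"
  by (simp add: Gd_def pderiv_iter_G_0)

lemma Gd_parity: "Gd k l (- x) = (- 1) ^ (l + k) * Gd k l x"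
proof (induction k arbitrary: x)
  case 0
  show ?case by (simp add: gegenbauer_parity)
next
  case (Suc k)
  have "((\<lambda>x. Gd k l (- x)) has_real_derivative - Gd (Suc k) l (- x)) (at x)"
    by (rule DERIV_chain2[OF Gd_deriv, of uminus, THEN DERIV_cong]) (auto intro!: derivative_eq_intros)
  moreover have "((\<lambda>x. Gd k l (- x)) has_real_derivative (- 1) ^ (l + k) * Gd (Suc k) l x) (at x)"
    unfolding Suc by (intro DERIV_cmult Gd_deriv)
  ultimately have "- Gd (Suc k) l (- x) = (- 1) ^ (l + k) * Gd (Suc k) l x"
    by (rule DERIV_unique)
  then show ?case by simp
qed

lemma Gd_one_nonneg: "Gd k l 1 \<ge> 0"
proof (cases "k > l")
  case False
  then show ?thesis unfolding Gd_one using d2 by (intro prod_nonneg) (auto simp: ev_factor)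
qed (simp add: Gd_eq_0)

lemma Gd_one_pos: "k \<le> l \<Longrightarrow> Gd k l 1 > 0"
  unfolding Gd_one using d2 by (intro prod_pos) (auto simp: ev_factor)

lemma Gd_bound:
  assumes x: "x \<in> {-1..1}"
  shows "\<bar>Gd k l x\<bar> \<le> Gd k l 1"
proof -
  consider "k > l" | "k = l" | "k < l" by linarith
  then show ?thesis
  proof cases
    case 1
    then show ?thesis by (simp add: Gd_eq_0)
  next
    \<comment> \<open>Here \<open>ev l k = 0\<close>, by which Sonine's function would divide; but
      this derivative is constant.\<close>
    case 2
    have "pderiv ((pderiv ^^ k) (G l)) = 0" using pderiv_iter_G_0[of l "Suc k"] 2 by simp
    then obtain c where "(pderiv ^^ k) (G l) = [:c:]"
      by (metis degree_eq_zeroE pderiv_eq_0_iff)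
    then show ?thesis using Gd_one_nonneg[of k l] by (simp add: Gd_def)
  next
    case 3
    have "\<bar>poly ((pderiv ^^ k) (G l)) x\<bar> \<le> \<bar>poly ((pderiv ^^ k) (G l)) 1\<bar>"
    proof (rule sonine_bound[OF _ _ _ _ x])
      show "[:1, 0, - 1:] * pderiv (pderiv ((pderiv ^^ k) (G l))) -
        [:0, real d + 2 * real k:] * pderiv ((pderiv ^^ k) (G l)) + smult (ev l k) ((pderiv ^^ k) (G l)) = 0"
        using Gd_ode[of k l] by simp
      show "\<bar>poly ((pderiv ^^ k) (G l)) (- 1)\<bar> = \<bar>poly ((pderiv ^^ k) (G l)) 1\<bar>"
        using Gd_parity[of k l 1] by (simp add: Gd_def abs_mult)
    qed (use 3 d2 in \<open>auto simp: ev_factor\<close>)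
    then show ?thesis using Gd_one_nonneg[of k l] by (simp add: Gd_def)
  qed
qed

text \<open>By \<open>Gd_one_Suc\<close>, every further derivative contributes a factor that grows
  like a positive multiple of \<open>l ^ 2\<close>.\<close>

lemma Gd_one_asymp:
  "\<exists>c>0. (\<lambda>l. Gd k l 1 / real l ^ (2 * k)) \<longlonglongrightarrow> c"
proof (induction k)
  case 0
  show ?case by (auto simp: G_at_1 intro!: exI[of _ 1])
next
  case (Suc k)
  then obtain c where c: "c > 0" "(\<lambda>l. Gd k l 1 / real l ^ (2 * k)) \<longlonglongrightarrow> c" by auto
  have "(\<lambda>l. ev l k / real l ^ 2) \<longlonglongrightarrow> 1"
    unfolding ev_def by real_asymp
  then have "(\<lambda>l. ev l k / real l ^ 2 / (real d + 2 * real k) * (Gd k l 1 / real l ^ (2 * k)))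
      \<longlonglongrightarrow> 1 / (real d + 2 * real k) * c"
    using d2 by (intro tendsto_intros c) auto
  then show ?case
    using c(1) d2 by (intro exI[of _ "1 / (real d + 2 * real k) * c"])
      (auto simp: Gd_one_Suc power2_eq_square mult_ac)
qed

lemma G_0: "poly (G 0) x = 1"
proof -
  have "degree (G 0) = 0" "poly (G 0) 1 = 1" by (simp_all add: deg_G G_at_1)
  then show ?thesis
    by (metis degree_eq_zeroE mult_zero_right poly_0 add.right_neutral poly_pCons)
qed

lemma weight_integral_G:
  assumes "l \<ge> 1"
  shows "(LINT x:{-1..1}|lborel. poly (G l) x * jacobi_weight d x) = 0"
  using ip_G_orth[of l 0] assms by (simp add: ip_def G_0)

end

section \<open>Derivatives on the unit interval and jets at its right endpoint\<close>

definition deriv_I :: "(real \<Rightarrow> real) \<Rightarrow> (real \<Rightarrow> real) \<Rightarrow> bool" where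
  "deriv_I f f' \<longleftrightarrow> (\<forall>t\<in>{-1..1}. (f has_real_derivative f' t) (at t within {-1..1}))"

lemma has_real_derivative_Icc_unique:
  assumes "(f has_real_derivative D) (at x within {a..b})" "(f has_real_derivative E) (at x within {a..b})"
    and "a < b" "x \<in> {a..b}"
  shows "D = E"
proof -
  have "x islimpt {a..b}"
  proof (rule connected_imp_perfect)
    show "{a..b} \<noteq> {y}" for y using assms(3) by (metis Icc_eq_Icc atLeastAtMost_singleton less_irrefl order_less_imp_le)
  qed (use assms in auto)
  then have "at x within {a..b} \<noteq> bot" by (simp add: trivial_limit_within)
  then show ?thesis
    using assms(1,2) unfolding has_field_derivative_iff by (rule tendsto_unique)
qed

lemma deriv_I_unique:
  assumes "deriv_I f g" "deriv_I f h" "t \<in> {-1..1}"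
  shows "g t = h t"
  using assms by (intro has_real_derivative_Icc_unique[of f _ t "-1" 1]) (auto simp: deriv_I_def)

lemma deriv_I_cong:
  assumes "deriv_I f f'" "\<And>t. t \<in> {-1..1} \<Longrightarrow> f t = g t"
  shows "deriv_I g f'"
  unfolding deriv_I_def
proof
  fix t :: real assume t: "t \<in> {-1..1}"
  have "(f has_real_derivative f' t) (at t within {-1..1})" using assms(1) t by (auto simp: deriv_I_def)
  then show "(g has_real_derivative f' t) (at t within {-1..1})"
    by (rule has_field_derivative_transform_within[OF _ zero_less_one t]) (use assms(2) in auto)
qed

lemma deriv_I_add: "deriv_I f f' \<Longrightarrow> deriv_I g g' \<Longrightarrow> deriv_I (\<lambda>t. f t + g t) (\<lambda>t. f' t + g' t)"
  unfolding deriv_I_def by (auto intro: DERIV_add)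

lemma deriv_I_mult: "deriv_I f f' \<Longrightarrow> deriv_I g g' \<Longrightarrow>
    deriv_I (\<lambda>t. f t * g t) (\<lambda>t. f' t * g t + f t * g' t)"
  unfolding deriv_I_def by (auto intro!: derivative_eq_intros)

lemma deriv_I_compose:
  assumes "deriv_I f f'" "deriv_I g g'" "g ` {-1..1} \<subseteq> {-1..1}"
  shows "deriv_I (\<lambda>t. f (g t)) (\<lambda>t. f' (g t) * g' t)"
  unfolding deriv_I_def
proof
  fix t :: real assume t: "t \<in> {-1..1}"
  have "g t \<in> {-1..1}" using assms(3) t by blast
  then have "(f has_real_derivative f' (g t)) (at (g t) within g ` {-1..1})"
    using assms(1) by (intro has_field_derivative_subset[OF _ assms(3)]) (simp add: deriv_I_def)
  from DERIV_image_chain[OF this] assms(2) t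
  show "((\<lambda>t. f (g t)) has_real_derivative f' (g t) * g' t) (at t within {-1..1})"
    by (auto simp: deriv_I_def o_def)
qed

text \<open>In particular \<open>f 1 \<ge> 0\<close>. The class is closed under sums, products and
  inner self-maps of \<open>[-1, 1]\<close> fixing \<open>1\<close>, so it survives the chain rule
  and Leibniz' rule.\<close>

definition dominated_at_1 :: "(real \<Rightarrow> real) \<Rightarrow> bool" where
  "dominated_at_1 f \<longleftrightarrow> (\<forall>t\<in>{-1..1}. \<bar>f t\<bar> \<le> f 1)"

lemma dominated_at_1_add: "dominated_at_1 f \<Longrightarrow> dominated_at_1 g \<Longrightarrow> dominated_at_1 (\<lambda>t. f t + g t)"
  unfolding dominated_at_1_def by (auto intro: order_trans[OF abs_triangle_ineq] add_mono)

lemma dominated_at_1_mult: "dominated_at_1 f \<Longrightarrow> dominated_at_1 g \<Longrightarrow> dominated_at_1 (\<lambda>t. f t * g t)"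
  unfolding dominated_at_1_def abs_mult
  by (auto intro!: mult_mono intro: order_trans[OF abs_ge_zero])

lemma dominated_at_1_compose:
  "dominated_at_1 f \<Longrightarrow> g ` {-1..1} \<subseteq> {-1..1} \<Longrightarrow> g 1 = 1 \<Longrightarrow> dominated_at_1 (\<lambda>t. f (g t))"
  unfolding dominated_at_1_def by auto

text \<open>\<open>jet r f F\<close>: the function \<open>f\<close> is \<open>r\<close> times differentiable on \<open>[-1, 1]\<close> with Taylor coefficients
  \<open>F\<close> at \<open>1\<close> up to order \<open>r\<close> (the other coefficients of \<open>F\<close> are arbitrary), and all these
  derivatives attain their maximal absolute value at \<open>1\<close>.\<close>

fun jet :: "nat \<Rightarrow> (real \<Rightarrow> real) \<Rightarrow> real fps \<Rightarrow> bool" where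
  "jet 0 f F \<longleftrightarrow> dominated_at_1 f \<and> F $ 0 = f 1"
| "jet (Suc r) f F \<longleftrightarrow> dominated_at_1 f \<and> F $ 0 = f 1 \<and> (\<exists>f'. deriv_I f f' \<and> jet r f' (fps_deriv F))"

lemma jetD: "jet r f F \<Longrightarrow> dominated_at_1 f" "jet r f F \<Longrightarrow> F $ 0 = f 1"
  by (cases r; simp)+

lemma jet_SucI:
  "dominated_at_1 f \<Longrightarrow> F $ 0 = f 1 \<Longrightarrow> deriv_I f f' \<Longrightarrow> jet r f' (fps_deriv F) \<Longrightarrow> jet (Suc r) f F"
  by auto

lemma jet_SucE:
  assumes "jet (Suc r) f F"
  obtains f' where "deriv_I f f'" "jet r f' (fps_deriv F)"
  using assms by auto

declare jet.simps(2) [simp del]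

lemma jet_Suc: "jet (Suc r) f F \<Longrightarrow> jet r f F"
proof (induction r arbitrary: f F)
  case (Suc r)
  obtain f' where *: "deriv_I f f'" "jet (Suc r) f' (fps_deriv F)"
    using Suc.prems by (rule jet_SucE)
  show ?case by (rule jet_SucI[OF jetD[OF Suc.prems] *(1) Suc.IH[OF *(2)]])
qed (simp add: jetD)

lemma jet_cong_I:
  assumes "jet r f F" "\<And>t. t \<in> {-1..1} \<Longrightarrow> f t = g t"
  shows "jet r g F"
proof -
  have "dominated_at_1 f \<longleftrightarrow> dominated_at_1 g" "f 1 = g 1"
    using assms(2) by (auto simp: dominated_at_1_def)
  then show ?thesis using assms deriv_I_cong[of f _ g] by (cases r) (auto simp: jet.simps(2))
qed

lemma jet_add: "jet r f F \<Longrightarrow> jet r g H \<Longrightarrow> jet r (\<lambda>t. f t + g t) (F + H)"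
proof (induction r arbitrary: f g F H)
  case 0
  then show ?case by (simp add: dominated_at_1_add)
next
  case (Suc r)
  then obtain f' g' where *: "deriv_I f f'" "jet r f' (fps_deriv F)" "deriv_I g g'" "jet r g' (fps_deriv H)"
    by (metis jet_SucE)
  have "jet r (\<lambda>t. f' t + g' t) (fps_deriv (F + H))"
    using Suc.IH[OF *(2,4)] by simp
  with deriv_I_add[OF *(1,3)] show ?case
    by (intro jet_SucI) (simp_all add: dominated_at_1_add Suc.prems[THEN jetD(1)] Suc.prems[THEN jetD(2)])
qed

lemma jet_mult: "jet r f F \<Longrightarrow> jet r g H \<Longrightarrow> jet r (\<lambda>t. f t * g t) (F * H)"
proof (induction r arbitrary: f g F H)
  case 0
  then show ?case by (simp add: dominated_at_1_mult)
next
  case (Suc r)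
  then obtain f' g' where *: "deriv_I f f'" "jet r f' (fps_deriv F)" "deriv_I g g'" "jet r g' (fps_deriv H)"
    by (metis jet_SucE)
  have "jet r (\<lambda>t. f' t * g t + f t * g' t) (fps_deriv F * H + F * fps_deriv H)"
    by (intro jet_add Suc.IH * Suc.prems[THEN jet_Suc])
  then have "jet r (\<lambda>t. f' t * g t + f t * g' t) (fps_deriv (F * H))"
    by (simp add: add.commute)
  with deriv_I_mult[OF *(1,3)] show ?case
    by (intro jet_SucI) (simp_all add: dominated_at_1_mult Suc.prems[THEN jetD(1)] Suc.prems[THEN jetD(2)])
qed

text \<open>Faa di Bruno's formula without its combinatorics: one differentiation on each side, with
  the formal chain rule \<open>fps_compose_deriv\<close> matching
  \<open>deriv_I_compose\<close>.\<close>

lemma jet_compose: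
  assumes "jet r f F" "jet r g (1 + H)" "g ` {-1..1} \<subseteq> {-1..1}" "H $ 0 = 0"
  shows "jet r (\<lambda>t. f (g t)) (F oo H)"
  using assms
proof (induction r arbitrary: f F)
  case 0
  then show ?case by (auto simp: dominated_at_1_compose)
next
  case (Suc r)
  have g1: "g 1 = 1" using jetD(2)[OF Suc.prems(2)] Suc.prems(4) by simp
  obtain f' g' where *: "deriv_I f f'" "jet r f' (fps_deriv F)" "deriv_I g g'" "jet r g' (fps_deriv (1 + H))"
    by (metis Suc.prems(1,2) jet_SucE)
  have "jet r (\<lambda>t. f' (g t)) (fps_deriv F oo H)"
    by (intro Suc.IH * Suc.prems(2)[THEN jet_Suc] Suc.prems)
  then have "jet r (\<lambda>t. f' (g t) * g' t) ((fps_deriv F oo H) * fps_deriv H)"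
    using *(4) by (intro jet_mult) simp_all
  then have "jet r (\<lambda>t. f' (g t) * g' t) (fps_deriv (F oo H))"
    using Suc.prems by (simp add: fps_compose_deriv)
  with deriv_I_compose[OF *(1,3) Suc.prems(3)] show ?case
    by (intro jet_SucI) (simp_all add: dominated_at_1_compose g1 Suc.prems(3) Suc.prems(1)[THEN jetD(1)] Suc.prems(1)[THEN jetD(2)])
qed

text \<open>Serves to equate two descriptions of an iterate: the jet of its Gegenbauer series and
  the jet obtained by composition.\<close>

lemma jet_unique:
  assumes "jet r f F" "jet r g H" "\<And>t. t \<in> {-1..1} \<Longrightarrow> f t = g t" "n \<le> r"
  shows "F $ n = H $ n"
  using assms
proof (induction r arbitrary: f g F H n)
  case 0
  then show ?case by simp
next
  case (Suc r)
  obtain f' g' where *: "deriv_I f f'" "jet r f' (fps_deriv F)" "deriv_I g g'" "jet r g' (fps_deriv H)"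
    by (metis Suc.prems(1,2) jet_SucE)
  have e: "f' t = g' t" if "t \<in> {-1..1}" for t
    using deriv_I_unique[OF deriv_I_cong[OF *(1)] *(3) that] Suc.prems(3) by simp
  show ?case
  proof (cases n)
    case 0
    then show ?thesis using Suc.prems(3)[of 1] jetD(2)[OF Suc.prems(1)] jetD(2)[OF Suc.prems(2)] by simp
  next
    case (Suc m)
    then have "fps_deriv F $ m = fps_deriv H $ m"
      using Suc.IH[OF *(2,4) e] Suc.prems by simp
    then show ?thesis using Suc by (simp del: of_nat_Suc)
  qed
qed

section \<open>Higher derivatives and the leading part of Leibniz' rule\<close>

primrec nth_deriv_I :: "nat \<Rightarrow> (real \<Rightarrow> real) \<Rightarrow> (real \<Rightarrow> real) \<Rightarrow> bool" where
  "nth_deriv_I 0 f g \<longleftrightarrow> (\<forall>t\<in>{-1..1}. f t = g t)"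
| "nth_deriv_I (Suc m) f g \<longleftrightarrow> (\<exists>f'. deriv_I f f' \<and> nth_deriv_I m f' g)"

lemma nth_deriv_I_unique:
  assumes "nth_deriv_I m f g" "nth_deriv_I m f2 h" "\<And>t. t \<in> {-1..1} \<Longrightarrow> f t = f2 t" "t \<in> {-1..1}"
  shows "g t = h t"
  using assms
proof (induction m arbitrary: f f2)
  case 0
  then show ?case by auto
next
  case (Suc m)
  obtain f' f2' where *: "deriv_I f f'" "nth_deriv_I m f' g" "deriv_I f2 f2'" "nth_deriv_I m f2' h"
    using Suc.prems by auto
  have "f' t = f2' t" if "t \<in> {-1..1}" for t
    using deriv_I_unique[OF deriv_I_cong[OF *(1)] *(3) that] Suc.prems(3) by simp
  from Suc.IH[OF *(2,4) this Suc.prems(4)] show ?case by simp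
qed

lemma nth_deriv_I_add:
  "nth_deriv_I m f g \<Longrightarrow> nth_deriv_I m f2 h \<Longrightarrow> nth_deriv_I m (\<lambda>t. f t + f2 t) (\<lambda>t. g t + h t)"
proof (induction m arbitrary: f f2)
  case (Suc m)
  then show ?case using deriv_I_add by fastforce
qed simp

lemma nth_deriv_I_cong:
  assumes "nth_deriv_I m f g" "\<And>t. t \<in> {-1..1} \<Longrightarrow> f t = f2 t"
  shows "nth_deriv_I m f2 g"
  using assms deriv_I_cong[of f _ f2] by (cases m) auto

lemma nth_deriv_I_cong_result:
  assumes "nth_deriv_I m f g" "\<And>t. t \<in> {-1..1} \<Longrightarrow> g t = h t"
  shows "nth_deriv_I m f h"
  using assms by (induction m arbitrary: f) auto

lemma jet_nth_deriv_I:
  "jet m f F \<Longrightarrow> \<exists>h. nth_deriv_I m f h \<and> dominated_at_1 h"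
proof (induction m arbitrary: f F)
  case 0
  then show ?case by (intro exI[of _ f]) simp
next
  case (Suc m)
  obtain f' where *: "deriv_I f f'" "jet m f' (fps_deriv F)"
    using Suc.prems by (rule jet_SucE)
  then show ?case using Suc.IH[OF *(2)] by auto
qed

text \<open>The part of Leibniz' rule without the term containing the highest derivative of the second
  factor is a sum of products of functions dominated by their values at \<open>1\<close>.\<close>

lemma nth_deriv_I_mult_leading:
  assumes "jet m u U" "jet m v V" "nth_deriv_I m v g"
  shows "\<exists>R. nth_deriv_I m (\<lambda>t. u t * v t) (\<lambda>t. u t * g t + R t) \<and> dominated_at_1 R"
  using assms
proof (induction m arbitrary: u v U V)
  case 0
  then show ?case by (intro exI[of _ "\<lambda>_. 0"]) (simp add: dominated_at_1_def)
next
  case (Suc m)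
  obtain u' v' where *: "deriv_I u u'" "jet m u' (fps_deriv U)" "deriv_I v v'" "jet m v' (fps_deriv V)"
    by (metis Suc.prems(1,2) jet_SucE)
  obtain v'' where v'': "deriv_I v v''" "nth_deriv_I m v'' g" using Suc.prems by auto
  have g: "nth_deriv_I m v' g"
    by (rule nth_deriv_I_cong[OF v''(2)]) (use deriv_I_unique[OF v''(1) *(3)] in auto)
  obtain R where R: "nth_deriv_I m (\<lambda>t. u t * v' t) (\<lambda>t. u t * g t + R t)" "dominated_at_1 R"
    using Suc.IH[OF Suc.prems(1)[THEN jet_Suc] *(4) g] by auto
  have "jet m (\<lambda>t. u' t * v t) (fps_deriv U * V)"
    by (intro jet_mult * Suc.prems(2)[THEN jet_Suc])
  then obtain h where h: "nth_deriv_I m (\<lambda>t. u' t * v t) h" "dominated_at_1 h"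
    using jet_nth_deriv_I by blast
  have "nth_deriv_I m (\<lambda>t. u' t * v t + u t * v' t) (\<lambda>t. h t + (u t * g t + R t))"
    by (rule nth_deriv_I_add[OF h(1) R(1)])
  then have "nth_deriv_I m (\<lambda>t. u' t * v t + u t * v' t) (\<lambda>t. u t * g t + (R t + h t))"
    by (rule nth_deriv_I_cong_result) simp
  with deriv_I_mult[OF *(1,3)] have "nth_deriv_I (Suc m) (\<lambda>t. u t * v t) (\<lambda>t. u t * g t + (R t + h t))"
    by auto
  with dominated_at_1_add[OF R(2) h(2)] show ?case by (intro exI[of _ "\<lambda>t. R t + h t"] conjI)
qed

section \<open>Nonnegative Gegenbauer series\<close>

text \<open>Weaker than differentiability at \<open>1\<close>, but it forces differentiability for
  the series below and, being an upper bound, it passes through inequalities between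
  functions.\<close>

definition bounded_quotient_at_1 :: "(real \<Rightarrow> real) \<Rightarrow> bool" where
  "bounded_quotient_at_1 f \<longleftrightarrow> (\<exists>B. \<forall>\<^sub>F t in at_left 1. (f 1 - f t) / (1 - t) \<le> B)"

lemma deriv_bounded_quotient:
  assumes "(f has_real_derivative D) (at 1 within {a..1})" "a < 1"
  shows "bounded_quotient_at_1 f"
proof -
  have "((\<lambda>t. (f t - f 1) / (t - 1)) \<longlongrightarrow> D) (at_left 1)"
    using assms by (simp add: has_field_derivative_iff at_within_Icc_at_left)
  then have "\<forall>\<^sub>F t in at_left 1. (f t - f 1) / (t - 1) < D + 1"
    by (rule order_tendstoD) simp
  then have "\<forall>\<^sub>F t in at_left 1. (f 1 - f t) / (1 - t) \<le> D + 1"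
  proof eventually_elim
    fix t assume "(f t - f 1) / (t - 1) < D + 1"
    moreover have "(f t - f 1) / (t - 1) = (f 1 - f t) / (1 - t)"
      by (metis minus_diff_eq minus_divide_divide)
    ultimately show "(f 1 - f t) / (1 - t) \<le> D + 1" by simp
  qed
  then show ?thesis unfolding bounded_quotient_at_1_def by blast
qed

locale gegenbauer_series = gegenbauer +
  fixes p :: "nat \<Rightarrow> real"
  assumes p_nonneg: "p l \<ge> 0"
begin

definition K :: "nat \<Rightarrow> real \<Rightarrow> real" where
  "K k t = (\<Sum>l. p l * Gd k l t)"

text \<open>By \<open>Gd_bound\<close>, convergence at \<open>1\<close> is the Weierstrass criterion
  on all of \<open>[-1, 1]\<close>. \<open>K k\<close> is the \<open>k\<close>-th derivative of the
  series only when \<open>fin k\<close> holds; otherwise the infinite sum can be a default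
  value.\<close>

definition fin :: "nat \<Rightarrow> bool" where
  "fin k \<longleftrightarrow> summable (\<lambda>l. p l * Gd k l 1)"

text \<open>Translates between derivatives and moments: by \<open>Gd_one_asymp\<close> the two
  series have eventually comparable terms.\<close>

lemma fin_iff: "fin k \<longleftrightarrow> summable (\<lambda>l. p l * real l ^ (2 * k))"
proof -
  obtain c where c: "c > 0" "(\<lambda>l. Gd k l 1 / real l ^ (2 * k)) \<longlonglongrightarrow> c"
    using Gd_one_asymp by blast
  have ev1: "\<forall>\<^sub>F l in sequentially. c / 2 < Gd k l 1 / real l ^ (2 * k)"
    by (rule order_tendstoD[OF c(2)]) (use c in auto)
  have ev2: "\<forall>\<^sub>F l in sequentially. Gd k l 1 / real l ^ (2 * k) < 2 * c"
    by (rule order_tendstoD[OF c(2)]) (use c in auto)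
  show ?thesis
  proof
    assume f: "fin k"
    show "summable (\<lambda>l. p l * real l ^ (2 * k))"
    proof (rule summable_comparison_test_ev)
      show "summable (\<lambda>l. 2 / c * (p l * Gd k l 1))"
        using f unfolding fin_def by (intro summable_mult)
      show "\<forall>\<^sub>F l in sequentially. norm (p l * real l ^ (2 * k)) \<le> 2 / c * (p l * Gd k l 1)"
        using ev1 eventually_gt_at_top[of 0]
      proof eventually_elim
        fix l assume "c / 2 < Gd k l 1 / real l ^ (2 * k)" "0 < l"
        then have "real l ^ (2 * k) \<le> 2 / c * Gd k l 1" using c by (simp add: field_simps)
        from mult_left_mono[OF this p_nonneg[of l]]
        show "norm (p l * real l ^ (2 * k)) \<le> 2 / c * (p l * Gd k l 1)"
          using p_nonneg[of l] by (simp add: mult_ac)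
      qed
    qed
  next
    assume f: "summable (\<lambda>l. p l * real l ^ (2 * k))"
    show "fin k" unfolding fin_def
    proof (rule summable_comparison_test_ev)
      show "summable (\<lambda>l. 2 * c * (p l * real l ^ (2 * k)))"
        using f by (intro summable_mult)
      show "\<forall>\<^sub>F l in sequentially. norm (p l * Gd k l 1) \<le> 2 * c * (p l * real l ^ (2 * k))"
        using ev2 eventually_gt_at_top[of 0]
      proof eventually_elim
        fix l assume "Gd k l 1 / real l ^ (2 * k) < 2 * c" "0 < l"
        then have "Gd k l 1 \<le> 2 * c * real l ^ (2 * k)" by (simp add: field_simps)
        from mult_left_mono[OF this p_nonneg[of l]]
        show "norm (p l * Gd k l 1) \<le> 2 * c * (p l * real l ^ (2 * k))"
          using p_nonneg[of l] Gd_one_nonneg[of k l] by (simp add: mult_ac)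
      qed
    qed
  qed
qed

lemma summable_power_mono:
  assumes "summable (\<lambda>l. p l * real l ^ n)" "m \<le> n"
  shows "summable (\<lambda>l. p l * real l ^ m)"
proof (rule summable_comparison_test_ev[OF _ assms(1)])
  show "\<forall>\<^sub>F l in sequentially. norm (p l * real l ^ m) \<le> p l * real l ^ n"
    using eventually_ge_at_top[of 1]
    by eventually_elim (use p_nonneg assms(2) in \<open>auto simp: abs_mult intro!: mult_left_mono power_increasing\<close>)
qed

lemma fin_mono: "fin k \<Longrightarrow> j \<le> k \<Longrightarrow> fin j"
  unfolding fin_iff by (erule summable_power_mono) simp

lemma term_bound: "t \<in> {-1..1} \<Longrightarrow> norm (p l * Gd k l t) \<le> p l * Gd k l 1"
  using Gd_bound[of t k l] p_nonneg[of l] by (auto simp: abs_mult intro!: mult_left_mono)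

lemma summable_K: "fin k \<Longrightarrow> t \<in> {-1..1} \<Longrightarrow> summable (\<lambda>l. p l * Gd k l t)"
  unfolding fin_def by (rule summable_comparison_test'[where N = 0]) (use term_bound in auto)

lemma uniform_K: "fin k \<Longrightarrow> uniform_limit {-1..1} (\<lambda>n t. \<Sum>l<n. p l * Gd k l t) (K k) sequentially"
  unfolding fin_def K_def by (rule Weierstrass_m_test[OF term_bound])

lemma continuous_K: "fin k \<Longrightarrow> continuous_on {-1..1} (K k)"
  by (rule uniform_limit_theorem[OF _ uniform_K])
    (auto intro!: always_eventually continuous_intros simp: Gd_def)

lemma K_dominated: "fin k \<Longrightarrow> dominated_at_1 (K k)"
  unfolding dominated_at_1_def
proof
  fix t :: real assume f: "fin k" and t: "t \<in> {-1..1}"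
  have s: "summable (\<lambda>l. norm (p l * Gd k l t))"
    by (rule summable_comparison_test[OF _ f[unfolded fin_def]]) (use term_bound[OF t] in auto)
  have "norm (K k t) \<le> (\<Sum>l. norm (p l * Gd k l t))"
    unfolding K_def by (rule summable_norm[OF s])
  also have "\<dots> \<le> K k 1"
    unfolding K_def by (rule suminf_le[OF term_bound[OF t] s f[unfolded fin_def]])
  finally show "\<bar>K k t\<bar> \<le> K k 1" by simp
qed

lemma K_one_nonneg: "fin k \<Longrightarrow> K k 1 \<ge> 0"
  using K_dominated[of k] by (force simp: dominated_at_1_def)

lemma K_deriv: "fin (Suc k) \<Longrightarrow> deriv_I (K k) (K (Suc k))"
  unfolding deriv_I_def
proof
  fix t :: real assume f: "fin (Suc k)" and t: "t \<in> {-1..1}"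
  have "\<exists>g. \<forall>x\<in>{-1..1}. (\<lambda>l. p l * Gd k l x) sums g x \<and>
      (g has_real_derivative K (Suc k) x) (at x within {-1..1})"
    by (rule has_field_derivative_series[OF _ _ uniform_K[OF f], of _ 1])
      (auto intro!: DERIV_cmult Gd_deriv summable_K fin_mono[OF f])
  then obtain g where g: "\<And>x. x \<in> {-1..1} \<Longrightarrow> (\<lambda>l. p l * Gd k l x) sums g x"
    "\<And>x. x \<in> {-1..1} \<Longrightarrow> (g has_real_derivative K (Suc k) x) (at x within {-1..1})" by blast
  have "K k x = g x" if "x \<in> {-1..1}" for x
    using g(1)[OF that] by (simp add: K_def sums_iff)
  with deriv_I_cong[of g "K (Suc k)" "K k"] g(2) t
  show "(K k has_real_derivative K (Suc k) t) (at t within {-1..1})"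
    by (simp add: deriv_I_def)
qed

lemma jet_K: "fin (k + r) \<Longrightarrow> jet r (K k) (Abs_fps (\<lambda>n. K (k + n) 1 / fact n))"
proof (induction r arbitrary: k)
  case 0
  then show ?case using K_dominated by simp
next
  case (Suc r)
  have "fps_deriv (Abs_fps (\<lambda>n. K (k + n) 1 / fact n)) = Abs_fps (\<lambda>n. K (Suc k + n) 1 / fact n)"
    by (rule fps_ext) (simp add: field_simps del: of_nat_Suc)
  then have "jet r (K (Suc k)) (fps_deriv (Abs_fps (\<lambda>n. K (k + n) 1 / fact n)))"
    using Suc.IH[of "Suc k"] Suc.prems by simp
  moreover have "fin k" "fin (Suc k)" using Suc.prems by (auto intro: fin_mono)
  ultimately show ?case using K_dominated[of k] K_deriv[of k]
    by (intro jet_SucI[where f' = "K (Suc k)"]) simp_all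
qed

lemma nth_deriv_K: "fin (k + m) \<Longrightarrow> nth_deriv_I m (K k) (K (k + m))"
proof (induction m arbitrary: k)
  case (Suc m)
  have "fin (Suc k)" using Suc.prems by (auto intro: fin_mono)
  then show ?case using K_deriv[of k] Suc.IH[of "Suc k"] Suc.prems by auto
qed simp

text \<open>Since \<open>Gd k l 1 - Gd k l t\<close> is nonnegative, a Fatou argument works for difference
  quotients at \<open>1\<close>.\<close>

lemma fin_Suc_if_bounded_quotient:
  assumes f: "fin k" and bq: "bounded_quotient_at_1 (K k)"
  shows "fin (Suc k)"
proof -
  obtain B where B: "\<forall>\<^sub>F t in at_left 1. (K k 1 - K k t) / (1 - t) \<le> B"
    using bq by (auto simp: bounded_quotient_at_1_def)
  have "(\<Sum>l<m. p l * Gd (Suc k) l 1) \<le> B" for m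
  proof (rule tendsto_upperbound)
    have "((\<lambda>t. (Gd k l t - Gd k l 1) / (t - 1)) \<longlongrightarrow> Gd (Suc k) l 1) (at_left 1)" for l
      using Gd_deriv[of k l 1 "{..<1}"] by (simp add: has_field_derivative_iff)
    then show "((\<lambda>t. \<Sum>l<m. p l * ((Gd k l t - Gd k l 1) / (t - 1))) \<longlongrightarrow> (\<Sum>l<m. p l * Gd (Suc k) l 1)) (at_left 1)"
      by (intro tendsto_intros)
    have "\<forall>\<^sub>F t in at_left (1::real). t \<in> {-1<..<1}"
      by (rule eventually_at_leftI[of "-1"]) auto
    with B show "\<forall>\<^sub>F t in at_left 1. (\<Sum>l<m. p l * ((Gd k l t - Gd k l 1) / (t - 1))) \<le> B"
    proof eventually_elim
      fix t :: real assume t: "t \<in> {-1<..<1}" and B: "(K k 1 - K k t) / (1 - t) \<le> B"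
      have e: "(a - b) / (t - 1) = (b - a) / (1 - t)" for a b :: real
        by (metis minus_diff_eq minus_divide_divide)
      have s: "summable (\<lambda>l. p l * Gd k l 1 - p l * Gd k l t)"
        using t by (intro summable_diff summable_K f) auto
      have nn: "p l * Gd k l 1 - p l * Gd k l t \<ge> 0" for l
        using term_bound[of t l k] t by auto
      have "(\<Sum>l<m. p l * ((Gd k l t - Gd k l 1) / (t - 1))) = (\<Sum>l<m. p l * Gd k l 1 - p l * Gd k l t) / (1 - t)"
        unfolding e by (simp add: sum_divide_distrib right_diff_distrib)
      also have "\<dots> \<le> (\<Sum>l. p l * Gd k l 1 - p l * Gd k l t) / (1 - t)"
        using t by (intro divide_right_mono sum_le_suminf s nn) auto
      also have "\<dots> = (K k 1 - K k t) / (1 - t)"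
        unfolding K_def using t by (subst suminf_diff) (auto intro!: summable_K f)
      finally show "(\<Sum>l<m. p l * ((Gd k l t - Gd k l 1) / (t - 1))) \<le> B" using B by linarith
    qed
  qed simp
  then show ?thesis unfolding fin_def
    by (intro summableI_nonneg_bounded) (auto intro: mult_nonneg_nonneg p_nonneg Gd_one_nonneg)
qed

text \<open>Only differentiability near \<open>1\<close> is given. Inductively the
  \<open>k\<close>-th derivative agrees with \<open>K k\<close> there, so its difference quotient at
  \<open>1\<close> is bounded and the next series converges, on the whole interval at once.\<close>

lemma fin_if_times_differentiable:
  assumes eq: "\<And>t. t \<in> {-1..1} \<Longrightarrow> f t = K 0 t" and fin0: "fin 0"
    and td: "times_differentiable_near_1 n f"
  shows "fin n"
proof -
  obtain \<epsilon> F where \<epsilon>: "0 < \<epsilon>" "\<epsilon> \<le> 2" and F0: "\<And>x. x \<in> {1-\<epsilon>..1} \<Longrightarrow> F 0 x = f x"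
    and F: "\<And>k x. k < n \<Longrightarrow> x \<in> {1-\<epsilon>..1} \<Longrightarrow> (F k has_real_derivative F (Suc k) x) (at x within {1-\<epsilon>..1})"
    using td unfolding times_differentiable_near_1_def times_differentiable_on_def by blast
  have "fin k \<and> (\<forall>t\<in>{1-\<epsilon>..1}. F k t = K k t)" if "k \<le> n" for k
    using that
  proof (induction k)
    case 0
    then show ?case using fin0 F0 eq \<epsilon> by simp
  next
    case (Suc k)
    then have IH: "fin k" "\<And>t. t \<in> {1-\<epsilon>..1} \<Longrightarrow> F k t = K k t" and k: "k < n" by auto
    have d: "(K k has_real_derivative F (Suc k) x) (at x within {1-\<epsilon>..1})" if "x \<in> {1-\<epsilon>..1}" for x
      using F[OF k that] by (rule has_field_derivative_transform_within[OF _ zero_less_one that]) (use IH in auto)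
    have f: "fin (Suc k)"
      by (rule fin_Suc_if_bounded_quotient[OF IH(1)], rule deriv_bounded_quotient[OF d]) (use \<epsilon> in auto)
    have "F (Suc k) x = K (Suc k) x" if x: "x \<in> {1-\<epsilon>..1}" for x
    proof (rule has_real_derivative_Icc_unique[OF d[OF x] _ _ x])
      have "(K k has_real_derivative K (Suc k) x) (at x within {-1..1})"
        using K_deriv[OF f] x \<epsilon> by (simp add: deriv_I_def)
      then show "(K k has_real_derivative K (Suc k) x) (at x within {1 - \<epsilon>..1})"
        by (rule DERIV_subset) (use \<epsilon> in auto)
    qed (use \<epsilon> in auto)
    then show ?case using f by auto
  qed
  then show ?thesis by auto
qed

lemma times_differentiable_if_fin:
  assumes eq: "\<And>t. t \<in> {-1..1} \<Longrightarrow> f t = K 0 t" and f: "fin n"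
  shows "times_differentiable_near_1 n f"
  unfolding times_differentiable_near_1_def times_differentiable_on_def
proof (intro exI conjI allI impI ballI)
  fix x :: real assume x: "x \<in> {1-2..1}"
  then show "K 0 x = f x" using eq by simp
  fix k assume "k < n"
  then have "fin (Suc k)" by (intro fin_mono[OF f]) auto
  then show "(K k has_real_derivative K (Suc k) x) (at x within {1-2..1})"
    using K_deriv x by (simp add: deriv_I_def)
qed auto

end

section \<open>Correlated Gaussian pairs\<close>

abbreviation "std_normal2 \<equiv> std_normal_distribution \<Otimes>\<^sub>M std_normal_distribution"

interpretation std_normal: real_distribution std_normal_distribution
  by (rule real_dist_normal_dist)

interpretation std_normal2: pair_prob_space std_normal_distribution std_normal_distribution ..

definition correlated :: "real \<Rightarrow> real \<times> real \<Rightarrow> real" where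
  "correlated \<rho> p = \<rho> * fst p + sqrt (1 - \<rho>\<^sup>2) * snd p"

lemma measurable_fst_std_normal2 [measurable]: "fst \<in> borel_measurable std_normal2"
  using measurable_fst[of std_normal_distribution std_normal_distribution]
  by (simp cong: measurable_cong_sets)

lemma measurable_snd_std_normal2 [measurable]: "snd \<in> borel_measurable std_normal2"
  using measurable_snd[of std_normal_distribution std_normal_distribution]
  by (simp cong: measurable_cong_sets)

lemma measurable_correlated [measurable]: "correlated \<rho> \<in> borel_measurable std_normal2"
  unfolding correlated_def by measurable

lemma char_std_normal2:
  "(CLINT p|std_normal2. iexp (a * fst p + b * snd p)) = complex_of_real (exp (- (a\<^sup>2 + b\<^sup>2) / 2))"
proof -
  have int: "integrable std_normal2 (\<lambda>p. iexp (a * fst p + b * snd p))"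
    by (rule std_normal2.P.integrable_const_bound[where B = 1]) (auto simp: norm_exp_i_times)
  have "(CLINT p|std_normal2. iexp (a * fst p + b * snd p)) =
    (CLINT x|std_normal_distribution. CLINT y|std_normal_distribution. iexp (a * x) * iexp (b * y))"
    by (subst std_normal2.integral_fst'[OF int, symmetric]) (simp add: exp_add[symmetric] distrib_left)
  also have "\<dots> = char std_normal_distribution a * char std_normal_distribution b"
    by (simp add: char_def)
  also have "\<dots> = complex_of_real (exp (- (a\<^sup>2 + b\<^sup>2) / 2))"
    by (simp add: char_std_normal_distribution exp_add[symmetric] add_divide_distrib flip: of_real_mult)
  finally show ?thesis .
qed

text \<open>The linear form \<open>s * fst + t * correlated \<rho>\<close> is Gaussian with variance
  \<open>s^2 + 2 \<rho> s t + t^2\<close>.\<close>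

lemma char_correlated:
  assumes "\<bar>\<rho>\<bar> \<le> 1"
  shows "(CLINT p|std_normal2. iexp (s * fst p + t * correlated \<rho> p))
    = complex_of_real (exp (- (s\<^sup>2 + t\<^sup>2) / 2 - \<rho> * s * t))"
proof -
  have r: "1 - \<rho>\<^sup>2 \<ge> 0" using assms by (simp add: abs_square_le_1)
  have e: "s * fst p + t * correlated \<rho> p = (s + t * \<rho>) * fst p + (t * sqrt (1 - \<rho>\<^sup>2)) * snd p" for p
    by (simp add: correlated_def algebra_simps)
  have "- ((s + t * \<rho>)\<^sup>2 + (t * sqrt (1 - \<rho>\<^sup>2))\<^sup>2) / 2 = - (s\<^sup>2 + t\<^sup>2) / 2 - \<rho> * s * t"
    using r by (simp add: power_mult_distrib) (simp add: power2_eq_square field_simps)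
  then show ?thesis unfolding e char_std_normal2 by simp
qed

lemma distr_std_normal:
  assumes X [measurable]: "X \<in> borel_measurable std_normal2"
    and c: "\<And>t. (CLINT p|std_normal2. iexp (t * X p)) = complex_of_real (exp (- t\<^sup>2 / 2))"
  shows "distr std_normal2 borel X = std_normal_distribution"
proof (rule Levy_uniqueness)
  show "real_distribution (distr std_normal2 borel X)"
    by (intro std_normal2.P.real_distribution_distr) simp
  show "char (distr std_normal2 borel X) = char std_normal_distribution"
  proof
    fix t
    have "char (distr std_normal2 borel X) t = (CLINT p|std_normal2. iexp (t * X p))"
      unfolding char_def by (subst integral_distr) auto
    then show "char (distr std_normal2 borel X) t = char std_normal_distribution t"
      by (simp only: c char_std_normal_distribution)
  qed
qed (rule real_dist_normal_dist)

lemma distr_fst: "distr std_normal2 borel fst = std_normal_distribution"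
  using char_std_normal2[of _ 0] by (intro distr_std_normal) simp_all

lemma distr_correlated: "\<bar>\<rho>\<bar> \<le> 1 \<Longrightarrow> distr std_normal2 borel (correlated \<rho>) = std_normal_distribution"
  using char_correlated[of \<rho> 0] by (intro distr_std_normal) simp_all

section \<open>Square-integrable functions of correlated Gaussian variables\<close>

definition square_integrable :: "(real \<Rightarrow> real) \<Rightarrow> bool" where
  "square_integrable f \<longleftrightarrow> f \<in> borel_measurable borel \<and> integrable std_normal_distribution (\<lambda>x. (f x)\<^sup>2)"

definition sq_norm :: "(real \<Rightarrow> real) \<Rightarrow> real" where
  "sq_norm f = (\<integral>x. (f x)\<^sup>2 \<partial>std_normal_distribution)"

lemma square_integrable_measurable [measurable_dest]: "square_integrable f \<Longrightarrow> f \<in> borel_measurable borel"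
  by (simp add: square_integrable_def)

lemma square_integrable_bounded:
  assumes "f \<in> borel_measurable borel" "\<And>x. \<bar>f x\<bar> \<le> B"
  shows "square_integrable f"
  unfolding square_integrable_def
proof
  show "integrable std_normal_distribution (\<lambda>x. (f x)\<^sup>2)"
  proof (rule std_normal.integrable_const_bound[where B = "B\<^sup>2"])
    show "AE x in std_normal_distribution. norm ((f x)\<^sup>2) \<le> B\<^sup>2"
      using assms(2) by (auto intro!: AE_I2 power2_le_iff_abs_le[THEN iffD2] simp: order_trans[OF abs_ge_zero assms(2)])
  qed (use assms(1) in measurable)
qed fact

lemma square_integrable_scale: "square_integrable f \<Longrightarrow> square_integrable (\<lambda>x. c * f x)"
  by (auto simp: square_integrable_def power_mult_distrib)

lemma sum_square_le: "((a::real) + b)\<^sup>2 \<le> 2 * a\<^sup>2 + 2 * b\<^sup>2"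
  using zero_le_power2[of "a - b"] by (simp add: power2_eq_square algebra_simps)

lemma square_integrable_add:
  assumes "square_integrable f" "square_integrable g"
  shows "square_integrable (\<lambda>x. f x + g x)"
proof -
  have "integrable std_normal_distribution (\<lambda>x. (f x + g x)\<^sup>2)"
    by (rule Bochner_Integration.integrable_bound[of _ "\<lambda>x. 2 * (f x)\<^sup>2 + 2 * (g x)\<^sup>2"])
      (use assms in \<open>auto simp: square_integrable_def sum_square_le\<close>)
  then show ?thesis using assms by (auto simp: square_integrable_def)
qed

lemma square_integrable_diff:
  assumes "square_integrable f" "square_integrable g"
  shows "square_integrable (\<lambda>x. f x - g x)"
  using square_integrable_add[OF assms(1) square_integrable_scale[OF assms(2), of "-1"]] by simp

lemma sq_norm_nonneg: "sq_norm f \<ge> 0"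
  by (simp add: sq_norm_def)

lemma sq_norm_add_le:
  assumes "square_integrable f" "square_integrable g"
  shows "sq_norm (\<lambda>x. f x + g x) \<le> 2 * sq_norm f + 2 * sq_norm g"
proof -
  have "sq_norm (\<lambda>x. f x + g x) \<le> (\<integral>x. 2 * (f x)\<^sup>2 + 2 * (g x)\<^sup>2 \<partial>std_normal_distribution)"
    unfolding sq_norm_def
    by (rule integral_mono) (use assms square_integrable_add[OF assms] in \<open>auto simp: square_integrable_def sum_square_le\<close>)
  also have "\<dots> = 2 * sq_norm f + 2 * sq_norm g"
    unfolding sq_norm_def using assms by (subst Bochner_Integration.integral_add) (auto simp: square_integrable_def)
  finally show ?thesis .
qed

definition pair_exp :: "real \<Rightarrow> (real \<Rightarrow> real) \<Rightarrow> (real \<Rightarrow> real) \<Rightarrow> real" where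
  "pair_exp \<rho> f g = (\<integral>p. f (fst p) * g (correlated \<rho> p) \<partial>std_normal2)"

lemma gaussian_pair_expectation_eq: "gaussian_pair_expectation \<sigma> \<rho> = pair_exp \<rho> \<sigma> \<sigma>"
  by (simp add: gaussian_pair_expectation_def pair_exp_def correlated_def)

lemma integral_square_distr:
  assumes f: "square_integrable f" and X [measurable]: "X \<in> borel_measurable std_normal2"
    and D: "distr std_normal2 borel X = std_normal_distribution"
  shows "integrable std_normal2 (\<lambda>p. (f (X p))\<^sup>2)" "(\<integral>p. (f (X p))\<^sup>2 \<partial>std_normal2) = sq_norm f"
proof -
  have [measurable]: "f \<in> borel_measurable borel" using f by (rule square_integrable_measurable)
  have "integrable (distr std_normal2 borel X) (\<lambda>x. (f x)\<^sup>2)"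
    unfolding D using f by (simp add: square_integrable_def)
  then show "integrable std_normal2 (\<lambda>p. (f (X p))\<^sup>2)"
    by (subst (asm) integrable_distr_eq) auto
  have "sq_norm f = (\<integral>x. (f x)\<^sup>2 \<partial>distr std_normal2 borel X)"
    unfolding D sq_norm_def ..
  then show "(\<integral>p. (f (X p))\<^sup>2 \<partial>std_normal2) = sq_norm f"
    by (subst (asm) integral_distr) auto
qed

lemmas integral_fst_square = integral_square_distr[OF _ measurable_fst_std_normal2 distr_fst]
lemmas integral_correlated_square = integral_square_distr[OF _ measurable_correlated distr_correlated]

lemma pair_exp_1: "square_integrable f \<Longrightarrow> pair_exp 1 f f = sq_norm f"
  using integral_fst_square(2)[of f] by (simp add: pair_exp_def correlated_def power2_eq_square)

lemma am_gm_weighted: "(\<delta>::real) > 0 \<Longrightarrow> \<bar>a * b\<bar> \<le> (a\<^sup>2 / \<delta> + \<delta> * b\<^sup>2) / 2"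
proof -
  assume \<delta>: "\<delta> > 0"
  have "2 * \<delta> * \<bar>a * b\<bar> \<le> a\<^sup>2 + \<delta>\<^sup>2 * b\<^sup>2"
    using zero_le_power2[of "\<bar>a\<bar> - \<delta> * \<bar>b\<bar>"]
    by (simp add: power2_diff abs_mult power_mult_distrib mult_ac)
  with \<delta> show ?thesis by (simp add: field_simps power2_eq_square)
qed

lemma pair_exp_integrable:
  assumes "square_integrable f" "square_integrable g" "\<bar>\<rho>\<bar> \<le> 1"
  shows "integrable std_normal2 (\<lambda>p. f (fst p) * g (correlated \<rho> p))"
proof (rule Bochner_Integration.integrable_bound)
  show "integrable std_normal2 (\<lambda>p. ((f (fst p))\<^sup>2 / 1 + 1 * (g (correlated \<rho> p))\<^sup>2) / 2)"
    using integral_fst_square(1)[OF assms(1)] integral_correlated_square(1)[OF assms(2,3)] by simp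
  show "AE p in std_normal2. norm (f (fst p) * g (correlated \<rho> p))
      \<le> norm (((f (fst p))\<^sup>2 / 1 + 1 * (g (correlated \<rho> p))\<^sup>2) / 2)"
    by (intro AE_I2) (use am_gm_weighted[OF zero_less_one] in \<open>simp add: abs_mult\<close>)
qed (use assms(1,2)[THEN square_integrable_measurable] in measurable)

text \<open>A substitute for the Cauchy-Schwarz inequality; the free parameter
  \<open>\<delta>\<close> is balanced by the caller.\<close>

lemma pair_exp_bound:
  assumes "square_integrable f" "square_integrable g" "\<bar>\<rho>\<bar> \<le> 1" "\<delta> > 0"
  shows "\<bar>pair_exp \<rho> f g\<bar> \<le> (sq_norm f / \<delta> + \<delta> * sq_norm g) / 2"
proof -
  have "\<bar>pair_exp \<rho> f g\<bar> \<le> (\<integral>p. ((f (fst p))\<^sup>2 / \<delta> + \<delta> * (g (correlated \<rho> p))\<^sup>2) / 2 \<partial>std_normal2)"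
    unfolding pair_exp_def
    by (rule integral_abs_bound_integral)
      (use assms pair_exp_integrable integral_fst_square(1) integral_correlated_square(1) am_gm_weighted in auto)
  also have "\<dots> = (sq_norm f / \<delta> + \<delta> * sq_norm g) / 2"
    using integral_fst_square[OF assms(1)] integral_correlated_square[OF assms(2,3)] by simp
  finally show ?thesis .
qed

lemma pair_exp_add_left:
  assumes "square_integrable f" "square_integrable f2" "square_integrable g" "\<bar>\<rho>\<bar> \<le> 1"
  shows "pair_exp \<rho> (\<lambda>x. f x + f2 x) g = pair_exp \<rho> f g + pair_exp \<rho> f2 g"
  unfolding pair_exp_def using assms
  by (subst Bochner_Integration.integral_add[symmetric]) (auto intro: pair_exp_integrable simp: distrib_right)

lemma pair_exp_add_right:
  assumes "square_integrable f" "square_integrable g" "square_integrable g2" "\<bar>\<rho>\<bar> \<le> 1"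
  shows "pair_exp \<rho> f (\<lambda>x. g x + g2 x) = pair_exp \<rho> f g + pair_exp \<rho> f g2"
  unfolding pair_exp_def using assms
  by (subst Bochner_Integration.integral_add[symmetric]) (auto intro: pair_exp_integrable simp: distrib_left)

text \<open>Writing the approximation as \<open>f + u\<close>, the expectation expands into four
  terms, three of which contain the error \<open>u\<close>.\<close>

lemma pair_exp_tendsto:
  assumes f: "square_integrable f" and F: "\<And>n. square_integrable (F n)" and r: "\<bar>\<rho>\<bar> \<le> 1"
    and lim: "(\<lambda>n. sq_norm (\<lambda>x. F n x - f x)) \<longlonglongrightarrow> 0"
  shows "(\<lambda>n. pair_exp \<rho> (F n) (F n)) \<longlonglongrightarrow> pair_exp \<rho> f f"
proof -
  define e where "e n = sq_norm (\<lambda>x. F n x - f x)" for n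
  have e0: "e \<longlonglongrightarrow> 0" using lim by (simp add: e_def[abs_def])
  \<comment> \<open>The square root balances the two parts of \<open>pair_exp_bound\<close>; the
    extra summand keeps \<open>\<delta> n\<close> positive when \<open>e n = 0\<close>.\<close>
  define \<delta> where "\<delta> n = sqrt (e n) + inverse (real (Suc n))" for n
  define b where "b n = e n + \<delta> n * (1 + sq_norm f)" for n
  have "\<delta> \<longlonglongrightarrow> sqrt 0 + 0"
    unfolding \<delta>_def by (intro tendsto_intros e0 LIMSEQ_inverse_real_of_nat)
  then have b0: "b \<longlonglongrightarrow> 0 + (sqrt 0 + 0) * (1 + sq_norm f)"
    unfolding b_def by (intro tendsto_intros e0)
  have "\<bar>pair_exp \<rho> (F n) (F n) - pair_exp \<rho> f f\<bar> \<le> b n" for n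
  proof -
    define u where "u x = F n x - f x" for x
    have u: "square_integrable u" unfolding u_def by (intro square_integrable_diff F f)
    have Fn: "F n = (\<lambda>x. f x + u x)" by (simp add: u_def)
    have uf: "square_integrable (\<lambda>x. f x + u x)" by (intro square_integrable_add f u)
    have "pair_exp \<rho> (F n) (F n) = pair_exp \<rho> f f + pair_exp \<rho> f u + (pair_exp \<rho> u f + pair_exp \<rho> u u)"
      unfolding Fn by (simp add: pair_exp_add_left pair_exp_add_right f u uf r)
    moreover have en: "sq_norm u = e n" by (simp add: e_def u_def[abs_def])
    have "\<bar>pair_exp \<rho> u u\<bar> \<le> e n"
      using pair_exp_bound[OF u u r zero_less_one] en by simp
    moreover have "\<bar>pair_exp \<rho> u f\<bar> + \<bar>pair_exp \<rho> f u\<bar> \<le> \<delta> n * (1 + sq_norm f)"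
    proof -
      have en0: "e n \<ge> 0" using sq_norm_nonneg[of u] en by simp
      have \<delta>: "\<delta> n > 0" by (simp add: \<delta>_def en0 add_nonneg_pos)
      have le: "e n / \<delta> n \<le> \<delta> n"
      proof -
        have "e n = (sqrt (e n))\<^sup>2" using en0 by simp
        also have "\<dots> \<le> (\<delta> n)\<^sup>2" using en0 by (intro power_mono) (simp_all add: \<delta>_def)
        finally show ?thesis using \<delta> by (simp add: divide_le_eq power2_eq_square)
      qed
      have "\<bar>pair_exp \<rho> u f\<bar> \<le> (e n / \<delta> n + \<delta> n * sq_norm f) / 2"
        using pair_exp_bound[OF u f r \<delta>] en by simp
      moreover have "\<bar>pair_exp \<rho> f u\<bar> \<le> (sq_norm f * \<delta> n + e n / \<delta> n) / 2"
        using pair_exp_bound[OF f u r, of "1 / \<delta> n"] en \<delta> by simp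
      ultimately show ?thesis using le by (simp add: algebra_simps)
    qed
    ultimately show ?thesis by (simp add: b_def)
  qed
  then have "(\<lambda>n. pair_exp \<rho> (F n) (F n) - pair_exp \<rho> f f) \<longlonglongrightarrow> 0"
    by (intro Lim_null_comparison[OF _ b0[simplified]] always_eventually) simp
  then show ?thesis by (rule LIM_zero_cancel)
qed

section \<open>Trigonometric polynomials\<close>

text \<open>List entries are amplitude, frequency and phase. Frequencies are arbitrary reals, so the
  class is stable under multiplication by any cosine.\<close>

definition trig :: "(real \<times> real \<times> real) list \<Rightarrow> real \<Rightarrow> real" where
  "trig xs x = (\<Sum>(c, t, a)\<leftarrow>xs. c * cos (t * x + a))"

lemma trig_Nil: "trig [] x = 0" and trig_Cons: "trig ((c, t, a) # xs) x = c * cos (t * x + a) + trig xs x"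
  and trig_append: "trig (xs @ ys) x = trig xs x + trig ys x"
  by (simp_all add: trig_def)

lemma trig_measurable [measurable]: "trig xs \<in> borel_measurable borel"
  by (induction xs) (auto simp: trig_Nil[abs_def] trig_Cons[abs_def] fun_eq_iff trig_def[abs_def] split_beta')

lemma square_integrable_cos: "square_integrable (\<lambda>x. c * cos (t * x + a))"
  by (rule square_integrable_bounded[where B = "\<bar>c\<bar>"]) (auto simp: abs_mult mult_left_le)

lemma square_integrable_trig: "square_integrable (trig xs)"
proof (induction xs)
  case Nil
  show ?case using square_integrable_bounded[of "\<lambda>_. 0" 0] by (simp add: trig_Nil[abs_def])
next
  case (Cons y xs)
  obtain c t a where y: "y = (c, t, a)" by (cases y)
  have "trig (y # xs) = (\<lambda>x. c * cos (t * x + a) + trig xs x)" by (simp add: y trig_Cons fun_eq_iff)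
  then show ?case using square_integrable_add[OF square_integrable_cos Cons] by simp
qed

definition cos_or_sin :: "nat \<Rightarrow> real \<Rightarrow> real" where
  "cos_or_sin k a = (if even k then cos a else sin a)"

text \<open>Up to a sign depending only on \<open>k\<close>, this is the expectation of
  \<open>trig xs\<close> times the \<open>k\<close>-th Hermite polynomial under the standard normal
  law. The sign cancels in products of two such coefficients.\<close>

definition trig_coeff :: "nat \<Rightarrow> (real \<times> real \<times> real) list \<Rightarrow> real" where
  "trig_coeff k xs = (\<Sum>(c, t, a)\<leftarrow>xs. c * exp (- t\<^sup>2 / 2) * t ^ k * cos_or_sin k a)"

lemma expectation_cos:
  assumes "\<bar>\<rho>\<bar> \<le> 1"
  shows "(\<integral>p. cos (s * fst p + t * correlated \<rho> p + c) \<partial>std_normal2)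
     = cos c * exp (- (s\<^sup>2 + t\<^sup>2) / 2 - \<rho> * s * t)"
proof -
  have int: "integrable std_normal2 (\<lambda>p. iexp c * iexp (s * fst p + t * correlated \<rho> p))"
    by (rule std_normal2.P.integrable_const_bound[where B = 1]) (auto simp: norm_mult norm_exp_i_times)
  have "(\<integral>p. cos (s * fst p + t * correlated \<rho> p + c) \<partial>std_normal2)
     = (\<integral>p. Re (iexp c * iexp (s * fst p + t * correlated \<rho> p)) \<partial>std_normal2)"
    by (intro Bochner_Integration.integral_cong refl)
      (simp add: exp_add[symmetric] distrib_left[symmetric] Re_exp add_ac flip: of_real_add)
  also have "\<dots> = Re (CLINT p|std_normal2. iexp c * iexp (s * fst p + t * correlated \<rho> p))"
    using int by (rule integral_Re)
  also have "\<dots> = Re (iexp c * complex_of_real (exp (- (s\<^sup>2 + t\<^sup>2) / 2 - \<rho> * s * t)))"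
    by (subst integral_mult_right_zero, subst char_correlated[OF assms]) (rule refl)
  also have "\<dots> = cos c * exp (- (s\<^sup>2 + t\<^sup>2) / 2 - \<rho> * s * t)"
    by (simp add: Re_exp del: of_real_exp)
  finally show ?thesis .
qed

text \<open>The product-to-sum formula produces \<open>exp (\<rho> s t)\<close> and
  \<open>exp (- \<rho> s t)\<close>. In their power series the even terms combine to
  \<open>cos a * cos b\<close> and the odd ones to \<open>sin a * sin b\<close>.\<close>

lemma pair_exp_cos_cos:
  assumes "\<bar>\<rho>\<bar> \<le> 1"
  shows "(\<lambda>k. (exp (- s\<^sup>2 / 2) * s ^ k * cos_or_sin k a) * (exp (- t\<^sup>2 / 2) * t ^ k * cos_or_sin k b) * \<rho> ^ k / fact k)
     sums pair_exp \<rho> (\<lambda>x. cos (s * x + a)) (\<lambda>x. cos (t * x + b))"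
proof -
  have i: "integrable std_normal2 (\<lambda>p. cos (s * fst p + t' * correlated \<rho> p + c))" for s t' c
    by (rule std_normal2.P.integrable_const_bound[where B = 1]) auto
  define E where "E = exp (- (s\<^sup>2 + t\<^sup>2) / 2)"
  have "pair_exp \<rho> (\<lambda>x. cos (s * x + a)) (\<lambda>x. cos (t * x + b)) =
     (\<integral>p. (cos (s * fst p + (- t) * correlated \<rho> p + (a - b)) + cos (s * fst p + t * correlated \<rho> p + (a + b))) / 2 \<partial>std_normal2)"
    unfolding pair_exp_def cos_times_cos
    by (intro Bochner_Integration.integral_cong refl) (simp add: algebra_simps)
  also have "\<dots> = (cos (a - b) * exp (- (s\<^sup>2 + (- t)\<^sup>2) / 2 - \<rho> * s * (- t)) + cos (a + b) * exp (- (s\<^sup>2 + t\<^sup>2) / 2 - \<rho> * s * t)) / 2"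
    by (simp only: integral_divide_zero Bochner_Integration.integral_add[OF i i] expectation_cos[OF assms])
  also have "\<dots> = E * (cos (a - b) / 2 * exp (\<rho> * s * t) + cos (a + b) / 2 * exp (- (\<rho> * s * t)))"
  proof -
    have "exp (- (s\<^sup>2 + (- t)\<^sup>2) / 2 - \<rho> * s * (- t)) = E * exp (\<rho> * s * t)"
      and "exp (- (s\<^sup>2 + t\<^sup>2) / 2 - \<rho> * s * t) = E * exp (- (\<rho> * s * t))"
      unfolding E_def exp_add[symmetric] by simp_all
    then show ?thesis by (simp only:) (simp add: algebra_simps)
  qed
  finally have e: "pair_exp \<rho> (\<lambda>x. cos (s * x + a)) (\<lambda>x. cos (t * x + b))
    = E * (cos (a - b) / 2 * exp (\<rho> * s * t) + cos (a + b) / 2 * exp (- (\<rho> * s * t)))" .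
  have "(\<lambda>k. E * (cos (a - b) / 2 * ((\<rho> * s * t) ^ k /\<^sub>R fact k) + cos (a + b) / 2 * ((- (\<rho> * s * t)) ^ k /\<^sub>R fact k)))
     sums pair_exp \<rho> (\<lambda>x. cos (s * x + a)) (\<lambda>x. cos (t * x + b))"
    unfolding e by (intro sums_mult sums_add exp_converges)
  also have "(\<lambda>k. E * (cos (a - b) / 2 * ((\<rho> * s * t) ^ k /\<^sub>R fact k) + cos (a + b) / 2 * ((- (\<rho> * s * t)) ^ k /\<^sub>R fact k)))
     = (\<lambda>k. (exp (- s\<^sup>2 / 2) * s ^ k * cos_or_sin k a) * (exp (- t\<^sup>2 / 2) * t ^ k * cos_or_sin k b) * \<rho> ^ k / fact k)"
  proof
    fix k
    have E: "E = exp (- s\<^sup>2 / 2) * exp (- t\<^sup>2 / 2)" by (simp add: E_def exp_add[symmetric] add_divide_distrib)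
    have "cos (a - b) / 2 * x + cos (a + b) / 2 * ((- 1) ^ k * x) = cos_or_sin k a * cos_or_sin k b * x" for x
      by (cases "even k") (simp_all add: cos_or_sin_def cos_add cos_diff field_simps)
    note cs = this
    define X where "X = \<rho> ^ k * s ^ k * t ^ k / fact k"
    have X: "(\<rho> * s * t) ^ k /\<^sub>R fact k = X" "(- (\<rho> * s * t)) ^ k /\<^sub>R fact k = (- 1) ^ k * X"
      unfolding X_def power_minus[of "\<rho> * s * t"] by (simp_all add: power_mult_distrib divide_inverse mult.commute)
    have gen: "(p * q) * (u * v * (x * y * z / w)) = (p * y * u) * (q * z * v) * x / w" for p q u v x y z w :: real
      by simp
    show "E * (cos (a - b) / 2 * ((\<rho> * s * t) ^ k /\<^sub>R fact k) + cos (a + b) / 2 * ((- (\<rho> * s * t)) ^ k /\<^sub>R fact k))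
       = (exp (- s\<^sup>2 / 2) * s ^ k * cos_or_sin k a) * (exp (- t\<^sup>2 / 2) * t ^ k * cos_or_sin k b) * \<rho> ^ k / fact k"
      unfolding X cs E unfolding X_def by (rule gen)
  qed
  finally show ?thesis .
qed

lemma pair_exp_scale: "pair_exp \<rho> (\<lambda>x. c * f x) g = c * pair_exp \<rho> f g"
  "pair_exp \<rho> f (\<lambda>x. c * g x) = c * pair_exp \<rho> f g"
  unfolding pair_exp_def by (simp_all add: mult.assoc mult.left_commute[of _ c])

lemma pair_exp_cos_trig:
  assumes r: "\<bar>\<rho>\<bar> \<le> 1"
  shows "(\<lambda>k. (exp (- s\<^sup>2 / 2) * s ^ k * cos_or_sin k a) * trig_coeff k ys * \<rho> ^ k / fact k)
     sums pair_exp \<rho> (\<lambda>x. cos (s * x + a)) (trig ys)"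
proof (induction ys)
  case Nil
  show ?case by (simp add: trig_Nil[abs_def] trig_coeff_def pair_exp_def)
next
  case (Cons y ys)
  obtain c t b where y: "y = (c, t, b)" by (cases y)
  have e: "trig (y # ys) = (\<lambda>x. c * cos (t * x + b) + trig ys x)" by (simp add: y trig_Cons fun_eq_iff)
  have si: "square_integrable (\<lambda>x. cos (s * x + a))" using square_integrable_cos[of 1] by simp
  have "pair_exp \<rho> (\<lambda>x. cos (s * x + a)) (trig (y # ys)) =
    c * pair_exp \<rho> (\<lambda>x. cos (s * x + a)) (\<lambda>x. cos (t * x + b)) + pair_exp \<rho> (\<lambda>x. cos (s * x + a)) (trig ys)"
    unfolding e by (subst pair_exp_add_right[OF si square_integrable_cos square_integrable_trig r]) (simp add: pair_exp_scale)
  moreover have "(\<lambda>k. c * ((exp (- s\<^sup>2 / 2) * s ^ k * cos_or_sin k a) * (exp (- t\<^sup>2 / 2) * t ^ k * cos_or_sin k b) * \<rho> ^ k / fact k)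
    + (exp (- s\<^sup>2 / 2) * s ^ k * cos_or_sin k a) * trig_coeff k ys * \<rho> ^ k / fact k)
    sums (c * pair_exp \<rho> (\<lambda>x. cos (s * x + a)) (\<lambda>x. cos (t * x + b)) + pair_exp \<rho> (\<lambda>x. cos (s * x + a)) (trig ys))"
    by (intro sums_add sums_mult pair_exp_cos_cos[OF r] Cons)
  moreover have "c * ((exp (- s\<^sup>2 / 2) * s ^ k * cos_or_sin k a) * (exp (- t\<^sup>2 / 2) * t ^ k * cos_or_sin k b) * \<rho> ^ k / fact k) + (exp (- s\<^sup>2 / 2) * s ^ k * cos_or_sin k a) * trig_coeff k ys * \<rho> ^ k / fact k
      = (exp (- s\<^sup>2 / 2) * s ^ k * cos_or_sin k a) * trig_coeff k (y # ys) * \<rho> ^ k / fact k" for k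
    by (simp add: y trig_coeff_def distrib_left distrib_right add_divide_distrib)
  ultimately show ?case by (simp only:)
qed

text \<open>Mehler's expansion for trigonometric polynomials. For \<open>xs = ys\<close> the
  coefficients are squares divided by factorials, hence nonnegative.\<close>

lemma pair_exp_trig_trig:
  assumes r: "\<bar>\<rho>\<bar> \<le> 1"
  shows "(\<lambda>k. trig_coeff k xs * trig_coeff k ys * \<rho> ^ k / fact k) sums pair_exp \<rho> (trig xs) (trig ys)"
proof (induction xs)
  case Nil
  show ?case by (simp add: trig_Nil[abs_def] trig_coeff_def pair_exp_def)
next
  case (Cons y xs)
  obtain c s a where y: "y = (c, s, a)" by (cases y)
  have e: "trig (y # xs) = (\<lambda>x. c * cos (s * x + a) + trig xs x)" by (simp add: y trig_Cons fun_eq_iff)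
  have "pair_exp \<rho> (trig (y # xs)) (trig ys) =
    c * pair_exp \<rho> (\<lambda>x. cos (s * x + a)) (trig ys) + pair_exp \<rho> (trig xs) (trig ys)"
    unfolding e by (subst pair_exp_add_left[OF square_integrable_cos square_integrable_trig square_integrable_trig r]) (simp add: pair_exp_scale)
  moreover have "(\<lambda>k. c * ((exp (- s\<^sup>2 / 2) * s ^ k * cos_or_sin k a) * trig_coeff k ys * \<rho> ^ k / fact k)
    + trig_coeff k xs * trig_coeff k ys * \<rho> ^ k / fact k)
    sums (c * pair_exp \<rho> (\<lambda>x. cos (s * x + a)) (trig ys) + pair_exp \<rho> (trig xs) (trig ys))"
    by (intro sums_add sums_mult pair_exp_cos_trig[OF r] Cons)
  moreover have "c * ((exp (- s\<^sup>2 / 2) * s ^ k * cos_or_sin k a) * trig_coeff k ys * \<rho> ^ k / fact k) + trig_coeff k xs * trig_coeff k ys * \<rho> ^ k / fact k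
      = trig_coeff k (y # xs) * trig_coeff k ys * \<rho> ^ k / fact k" for k
    by (simp add: y trig_coeff_def distrib_left distrib_right add_divide_distrib)
  ultimately show ?case by (simp only:)
qed

lemma pair_exp_trig_mono:
  assumes "0 \<le> \<rho>1" "\<rho>1 \<le> \<rho>2" "\<rho>2 \<le> 1"
  shows "0 \<le> pair_exp \<rho>1 (trig xs) (trig xs)"
    "pair_exp \<rho>1 (trig xs) (trig xs) \<le> pair_exp \<rho>2 (trig xs) (trig xs)"
proof -
  have 1: "(\<lambda>k. trig_coeff k xs * trig_coeff k xs * \<rho>1 ^ k / fact k) sums pair_exp \<rho>1 (trig xs) (trig xs)"
    and 2: "(\<lambda>k. trig_coeff k xs * trig_coeff k xs * \<rho>2 ^ k / fact k) sums pair_exp \<rho>2 (trig xs) (trig xs)"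
    using assms by (intro pair_exp_trig_trig; simp)+
  show "0 \<le> pair_exp \<rho>1 (trig xs) (trig xs)"
    by (rule sums_le[OF _ sums_zero 1]) (use assms in simp)
  show "pair_exp \<rho>1 (trig xs) (trig xs) \<le> pair_exp \<rho>2 (trig xs) (trig xs)"
    by (rule sums_le[OF _ 1 2]) (use assms in \<open>auto intro!: divide_right_mono mult_left_mono power_mono\<close>)
qed

text \<open>Termwise comparison with the series at correlation 1, because
  \<open>- r \<le> (- r) ^ k\<close> for every \<open>k\<close>, including
  \<open>k = 0\<close>.\<close>

lemma pair_exp_trig_neg:
  assumes "0 \<le> r" "r \<le> 1"
  shows "pair_exp (- r) (trig xs) (trig xs) \<ge> - r * sq_norm (trig xs)"
proof -
  have 1: "(\<lambda>k. - r * (trig_coeff k xs * trig_coeff k xs * 1 ^ k / fact k)) sums (- r * sq_norm (trig xs))"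
    unfolding pair_exp_1[OF square_integrable_trig, symmetric]
    by (intro sums_mult pair_exp_trig_trig) simp
  have 2: "(\<lambda>k. trig_coeff k xs * trig_coeff k xs * (- r) ^ k / fact k) sums pair_exp (- r) (trig xs) (trig xs)"
    using assms by (intro pair_exp_trig_trig) simp
  have "- r \<le> (- r) ^ k" for k
  proof (cases "even k")
    case True
    then show ?thesis using assms by (simp add: order_trans[of _ 0])
  next
    case False
    then have "r ^ k \<le> r ^ 1" using assms by (intro power_decreasing) (auto simp: odd_pos Suc_leI)
    then show ?thesis using False by simp
  qed
  then have "(trig_coeff k xs * trig_coeff k xs / fact k) * (- r) \<le> (trig_coeff k xs * trig_coeff k xs / fact k) * (- r) ^ k" for k
    by (intro mult_left_mono) auto
  then show ?thesis
    by (intro sums_le[OF _ 1 2]) (simp add: mult_ac)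
qed

section \<open>Density of trigonometric polynomials\<close>

definition approximable :: "(real \<Rightarrow> real) \<Rightarrow> bool" where
  "approximable f \<longleftrightarrow> square_integrable f \<and> (\<forall>e>0. \<exists>xs. sq_norm (\<lambda>x. trig xs x - f x) < e)"

lemma approximable_trig: "approximable (trig xs)"
  unfolding approximable_def using square_integrable_trig[of xs]
  by (auto intro!: exI[of _ xs] simp: sq_norm_def)

lemma approximable_closed:
  assumes f: "square_integrable f" and ex: "\<And>e. e > 0 \<Longrightarrow> \<exists>g. approximable g \<and> sq_norm (\<lambda>x. g x - f x) < e"
  shows "approximable f"
  unfolding approximable_def
proof (intro conjI f allI impI)
  fix e :: real assume e: "e > 0"
  \<comment> \<open>The squared norm satisfies the triangle inequality only with a factor 2 on both
    summands, hence a quarter of \<open>e\<close> for each.\<close>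
  obtain g where g: "approximable g" "sq_norm (\<lambda>x. g x - f x) < e / 4" using ex[of "e / 4"] e by auto
  then have gi: "square_integrable g" by (simp add: approximable_def)
  obtain xs where xs: "sq_norm (\<lambda>x. trig xs x - g x) < e / 4"
    using g(1) e unfolding approximable_def by (metis divide_pos_pos zero_less_numeral)
  have "sq_norm (\<lambda>x. (trig xs x - g x) + (g x - f x)) \<le> 2 * sq_norm (\<lambda>x. trig xs x - g x) + 2 * sq_norm (\<lambda>x. g x - f x)"
    by (intro sq_norm_add_le square_integrable_diff square_integrable_trig gi f)
  also have "\<dots> < e" using g xs by linarith
  finally show "\<exists>xs. sq_norm (\<lambda>x. trig xs x - f x) < e" by (intro exI[of _ xs]) simp
qed

text \<open>Dominated convergence makes the class stable under pointwise limits with a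
  square-integrable majorant, which carries it from continuous functions to indicators and then to
  simple functions and their limits.\<close>

lemma approximable_limit:
  assumes F: "\<And>n. approximable (F n)" and lim: "\<And>x. (\<lambda>n. F n x) \<longlonglongrightarrow> f x"
    and w: "square_integrable w" and bd: "\<And>n x. \<bar>F n x\<bar> \<le> \<bar>w x\<bar>"
  shows "approximable f"
proof -
  have Fi: "square_integrable (F n)" for n using F by (simp add: approximable_def)
  have Fm [measurable]: "F n \<in> borel_measurable borel" for n using Fi by (rule square_integrable_measurable)
  have [measurable]: "w \<in> borel_measurable borel" using w by (rule square_integrable_measurable)
  have fm [measurable]: "f \<in> borel_measurable borel"
    by (rule borel_measurable_LIMSEQ_metric[OF Fm lim])
  have fb: "\<bar>f x\<bar> \<le> \<bar>w x\<bar>" for x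
    by (rule tendsto_upperbound[OF tendsto_rabs[OF lim]]) (use bd in auto)
  have f: "square_integrable f"
    unfolding square_integrable_def
  proof
    show "integrable std_normal_distribution (\<lambda>x. (f x)\<^sup>2)"
      by (rule Bochner_Integration.integrable_bound[of _ "\<lambda>x. (w x)\<^sup>2"])
        (use w fb in \<open>auto simp: square_integrable_def abs_le_square_iff\<close>)
  qed measurable
  have "(\<lambda>n. \<integral>x. (F n x - f x)\<^sup>2 \<partial>std_normal_distribution) \<longlonglongrightarrow> (\<integral>x. 0 \<partial>std_normal_distribution)"
  proof (rule integral_dominated_convergence[where w = "\<lambda>x. 4 * (w x)\<^sup>2"])
    show "integrable std_normal_distribution (\<lambda>x. 4 * (w x)\<^sup>2)"
      using w by (simp add: square_integrable_def)
    show "AE x in std_normal_distribution. (\<lambda>n. (F n x - f x)\<^sup>2) \<longlonglongrightarrow> 0"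
    proof (intro AE_I2)
      fix x
      have "(\<lambda>n. (F n x - f x)\<^sup>2) \<longlonglongrightarrow> (f x - f x)\<^sup>2" by (intro tendsto_intros lim)
      then show "(\<lambda>n. (F n x - f x)\<^sup>2) \<longlonglongrightarrow> 0" by simp
    qed
    show "AE x in std_normal_distribution. norm ((F n x - f x)\<^sup>2) \<le> 4 * (w x)\<^sup>2" for n
    proof (intro AE_I2)
      fix x
      have "\<bar>F n x - f x\<bar> \<le> \<bar>2 * w x\<bar>" using bd[of n x] fb[of x] by linarith
      then have "(F n x - f x)\<^sup>2 \<le> (2 * w x)\<^sup>2" by (simp only: abs_le_square_iff)
      then show "norm ((F n x - f x)\<^sup>2) \<le> 4 * (w x)\<^sup>2" by (simp add: power_mult_distrib)
    qed
  qed measurable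
  then have lim0: "(\<lambda>n. sq_norm (\<lambda>x. F n x - f x)) \<longlonglongrightarrow> 0" by (simp add: sq_norm_def)
  show ?thesis
  proof (rule approximable_closed[OF f])
    fix e :: real assume "e > 0"
    then have "eventually (\<lambda>n. sq_norm (\<lambda>x. F n x - f x) < e) sequentially"
      using lim0 by (intro order_tendstoD)
    then obtain n where "sq_norm (\<lambda>x. F n x - f x) < e" by (auto simp: eventually_sequentially)
    with F show "\<exists>g. approximable g \<and> sq_norm (\<lambda>x. g x - f x) < e" by blast
  qed
qed

lemma trig_scale: "c * trig xs x = trig (map (\<lambda>(b, t, a). (c * b, t, a)) xs) x"
  by (induction xs) (auto simp: trig_Nil trig_Cons algebra_simps)

lemma approximable_scale:
  assumes "approximable f" shows "approximable (\<lambda>x. c * f x)"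
proof (rule approximable_closed)
  show "square_integrable (\<lambda>x. c * f x)"
    using assms by (auto simp: approximable_def intro: square_integrable_scale)
  fix e :: real assume e: "e > 0"
  obtain xs where xs: "sq_norm (\<lambda>x. trig xs x - f x) < e / (1 + c\<^sup>2)"
    using assms e unfolding approximable_def by (meson add_pos_nonneg divide_pos_pos zero_le_power2 zero_less_one)
  have s: "1 + c\<^sup>2 > 0" by (simp add: add_pos_nonneg)
  have "sq_norm (\<lambda>x. trig (map (\<lambda>(b, t, a). (c * b, t, a)) xs) x - c * f x) = c\<^sup>2 * sq_norm (\<lambda>x. trig xs x - f x)"
    unfolding sq_norm_def trig_scale[symmetric]
    by (simp add: right_diff_distrib[symmetric] power_mult_distrib)
  also have "\<dots> \<le> (1 + c\<^sup>2) * sq_norm (\<lambda>x. trig xs x - f x)"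
    using sq_norm_nonneg by (intro mult_right_mono) auto
  also have "\<dots> < e" using xs s by (simp add: field_simps)
  finally show "\<exists>g. approximable g \<and> sq_norm (\<lambda>x. g x - c * f x) < e"
    using approximable_trig by blast
qed

lemma approximable_add:
  assumes "approximable f" "approximable g" shows "approximable (\<lambda>x. f x + g x)"
proof (rule approximable_closed)
  have fg: "square_integrable f" "square_integrable g" using assms by (auto simp: approximable_def)
  then show "square_integrable (\<lambda>x. f x + g x)" by (rule square_integrable_add)
  fix e :: real assume e: "e > 0"
  obtain xs where xs: "sq_norm (\<lambda>x. trig xs x - f x) < e / 4"
    using assms(1) e unfolding approximable_def by (metis divide_pos_pos zero_less_numeral)
  obtain ys where ys: "sq_norm (\<lambda>x. trig ys x - g x) < e / 4"
    using assms(2) e unfolding approximable_def by (metis divide_pos_pos zero_less_numeral)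
  have "sq_norm (\<lambda>x. (trig xs x - f x) + (trig ys x - g x)) \<le> 2 * sq_norm (\<lambda>x. trig xs x - f x) + 2 * sq_norm (\<lambda>x. trig ys x - g x)"
    by (intro sq_norm_add_le square_integrable_diff square_integrable_trig fg)
  also have "\<dots> < e" using xs ys by linarith
  also have "(\<lambda>x. (trig xs x - f x) + (trig ys x - g x)) = (\<lambda>x. trig (xs @ ys) x - (f x + g x))"
    by (auto simp: trig_append)
  finally show "\<exists>h. approximable h \<and> sq_norm (\<lambda>x. h x - (f x + g x)) < e"
    using approximable_trig by blast
qed

lemma approximable_const: "approximable (\<lambda>_. c)"
proof -
  have "trig [(c, 0, 0)] = (\<lambda>_. c)" by (simp add: trig_Nil trig_Cons fun_eq_iff)
  then show ?thesis using approximable_trig[of "[(c, 0, 0)]"] by simp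
qed

lemma approximable_sum:
  "finite A \<Longrightarrow> (\<And>i. i \<in> A \<Longrightarrow> approximable (f i)) \<Longrightarrow> approximable (\<lambda>x. \<Sum>i\<in>A. f i x)"
  by (induction A rule: finite_induct) (auto intro: approximable_const approximable_add)

lemma trig_times_cos: "\<exists>ys. \<forall>x. trig xs x * cos (s * x + b) = trig ys x"
proof (induction xs)
  case Nil
  show ?case by (intro exI[of _ "[]"]) (simp add: trig_Nil)
next
  case (Cons y xs)
  obtain c t a where y: "y = (c, t, a)" by (cases y)
  obtain ys where ys: "\<And>x. trig xs x * cos (s * x + b) = trig ys x" using Cons by blast
  have "cos (t * x + a) * cos (s * x + b) = cos ((t - s) * x + (a - b)) / 2 + cos ((t + s) * x + (a + b)) / 2" for x
    by (simp add: cos_times_cos algebra_simps add_divide_distrib)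
  note cc = this
  have "trig (y # xs) x * cos (s * x + b) = trig ((c / 2, t - s, a - b) # (c / 2, t + s, a + b) # ys) x" for x
  proof -
    have "trig (y # xs) x * cos (s * x + b) = c * (cos (t * x + a) * cos (s * x + b)) + trig xs x * cos (s * x + b)"
      by (simp add: y trig_Cons distrib_right)
    then show ?thesis unfolding cc ys trig_Cons by (simp add: distrib_left)
  qed
  then show ?case by blast
qed

lemma sin_power_trig: "\<exists>ys. \<forall>x. sin (s * x) ^ k = trig ys x"
proof (induction k)
  case 0
  show ?case by (intro exI[of _ "[(1, 0, 0)]"]) (simp add: trig_Nil trig_Cons)
next
  case (Suc k)
  then obtain ys where ys: "\<And>x. sin (s * x) ^ k = trig ys x" by blast
  obtain zs where zs: "\<And>x. trig ys x * cos (s * x + (- pi / 2)) = trig zs x" using trig_times_cos by blast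
  have "sin (s * x) = cos (s * x + (- pi / 2))" for x
    by (simp add: cos_add cos_diff)
  then show ?case using ys zs by (intro exI[of _ zs]) (simp add: mult.commute)
qed

text \<open>A bounded continuous \<open>g\<close> is the limit of \<open>x \<mapsto> g (T sin (x / T))\<close> as \<open>T \<rightarrow> \<infinity>\<close>, and these
  functions are approximated uniformly by polynomials in \<open>sin (x / T)\<close>.\<close>

lemma approximable_continuous_bounded:
  assumes g: "continuous_on UNIV g" and bd: "\<And>x. \<bar>g x\<bar> \<le> B"
  shows "approximable g"
proof (rule approximable_limit)
  define F where "F n x = g (real (Suc n) * sin (inverse (real (Suc n)) * x))" for n x
  have gm: "g \<in> borel_measurable borel" by (rule borel_measurable_continuous_onI[OF g])
  show "square_integrable (\<lambda>_. B)" by (rule square_integrable_bounded[where B = "\<bar>B\<bar>"]) auto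
  show Fb: "\<bar>F n x\<bar> \<le> \<bar>B\<bar>" for n x using bd by (simp add: F_def order_trans[OF bd abs_ge_self])
  show "(\<lambda>n. F n x) \<longlonglongrightarrow> g x" for x
  proof -
    have "((\<lambda>y::real. y * sin (inverse y * x)) \<longlongrightarrow> x) at_top" by real_asymp
    from filterlim_compose[OF this filterlim_compose[OF filterlim_real_sequentially filterlim_Suc]]
    have "(\<lambda>n. real (Suc n) * sin (inverse (real (Suc n)) * x)) \<longlonglongrightarrow> x" .
    moreover have "isCont g x" using g by (simp add: continuous_on_eq_continuous_at)
    ultimately show ?thesis unfolding F_def by (intro isCont_tendsto_compose[of x g])
  qed
  show "approximable (F n)" for n
  proof (rule approximable_closed)
    have "(\<lambda>x. real (Suc n) * sin (inverse (real (Suc n)) * x)) \<in> borel_measurable borel" by measurable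
    then have "F n \<in> borel_measurable borel" unfolding F_def using gm by (rule measurable_compose)
    then show Fi: "square_integrable (F n)" using Fb by (rule square_integrable_bounded)
    fix e :: real assume e: "e > 0"
    \<comment> \<open>The measure has total mass 1, so a uniform error \<open>\<epsilon>\<close>
      contributes at most \<open>e / 2\<close> to the squared norm.\<close>
    define \<epsilon> where "\<epsilon> = sqrt (e / 2)"
    have \<epsilon>: "\<epsilon> > 0" "\<epsilon>\<^sup>2 = e / 2" using e by (simp_all add: \<epsilon>_def)
    have cont: "continuous_on {-1..1} (\<lambda>y. g (real (Suc n) * y))"
      by (intro continuous_on_compose2[OF g] continuous_intros) auto
    obtain q where q: "real_polynomial_function q" "\<And>y. y \<in> {-1..1} \<Longrightarrow> \<bar>g (real (Suc n) * y) - q y\<bar> < \<epsilon>"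
      using Stone_Weierstrass_real_polynomial_function[OF _ cont \<epsilon>(1)] by auto
    obtain a m where qa: "q = (\<lambda>x. \<Sum>i\<le>m. a i * x ^ i)"
      using q(1) unfolding real_polynomial_function_iff_sum by auto
    define h where "h x = q (sin (inverse (real (Suc n)) * x))" for x
    have "approximable (\<lambda>x. a i * sin (inverse (real (Suc n)) * x) ^ i)" for i
    proof -
      obtain ys where "\<And>x. sin (inverse (real (Suc n)) * x) ^ i = trig ys x" using sin_power_trig by blast
      then show ?thesis using approximable_scale[OF approximable_trig[of ys], of "a i"] by simp
    qed
    then have h: "approximable h"
      unfolding h_def qa by (intro approximable_sum) auto
    have "sq_norm (\<lambda>x. h x - F n x) \<le> (\<integral>x. \<epsilon>\<^sup>2 \<partial>std_normal_distribution)"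
      unfolding sq_norm_def
    proof (rule integral_mono)
      show "integrable std_normal_distribution (\<lambda>x. (h x - F n x)\<^sup>2)"
        using square_integrable_diff[OF _ Fi, of h] h by (simp add: approximable_def square_integrable_def)
      fix x
      have "\<bar>h x - F n x\<bar> \<le> \<epsilon>"
        using q(2)[of "sin (inverse (real (Suc n)) * x)"] unfolding h_def F_def
        by (simp add: abs_minus_commute less_imp_le)
      then show "(h x - F n x)\<^sup>2 \<le> \<epsilon>\<^sup>2" using \<epsilon>(1) by (simp add: abs_le_square_iff[symmetric])
    qed simp
    also have "\<dots> < e" using \<epsilon> e std_normal.prob_space by simp
    finally show "\<exists>h. approximable h \<and> sq_norm (\<lambda>x. h x - F n x) < e" using h by blast
  qed
qed

text \<open>Induction over the sigma-algebra generated by the intersection-stable family of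
  half-lines. The indicator of a half-line is a limit of continuous ramps of slope
  \<open>- n\<close>; complements and disjoint unions follow from linearity and
  \<open>approximable_limit\<close>.\<close>

lemma approximable_indicator:
  assumes "A \<in> sets borel"
  shows "approximable (indicator A)"
proof -
  have one: "square_integrable (\<lambda>_. 1)" by (rule square_integrable_bounded[where B = 1]) auto
  have "Int_stable (range (\<lambda>a::real. {..a}))"
    by (auto simp: Int_stable_def)
  moreover have "range (\<lambda>a::real. {..a}) \<subseteq> Pow UNIV" by auto
  moreover have "A \<in> sigma_sets UNIV (range (\<lambda>a::real. {..a}))"
    using assms by (simp add: borel_eq_atMost)
  ultimately show ?thesis
  proof (induction rule: sigma_sets_induct_disjoint)
    case (basic A)
    then obtain a where A: "A = {..a}" by auto
    define F where "F n x = max 0 (min 1 (1 - real n * (x - a)))" for n :: nat and x :: real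
    show ?case
    proof (rule approximable_limit[OF _ _ one])
      show "approximable (F n)" for n unfolding F_def
        by (rule approximable_continuous_bounded[where B = 1]) (auto intro!: continuous_intros)
      show "\<bar>F n x\<bar> \<le> \<bar>1\<bar>" for n x by (auto simp: F_def)
      show "(\<lambda>n. F n x) \<longlonglongrightarrow> indicator A x" for x
      proof (cases "x \<le> a")
        case True
        then have "F n x = 1" for n
          by (simp add: F_def mult_nonneg_nonpos max_def min_def)
        then show ?thesis using True by (simp add: A)
      next
        case False
        then obtain m :: nat where m: "real m * (x - a) > 1" using ex_less_of_nat_mult[of "x - a" 1] by auto
        have "eventually (\<lambda>n. F n x = indicator A x) sequentially"
          using eventually_ge_at_top[of m]
        proof eventually_elim
          fix n assume "n \<ge> m"
          then have "real n * (x - a) \<ge> real m * (x - a)" using False by (intro mult_right_mono) auto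
          then have "real n * (x - a) > 1" using m by linarith
          then show "F n x = indicator A x" using False by (simp add: F_def A)
        qed
        then show ?thesis by (rule tendsto_eventually)
      qed
    qed
  next
    case empty
    show ?case using approximable_const[of 0] by (simp add: indicator_def[abs_def])
  next
    case (compl A)
    have "indicator (UNIV - A) = (\<lambda>x. 1 + (- 1) * (indicator A x :: real))"
      by (auto simp: indicator_def fun_eq_iff)
    then show ?case
      using approximable_add[OF approximable_const[of 1] approximable_scale[OF compl(2), of "- 1"]] by simp
  next
    case (union A)
    show ?case
    proof (rule approximable_limit[OF _ _ one])
      have ind: "(\<Sum>i<n. indicator (A i) x) = (indicator (\<Union>i<n. A i) x :: real)" for n x
        using union(1) by (subst indicator_UN_disjoint) (auto simp: disjoint_family_on_def)
      show "approximable (\<lambda>x. \<Sum>i<n. indicator (A i) x)" for n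
        by (intro approximable_sum union) auto
      show "\<bar>\<Sum>i<n. indicator (A i) x\<bar> \<le> \<bar>1::real\<bar>" for n x by (simp add: ind)
      show "(\<lambda>n. \<Sum>i<n. indicator (A i) x :: real) \<longlonglongrightarrow> indicator (\<Union>i. A i) x" for x
        unfolding ind by (rule LIMSEQ_indicator_UN)
    qed
  qed
qed

lemma approximable_square_integrable:
  assumes f: "square_integrable f"
  shows "approximable f"
proof -
  have "f \<in> borel_measurable borel" using f by (rule square_integrable_measurable)
  \<comment> \<open>The base point 0 yields simple functions bounded by
    \<open>2 * \<bar>f x\<bar>\<close>, the majorant for \<open>approximable_limit\<close>.\<close>
  from borel_measurable_implies_sequence_metric[OF this, of 0] obtain F where
    F: "\<And>i. simple_function borel (F i)" "\<And>x. (\<lambda>i. F i x) \<longlonglongrightarrow> f x" "\<And>i x. \<bar>F i x\<bar> \<le> 2 * \<bar>f x\<bar>"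
    by auto
  show ?thesis
  proof (rule approximable_limit[OF _ F(2) square_integrable_scale[OF f, of 2]])
    show "\<bar>F n x\<bar> \<le> \<bar>2 * f x\<bar>" for n x using F(3)[of n x] by (simp add: abs_mult)
    show "approximable (F n)" for n
    proof -
      have fin: "finite (range (F n))" and s: "F n -` {y} \<in> sets borel" for y
        using F(1)[of n] simple_functionD[of borel "F n"] by auto
      have e: "F n = (\<lambda>x. \<Sum>y\<in>range (F n). y * indicator (F n -` {y}) x)"
      proof
        fix x
        have "F n x = (\<Sum>y\<in>F n ` space borel. indicator (F n -` {y} \<inter> space borel) x *\<^sub>R y)"
          by (rule simple_function_indicator_representation_banach[OF F(1)[of n]]) simp
        then show "F n x = (\<Sum>y\<in>range (F n). y * indicator (F n -` {y}) x)"
          by (simp only: space_borel Int_UNIV_right real_scaleR_def mult.commute)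
      qed
      have "approximable (\<lambda>x. \<Sum>y\<in>range (F n). y * indicator (F n -` {y}) x)"
        by (intro approximable_sum fin approximable_scale approximable_indicator s)
      then show ?thesis by (subst e)
    qed
  qed
qed

lemma trig_approximation:
  assumes f: "square_integrable f"
  obtains xs where "(\<lambda>n. sq_norm (\<lambda>x. trig (xs n) x - f x)) \<longlonglongrightarrow> 0"
proof -
  have "\<exists>xs. sq_norm (\<lambda>x. trig xs x - f x) < inverse (real (Suc n))" for n
    using approximable_square_integrable[OF f] unfolding approximable_def by simp
  then obtain xs where xs: "\<And>n. sq_norm (\<lambda>x. trig (xs n) x - f x) < inverse (real (Suc n))" by metis
  have "(\<lambda>n. sq_norm (\<lambda>x. trig (xs n) x - f x)) \<longlonglongrightarrow> 0"
    by (rule tendsto_sandwich[OF _ _ tendsto_const LIMSEQ_inverse_real_of_nat])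
      (auto intro!: always_eventually less_imp_le[OF xs] sq_norm_nonneg simp del: of_nat_Suc)
  then show ?thesis by (rule that)
qed

lemma pair_exp_mono:
  assumes f: "square_integrable f" and r: "0 \<le> \<rho>1" "\<rho>1 \<le> \<rho>2" "\<rho>2 \<le> 1"
  shows "0 \<le> pair_exp \<rho>1 f f" "pair_exp \<rho>1 f f \<le> pair_exp \<rho>2 f f"
proof -
  obtain xs where xs: "(\<lambda>n. sq_norm (\<lambda>x. trig (xs n) x - f x)) \<longlonglongrightarrow> 0"
    using trig_approximation[OF f] by blast
  have lim: "(\<lambda>n. pair_exp \<rho> (trig (xs n)) (trig (xs n))) \<longlonglongrightarrow> pair_exp \<rho> f f" if "\<bar>\<rho>\<bar> \<le> 1" for \<rho>
    by (intro pair_exp_tendsto f square_integrable_trig that xs)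
  show "0 \<le> pair_exp \<rho>1 f f"
    by (rule LIMSEQ_le[OF tendsto_const lim]) (use pair_exp_trig_mono(1)[OF r] r in auto)
  show "pair_exp \<rho>1 f f \<le> pair_exp \<rho>2 f f"
    by (rule LIMSEQ_le[OF lim lim]) (use pair_exp_trig_mono(2)[OF r] r in auto)
qed

lemma pair_exp_neg:
  assumes f: "square_integrable f" and r: "0 \<le> r" "r \<le> 1"
  shows "- r * sq_norm f \<le> pair_exp (- r) f f"
proof -
  obtain xs where xs: "(\<lambda>n. sq_norm (\<lambda>x. trig (xs n) x - f x)) \<longlonglongrightarrow> 0"
    using trig_approximation[OF f] by blast
  have lim: "(\<lambda>n. pair_exp \<rho> (trig (xs n)) (trig (xs n))) \<longlonglongrightarrow> pair_exp \<rho> f f" if "\<bar>\<rho>\<bar> \<le> 1" for \<rho>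
    by (intro pair_exp_tendsto f square_integrable_trig that xs)
  \<comment> \<open>Convergence of the norms is the case of correlation 1, by
    \<open>pair_exp_1\<close>.\<close>
  have "(\<lambda>n. - r * sq_norm (trig (xs n))) \<longlonglongrightarrow> - r * sq_norm f"
    using lim[of 1] by (intro tendsto_intros) (simp add: pair_exp_1 f square_integrable_trig)
  then show ?thesis
    by (rule LIMSEQ_le[OF _ lim]) (use pair_exp_trig_neg[OF r] r in auto)
qed

section \<open>The network kernel\<close>

locale network =
  fixes \<sigma> :: "real \<Rightarrow> real" and \<Gamma>b \<Gamma>W0 :: real
  assumes admissible: "admissible_activation \<sigma>"
    and pos: "\<Gamma>b > 0" "\<Gamma>W0 > 0" and sum_1: "\<Gamma>b + \<Gamma>W0 = 1"
begin

abbreviation "\<kappa> \<equiv> network_kernel \<sigma> \<Gamma>b \<Gamma>W0"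

lemma \<sigma>_square_integrable: "square_integrable \<sigma>"
  using admissible by (auto simp: admissible_activation_def square_integrable_def)

lemma Gamma_sigma_eq: "Gamma_sigma \<sigma> = sq_norm \<sigma>"
  by (simp add: Gamma_sigma_def sq_norm_def)

lemma sq_norm_pos: "sq_norm \<sigma> > 0"
  using admissible by (auto simp: admissible_activation_def Gamma_sigma_eq)

lemma kernel_eq: "\<kappa> u = \<Gamma>b + (1 - \<Gamma>b) / sq_norm \<sigma> * pair_exp (\<Gamma>b + \<Gamma>W0 * u) \<sigma> \<sigma>"
  by (simp add: network_kernel_def gaussian_pair_expectation_eq Gamma_sigma_eq)

lemma factor_nonneg: "(1 - \<Gamma>b) / sq_norm \<sigma> \<ge> 0"
  using pos sum_1 sq_norm_pos by simp

lemma kernel_1: "\<kappa> 1 = 1"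
  using sum_1 sq_norm_pos by (simp add: kernel_eq pair_exp_1 \<sigma>_square_integrable)

lemma kernel_mono: "0 \<le> s \<Longrightarrow> s \<le> t \<Longrightarrow> t \<le> 1 \<Longrightarrow> \<kappa> s \<le> \<kappa> t"
proof -
  assume st: "0 \<le> s" "s \<le> t" "t \<le> 1"
  have "\<Gamma>W0 * t \<le> \<Gamma>W0 * 1" using st pos by (intro mult_left_mono) auto
  then have "\<Gamma>b + \<Gamma>W0 * t \<le> 1" using sum_1 by simp
  then have "pair_exp (\<Gamma>b + \<Gamma>W0 * s) \<sigma> \<sigma> \<le> pair_exp (\<Gamma>b + \<Gamma>W0 * t) \<sigma> \<sigma>"
    using st pos by (intro pair_exp_mono(2) \<sigma>_square_integrable) (auto intro!: add_nonneg_nonneg mult_left_mono)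
  then show ?thesis unfolding kernel_eq using factor_nonneg by (intro add_left_mono mult_left_mono)
qed

lemma kernel_ge: 
  assumes "\<Gamma>b + \<Gamma>W0 * t \<ge> 0" "t \<le> 1" shows "\<kappa> t \<ge> \<Gamma>b"
proof -
  have "\<Gamma>W0 * t \<le> \<Gamma>W0 * 1" using assms pos by (intro mult_left_mono) auto
  then have "\<Gamma>b + \<Gamma>W0 * t \<le> 1" using sum_1 by simp
  then have "pair_exp (\<Gamma>b + \<Gamma>W0 * t) \<sigma> \<sigma> \<ge> 0"
    using assms pair_exp_mono(1)[OF \<sigma>_square_integrable assms(1) order_refl] by simp
  from mult_nonneg_nonneg[OF factor_nonneg this] show ?thesis unfolding kernel_eq by linarith
qed

lemma kernel_ge_nonneg: "0 \<le> t \<Longrightarrow> t \<le> 1 \<Longrightarrow> \<kappa> t \<ge> \<Gamma>b"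
  using pos by (intro kernel_ge) auto

text \<open>For negative correlation \<open>- r\<close>, the expectation is at least
  \<open>- r * sq_norm \<sigma>\<close>, so \<open>\<kappa> t \<ge> \<Gamma>b - r\<close>, and
  \<open>r \<le> - t - \<Gamma>b\<close>. The gain \<open>\<Gamma>b\<close> rules out negative fixed
  points and the identity kernel.\<close>

lemma kernel_ge_neg:
  assumes t: "-1 \<le> t" "t \<le> 0" shows "\<kappa> t \<ge> t + \<Gamma>b"
proof (cases "\<Gamma>b + \<Gamma>W0 * t \<ge> 0")
  case True
  then show ?thesis using kernel_ge[OF True] t by simp
next
  case False
  define r where "r = - (\<Gamma>b + \<Gamma>W0 * t)"
  have "\<Gamma>W0 * (- t) \<le> \<Gamma>W0 * 1" using t pos by (intro mult_left_mono) auto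
  then have r: "0 \<le> r" "r \<le> 1" using False pos sum_1 by (auto simp: r_def)
  have "(1 - \<Gamma>b) / sq_norm \<sigma> * (- r * sq_norm \<sigma>) \<le> (1 - \<Gamma>b) / sq_norm \<sigma> * pair_exp (- r) \<sigma> \<sigma>"
    by (intro mult_left_mono pair_exp_neg \<sigma>_square_integrable r factor_nonneg)
  moreover have "\<kappa> t = \<Gamma>b + (1 - \<Gamma>b) / sq_norm \<sigma> * pair_exp (- r) \<sigma> \<sigma>"
  proof -
    have "\<Gamma>b + \<Gamma>W0 * t = - r" by (simp add: r_def)
    then show ?thesis by (simp only: kernel_eq)
  qed
  moreover have "(1 - \<Gamma>b) / sq_norm \<sigma> * (- r * sq_norm \<sigma>) = - ((1 - \<Gamma>b) * r)"
    using sq_norm_pos by simp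
  ultimately have "\<kappa> t \<ge> \<Gamma>b - (1 - \<Gamma>b) * r" by linarith
  moreover have "(1 - \<Gamma>b) * r \<le> 1 * r"
    using r pos by (intro mult_right_mono) auto
  moreover have "\<Gamma>W0 * (- t) \<le> 1 * (- t)"
    using t pos sum_1 by (intro mult_right_mono) auto
  ultimately show ?thesis using pos by (simp add: r_def)
qed

end

section \<open>Moments of integer-valued random variables\<close>

lemma distr_nat_eq_density:
  assumes "prob_space N" and X: "Y \<in> measurable N (count_space (UNIV :: nat set))"
  shows "distr N (count_space UNIV) Y
    = density (count_space UNIV) (\<lambda>l. ennreal (measure N {\<omega> \<in> space N. Y \<omega> = l}))"
proof (rule measure_eqI_countable[where A = UNIV])
  interpret prob_space N by fact
  fix l :: nat
  have "emeasure (distr N (count_space UNIV) Y) {l} = emeasure N (Y -` {l} \<inter> space N)"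
    using X by (simp add: emeasure_distr)
  also have "Y -` {l} \<inter> space N = {\<omega> \<in> space N. Y \<omega> = l}" by auto
  finally show "emeasure (distr N (count_space UNIV) Y) {l} =
    emeasure (density (count_space UNIV) (\<lambda>l. ennreal (measure N {\<omega> \<in> space N. Y \<omega> = l}))) {l}"
    by (simp add: emeasure_density emeasure_eq_measure)
qed auto

lemma moment_series:
  assumes N: "prob_space N" and X: "Y \<in> measurable N (count_space (UNIV :: nat set))"
  defines "p \<equiv> \<lambda>l. measure N {\<omega> \<in> space N. Y \<omega> = l}"
  shows "finite_moment N Y n \<longleftrightarrow> summable (\<lambda>l. p l * real l ^ n)"
    and "finite_moment N Y n \<Longrightarrow> moment N Y n = (\<Sum>l. p l * real l ^ n)"
proof -
  have D: "distr N (count_space UNIV) Y = density (count_space UNIV) (\<lambda>l. ennreal (p l))"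
    unfolding p_def by (rule distr_nat_eq_density[OF N X])
  have p: "p l \<ge> 0" for l by (simp add: p_def)
  have "finite_moment N Y n \<longleftrightarrow> integrable (distr N (count_space UNIV) Y) (\<lambda>l. real l ^ n)"
    unfolding finite_moment_def using X by (subst integrable_distr_eq) auto
  also have "\<dots> \<longleftrightarrow> integrable (count_space UNIV) (\<lambda>l. p l * real l ^ n)"
    unfolding D using p by (subst integrable_density) auto
  finally have *: "finite_moment N Y n \<longleftrightarrow> integrable (count_space UNIV) (\<lambda>l. p l * real l ^ n)" .
  then show "finite_moment N Y n \<longleftrightarrow> summable (\<lambda>l. p l * real l ^ n)"
    using p by (simp add: integrable_count_space_nat_iff abs_mult)
  assume "finite_moment N Y n"
  with * have int: "integrable (count_space UNIV) (\<lambda>l. p l * real l ^ n)" by simp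
  have "moment N Y n = (\<integral>l. real l ^ n \<partial>distr N (count_space UNIV) Y)"
    unfolding moment_def using X by (subst integral_distr) auto
  also have "\<dots> = (\<integral>l. p l * real l ^ n \<partial>count_space UNIV)"
    unfolding D using p by (subst integral_density) auto
  finally show "moment N Y n = (\<Sum>l. p l * real l ^ n)"
    using integral_count_space_nat[OF int] by simp
qed

lemma leading_orderI:
  assumes c: "c > 0" and lim: "(\<lambda>L. f L / g L) \<longlonglongrightarrow> c" and g: "\<And>L. L \<ge> 1 \<Longrightarrow> g L \<noteq> 0"
  shows "leading_order f g"
  unfolding leading_order_def
proof (intro exI conjI allI impI)
  show "(\<lambda>L. f L / g L - c) \<longlonglongrightarrow> 0" using tendsto_diff[OF lim tendsto_const[of c]] by simp
  show "f L = g L * (c + (f L / g L - c))" if "L \<ge> 1" for L using g[OF that] by simp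
qed fact

text \<open>Applied to \<open>a = E X^(k+1)\<close>, \<open>m = E X^k\<close> and \<open>b = E X^(k+3)\<close>, this bounds odd moments from
  below; hypothesis \<open>le\<close> comes from \<open>x^(k+1) \<le> s x^k + x^(k+3) / s^2\<close>.\<close>

lemma interpolated_lower_bound:
  fixes a b m h :: "nat \<Rightarrow> real"
  assumes h: "\<And>L. L \<ge> 1 \<Longrightarrow> h L > 0"
    and a: "(\<lambda>L. a L / h L) \<longlonglongrightarrow> c" "c > 0"
    and b: "(\<lambda>L. b L / (h L)\<^sup>2) \<longlonglongrightarrow> c'" "c' > 0"
    and le: "\<And>L s. L \<ge> 1 \<Longrightarrow> s > 0 \<Longrightarrow> a L \<le> s * m L + b L / s\<^sup>2"
  shows "\<exists>\<delta>>0. \<forall>\<^sub>F L in sequentially. \<delta> * sqrt (h L) \<le> m L"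
proof -
  \<comment> \<open>The choice \<open>s = A * sqrt (h L)\<close> makes \<open>b L / s^2\<close> at
    most \<open>c / 4 * h L\<close>, half of the lower bound \<open>c / 2 * h L\<close> for
    \<open>a L\<close>.\<close>
  define A where "A = sqrt (4 * (c' + 1) / c)"
  have A: "A > 0" "A\<^sup>2 = 4 * (c' + 1) / c" using a(2) b(2) by (simp_all add: A_def)
  have "\<forall>\<^sub>F L in sequentially. c / 2 < a L / h L"
    by (rule order_tendstoD[OF a(1)]) (use a in auto)
  moreover have "\<forall>\<^sub>F L in sequentially. b L / (h L)\<^sup>2 < c' + 1"
    by (rule order_tendstoD[OF b(1)]) auto
  ultimately have "\<forall>\<^sub>F L in sequentially. c / (4 * A) * sqrt (h L) \<le> m L"
    using eventually_ge_at_top[of 1]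
  proof eventually_elim
    fix L assume L: "1 \<le> L" and 1: "c / 2 < a L / h L" and 2: "b L / (h L)\<^sup>2 < c' + 1"
    define q where "q = sqrt (h L)"
    have q: "q > 0" "h L = q\<^sup>2" using h[OF L] by (simp_all add: q_def)
    have "b L / (A * q)\<^sup>2 = b L / (h L)\<^sup>2 * (h L / A\<^sup>2)"
      using q A(1) by (simp add: field_simps power2_eq_square)
    also have "\<dots> \<le> (c' + 1) * (h L / A\<^sup>2)"
      using 2 q by (intro mult_right_mono) auto
    also have "\<dots> = c / 4 * h L"
    proof -
      define e where "e = c' + 1"
      have "e > 0" using b(2) by (simp add: e_def)
      then show ?thesis unfolding A(2) e_def[symmetric] using a(2) by (simp add: field_simps)
    qed
    finally have F: "b L / (A * q)\<^sup>2 \<le> c / 4 * h L" .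
    have "A * q > 0" using A q by simp
    from le[OF L this] F have "a L \<le> A * q * m L + c / 4 * h L" by linarith
    moreover have "c / 2 * h L \<le> a L" using 1 h[OF L] by (simp add: field_simps)
    ultimately have "c / 4 * q\<^sup>2 \<le> A * q * m L" unfolding q(2) by linarith
    then have "q * (c / 4 * q) \<le> q * (A * m L)" by (simp add: power2_eq_square mult_ac)
    then have "c / 4 * q \<le> A * m L" using q(1) by (simp only: mult_le_cancel_left_pos)
    then show "c / (4 * A) * sqrt (h L) \<le> m L" using A(1) by (simp add: q_def field_simps)
  qed
  moreover have "c / (4 * A) > 0" using a A by simp
  ultimately show ?thesis by blast
qed

section \<open>Comparing powers with derivatives at \<open>1\<close>\<close>

lemma (in gegenbauer) Gd_1_one: "Gd 1 l 1 = real l * (real l + real d - 1) / real d"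
  by (simp add: Gd_one ev_def)

text \<open>Origin of the constants 1 and \<open>d\<close> in the bounds for the second
  moment.\<close>

lemma (in gegenbauer) Gd_1_one_bounds: "(real l)\<^sup>2 \<le> real d * Gd 1 l 1" "Gd 1 l 1 \<le> (real l)\<^sup>2"
proof -
  show "(real l)\<^sup>2 \<le> real d * Gd 1 l 1"
    unfolding Gd_1_one using d2 by (simp add: power2_eq_square mult_left_mono)
  have "real l * (real l + real d - 1) \<le> real l * (real l * real d)"
  proof (cases "l = 0")
    case False
    then have "0 \<le> (real l - 1) * (real d - 1)" using d2 by (intro mult_nonneg_nonneg) auto
    then show ?thesis by (intro mult_left_mono) (auto simp: algebra_simps)
  qed simp
  then show "Gd 1 l 1 \<le> (real l)\<^sup>2"
    unfolding Gd_1_one using d2 by (simp add: power2_eq_square field_simps)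
qed

context gegenbauer_series
begin

text \<open>Converse of \<open>jet_K\<close>. It is needed for iterates, whose derivatives are first
  obtained from the chain rule rather than from their series.\<close>

lemma fin_if_jet: "fin k \<Longrightarrow> jet r (K k) F \<Longrightarrow> fin (k + r)"
proof (induction r arbitrary: k F)
  case (Suc r)
  obtain f' where *: "deriv_I (K k) f'" "jet r f' (fps_deriv F)"
    using Suc.prems(2) by (rule jet_SucE)
  have "(K k has_real_derivative f' 1) (at 1 within {-1..1})"
    using *(1) by (simp add: deriv_I_def)
  then have "bounded_quotient_at_1 (K k)" by (rule deriv_bounded_quotient) simp
  then have f: "fin (Suc k)" by (rule fin_Suc_if_bounded_quotient[OF Suc.prems(1)])
  have "jet r (K (Suc k)) (fps_deriv F)"
    by (rule jet_cong_I[OF *(2)]) (use deriv_I_unique[OF *(1) K_deriv[OF f]] in auto)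
  from Suc.IH[OF f this] show ?case by simp
qed simp

lemma summable_power: "fin k \<Longrightarrow> n \<le> 2 * k \<Longrightarrow> summable (\<lambda>l. p l * real l ^ n)"
  unfolding fin_iff by (rule summable_power_mono) auto

text \<open>Order 0 must be excluded because \<open>0 ^ 0 = 1\<close> exceeds all higher powers of
  0.\<close>

lemma suminf_power_mono:
  assumes "1 \<le> m" "m \<le> n" "summable (\<lambda>l. p l * real l ^ n)"
  shows "(\<Sum>l. p l * real l ^ m) \<le> (\<Sum>l. p l * real l ^ n)"
proof (rule suminf_le)
  show "p l * real l ^ m \<le> p l * real l ^ n" for l
  proof (rule mult_left_mono[OF _ p_nonneg])
    show "real l ^ m \<le> real l ^ n"
      using assms by (cases "l = 0") (auto simp: power_0_left intro!: power_increasing)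
  qed
  show "summable (\<lambda>l. p l * real l ^ m)" using assms by (intro summable_power_mono[OF assms(3)]) auto
qed fact

lemma suminf_power_interpolate:
  assumes s: "s > 0" and sum: "summable (\<lambda>l. p l * real l ^ (k + 3))"
  shows "(\<Sum>l. p l * real l ^ (k + 1)) \<le> s * (\<Sum>l. p l * real l ^ k) + (\<Sum>l. p l * real l ^ (k + 3)) / s\<^sup>2"
proof -
  have s1: "summable (\<lambda>l. p l * real l ^ (k + 1))" and s2: "summable (\<lambda>l. p l * real l ^ k)"
    by (rule summable_power_mono[OF sum]; simp)+
  have le: "x ^ (k + 1) \<le> s * x ^ k + x ^ (k + 3) / s\<^sup>2" if "x \<ge> 0" for x :: real
  proof (cases "x \<le> s")
    case True
    then have "x * x ^ k \<le> s * x ^ k" using that by (intro mult_right_mono) auto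
    then show ?thesis using that by (simp add: add_increasing2)
  next
    case False
    then have "x ^ (k + 1) * s\<^sup>2 \<le> x ^ (k + 1) * x\<^sup>2" using s by (intro mult_left_mono power_mono) auto
    also have "\<dots> = x ^ (k + 3)" by (simp add: power_add power2_eq_square power3_eq_cube)
    finally have "x ^ (k + 1) \<le> x ^ (k + 3) / s\<^sup>2" using s by (simp add: pos_le_divide_eq)
    then show ?thesis using that s by (simp add: add_increasing)
  qed
  have "(\<Sum>l. p l * real l ^ (k + 1)) \<le> (\<Sum>l. s * (p l * real l ^ k) + (p l * real l ^ (k + 3)) / s\<^sup>2)"
  proof (rule suminf_le[OF _ s1])
    show "p l * real l ^ (k + 1) \<le> s * (p l * real l ^ k) + (p l * real l ^ (k + 3)) / s\<^sup>2" for l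
      using mult_left_mono[OF le[of "real l"] p_nonneg[of l]] by (simp add: algebra_simps)
    show "summable (\<lambda>l. s * (p l * real l ^ k) + (p l * real l ^ (k + 3)) / s\<^sup>2)"
      by (intro summable_add summable_mult summable_divide s2 sum)
  qed
  also have "\<dots> = s * (\<Sum>l. p l * real l ^ k) + (\<Sum>l. p l * real l ^ (k + 3)) / s\<^sup>2"
    by (subst suminf_add[symmetric])
      (auto intro!: summable_mult summable_divide s2 sum simp: suminf_mult[OF s2] suminf_divide[OF sum])
  finally show ?thesis .
qed

end

text \<open>For large \<open>l\<close> the relative error is below \<open>\<epsilon>\<close>, and
  the finitely many remaining \<open>l\<close> are absorbed in \<open>C\<close>. Since
  \<open>C\<close> does not involve the distribution, the estimate can be averaged over all depths
  at once.\<close>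

lemma (in gegenbauer) power_approx:
  assumes "\<epsilon> > 0" and dn: "(\<lambda>l. Gd n l 1 / real l ^ (2 * n)) \<longlonglongrightarrow> dn" "dn > 0"
  shows "\<exists>C\<ge>0. \<forall>l. \<bar>dn * real l ^ (2 * n) - Gd n l 1\<bar> \<le> \<epsilon> * Gd n l 1 + C"
proof -
  have "(\<lambda>l. dn / (Gd n l 1 / real l ^ (2 * n))) \<longlonglongrightarrow> dn / dn"
    by (intro tendsto_intros dn(1)) (use dn in auto)
  then have "(\<lambda>l. dn / (Gd n l 1 / real l ^ (2 * n))) \<longlonglongrightarrow> 1" using dn by simp
  from tendstoD[OF this assms(1)] obtain l0 where
    l0: "\<And>l. l \<ge> l0 \<Longrightarrow> \<bar>dn / (Gd n l 1 / real l ^ (2 * n)) - 1\<bar> < \<epsilon>"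
    by (auto simp: eventually_sequentially dist_real_def)
  \<comment> \<open>The summand \<open>n\<close> ensures \<open>l \<ge> n\<close> beyond the cut, so
    that \<open>Gd n l 1\<close> is positive.\<close>
  define C where "C = (\<Sum>l<l0 + n. \<bar>dn * real l ^ (2 * n) - Gd n l 1\<bar>)"
  show ?thesis
  proof (intro exI[of _ C] conjI allI)
    show C: "C \<ge> 0" unfolding C_def by (intro sum_nonneg) auto
    fix l
    show "\<bar>dn * real l ^ (2 * n) - Gd n l 1\<bar> \<le> \<epsilon> * Gd n l 1 + C"
    proof (cases "l < l0 + n")
      case True
      then have "\<bar>dn * real l ^ (2 * n) - Gd n l 1\<bar> \<le> C"
        unfolding C_def by (intro member_le_sum) auto
      then show ?thesis using Gd_one_nonneg[of n l] assms(1) by (simp add: add_increasing)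
    next
      case False
      have pos: "Gd n l 1 > 0" using False by (intro Gd_one_pos) auto
      have "dn / (Gd n l 1 / real l ^ (2 * n)) - 1 = (dn * real l ^ (2 * n) - Gd n l 1) / Gd n l 1"
        using pos by (simp add: field_simps)
      then have "\<bar>dn * real l ^ (2 * n) - Gd n l 1\<bar> / Gd n l 1 < \<epsilon>"
        using l0[of l] False pos by (simp add: abs_divide)
      then show ?thesis using pos C by (simp add: field_simps)
    qed
  qed
qed

section \<open>Deep networks\<close>

text \<open>The Gaussian fields have been eliminated: all that remains of them is the Gegenbauer
  expansion of each iterate with the probabilities of \<open>X L\<close> as coefficients.\<close>

locale deep_network = network \<sigma> \<Gamma>b \<Gamma>W0 + gegenbauer d G
  for \<sigma> :: "real \<Rightarrow> real" and \<Gamma>b \<Gamma>W0 :: real and d :: nat and G :: "nat \<Rightarrow> real poly" +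
  fixes \<kappa>' :: "real \<Rightarrow> real" and N :: "'b measure" and X :: "nat \<Rightarrow> 'b \<Rightarrow> nat"
  assumes prob: "prob_space N"
    and X_measurable: "L \<ge> 1 \<Longrightarrow> X L \<in> measurable N (count_space UNIV)"
    and expansion: "L \<ge> 1 \<Longrightarrow> t \<in> {-1..1} \<Longrightarrow>
      (\<lambda>l. measure N {\<omega> \<in> space N. X L \<omega> = l} * poly (G l) t) sums (\<kappa> ^^ L) t"
    and deriv: "deriv_I \<kappa> \<kappa>'"
begin

definition prb :: "nat \<Rightarrow> nat \<Rightarrow> real" where
  "prb L l = measure N {\<omega> \<in> space N. X L \<omega> = l}"

text \<open>With the depth as parameter, \<open>S.K L k\<close> is the series of the
  \<open>k\<close>-th derivative of \<open>\<kappa> ^^ L\<close>, and \<open>S.fin L k\<close> its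
  convergence at \<open>1\<close>.\<close>

sublocale S: gegenbauer_series d G "prb L" for L
  by unfold_locales (simp add: prb_def)

lemma iterate_1: "(\<kappa> ^^ L) 1 = 1"
  by (induction L) (auto simp: kernel_1)

lemma iterate_eq: "L \<ge> 1 \<Longrightarrow> t \<in> {-1..1} \<Longrightarrow> (\<kappa> ^^ L) t = S.K L 0 t"
  using expansion[of L t] by (simp add: S.K_def prb_def sums_iff)

lemma prb_sums: "L \<ge> 1 \<Longrightarrow> prb L sums 1"
  using expansion[of L 1] by (simp add: prb_def[abs_def] G_at_1 iterate_1)

lemma fin_0: "L \<ge> 1 \<Longrightarrow> S.fin L 0"
  using prb_sums[of L] by (simp add: S.fin_def G_at_1 sums_iff)

lemma kernel_range: "t \<in> {-1..1} \<Longrightarrow> \<kappa> t \<in> {-1..1}"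
  using S.K_dominated[OF fin_0[OF order_refl]] iterate_eq[of 1 t] iterate_eq[of 1 1] kernel_1
  by (auto simp: dominated_at_1_def abs_le_iff)

lemma iterate_range: "t \<in> {-1..1} \<Longrightarrow> (\<kappa> ^^ L) t \<in> {-1..1}"
proof (induction L)
  case (Suc L)
  then show ?case using kernel_range by (simp del: atLeastAtMost_iff)
qed simp

lemma iterate_image: "(\<kappa> ^^ L) ` {-1..1} \<subseteq> {-1..1}"
  using iterate_range by auto

lemma deriv_K_1: "deriv_I (S.K 1 0) \<kappa>'"
  by (rule deriv_I_cong[OF deriv]) (use iterate_eq[of 1] in simp)

lemma fin_1_1: "S.fin 1 1"
proof -
  have "(S.K 1 0 has_real_derivative \<kappa>' 1) (at 1 within {-1..1})"
    using deriv_K_1 by (simp add: deriv_I_def)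
  then have "bounded_quotient_at_1 (S.K 1 0)" by (rule deriv_bounded_quotient) simp
  from S.fin_Suc_if_bounded_quotient[OF fin_0[OF order_refl] this] show ?thesis by simp
qed

lemma kernel_deriv_eq: "t \<in> {-1..1} \<Longrightarrow> \<kappa>' t = S.K 1 1 t"
  using deriv_I_unique[OF deriv_K_1 S.K_deriv] fin_1_1 by simp

lemma lambda_nonneg: "\<kappa>' 1 \<ge> 0"
  using kernel_deriv_eq[of 1] S.K_one_nonneg[OF fin_1_1] by simp

lemma times_differentiable_iff: "times_differentiable_near_1 n \<kappa> \<longleftrightarrow> S.fin 1 n"
proof
  have e: "\<kappa> t = S.K 1 0 t" if "t \<in> {-1..1}" for t using iterate_eq[of 1 t] that by simp
  show "S.fin 1 n" if "times_differentiable_near_1 n \<kappa>"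
    by (rule S.fin_if_times_differentiable[OF e fin_0[OF order_refl] that])
  show "times_differentiable_near_1 n \<kappa>" if "S.fin 1 n"
    by (rule S.times_differentiable_if_fin[OF e that])
qed

lemma infinitely_differentiable_imp: "infinitely_differentiable_near_1 \<kappa> \<Longrightarrow> S.fin 1 n"
  unfolding times_differentiable_iff[symmetric] infinitely_differentiable_near_1_def times_differentiable_near_1_def
  by blast

lemma only_times_imp:
  assumes "only_times_differentiable_near_1 r \<kappa>"
  shows "S.fin 1 r" "\<not> S.fin 1 (Suc r)" "r \<ge> 1"
proof -
  show "S.fin 1 r" and n: "\<not> S.fin 1 (Suc r)"
    using assms by (auto simp: only_times_differentiable_near_1_def times_differentiable_iff)
  show "r \<ge> 1" using n fin_1_1 by (cases r) auto
qed

definition J :: "nat \<Rightarrow> real fps" where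
  "J L = Abs_fps (\<lambda>n. S.K L n 1 / fact n)"

text \<open>Removing the constant term 1, the value at the fixed point, makes the series composable.
  No expansion is available at \<open>L = 0\<close>, so the value there is a dummy that keeps
  \<open>u L $ 0 = 0\<close> for all \<open>L\<close>.\<close>

definition u :: "nat \<Rightarrow> real fps" where
  "u L = (if L = 0 then 0 else J L - 1)"

lemma J_eq: "L \<ge> 1 \<Longrightarrow> J L = 1 + u L"
  by (simp add: u_def)

lemma u_0: "u L $ 0 = 0"
  using iterate_eq[of L 1] iterate_1[of L] by (simp add: u_def J_def)

lemma u_nth: "L \<ge> 1 \<Longrightarrow> n \<ge> 1 \<Longrightarrow> u L $ n = S.K L n 1 / fact n"
  by (simp add: u_def J_def)

lemma jet_J: "L \<ge> 1 \<Longrightarrow> S.fin L r \<Longrightarrow> jet r (\<kappa> ^^ L) (J L)"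
proof -
  assume L: "L \<ge> 1" and "S.fin L r"
  then have "jet r (S.K L 0) (J L)" using S.jet_K[of L 0 r] by (simp add: J_def)
  then show ?thesis by (rule jet_cong_I) (rule iterate_eq[OF L, symmetric])
qed

lemma jet_step:
  assumes "S.fin 1 r" "L \<ge> 1" "S.fin L r"
  shows "jet r (\<kappa> ^^ Suc L) (J 1 oo u L)"
proof -
  have "jet r (\<lambda>t. \<kappa> ((\<kappa> ^^ L) t)) (J 1 oo u L)"
    using jet_J[of 1 r] jet_J[of L r] assms
    by (intro jet_compose iterate_image u_0) (auto simp: J_eq[symmetric])
  then show ?thesis by (simp add: o_def)
qed

text \<open>The chain rule gives a jet of the next iterate, and \<open>fin_if_jet\<close> turns it
  back into convergence of its series.\<close>

lemma fin_iterate: "S.fin 1 r \<Longrightarrow> L \<ge> 1 \<Longrightarrow> S.fin L r"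
proof -
  assume f: "S.fin 1 r" and "L \<ge> 1"
  from this(2) show "S.fin L r"
  proof (induction L rule: dec_induct)
    case (step L)
    have "jet r (S.K (Suc L) 0) (J 1 oo u L)"
      by (rule jet_cong_I[OF jet_step[OF f step.hyps(1) step.IH]]) (rule iterate_eq, simp_all)
    from S.fin_if_jet[OF fin_0 this] show ?case by simp
  qed (rule f)
qed

lemma recursion: "S.fin 1 r \<Longrightarrow> jet_recursion u (u 1) r"
proof (rule jet_recursion.intro)
  fix L n :: nat assume f: "S.fin 1 r" and L: "L \<ge> 1" and n: "n \<le> r"
  have "J (Suc L) $ n = (J 1 oo u L) $ n"
    using jet_unique[OF jet_J jet_step[OF f L fin_iterate[OF f L]] refl n] fin_iterate[OF f] by simp
  also have "J 1 oo u L = 1 + (u 1 oo u L)"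
    by (simp add: J_eq fps_compose_add_distrib)
  finally have "u (Suc L) $ n = (u 1 oo u L) $ n" by (simp add: J_eq)
  then show "u (Suc L) $ n = (\<Sum>k=0..n. u 1 $ k * (u L ^ k) $ n)" by (simp add: fps_compose_nth)
next
  fix n :: nat assume f: "S.fin 1 r" and n: "n \<le> r"
  show "u 1 $ n \<ge> 0"
    using u_0[of 1] u_nth[of 1 n] S.K_one_nonneg[OF S.fin_mono[OF f n]] by (cases "n = 0") auto
qed (simp_all add: u_0)

lemma u_1_1: "u 1 $ 1 = \<kappa>' 1"
  using u_nth[of 1 1] kernel_deriv_eq[of 1] by simp

lemma K_1_power: "L \<ge> 1 \<Longrightarrow> S.K L 1 1 = \<kappa>' 1 ^ L"
  using jet_recursion.first[OF recursion[OF fin_1_1], of L] u_nth[of L 1] u_1_1 by simp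

lemma prb_eq_0_if_K_eq_0:
  assumes f: "S.fin L k" and K: "S.K L k 1 = 0" and l: "l \<ge> k"
  shows "prb L l = 0"
proof -
  have "\<forall>l. prb L l * Gd k l 1 = 0"
    using f K unfolding S.fin_def S.K_def
    by (subst (asm) suminf_eq_zero_iff) (auto intro!: mult_nonneg_nonneg S.p_nonneg Gd_one_nonneg)
  then show ?thesis using Gd_one_pos[OF l] by (metis less_irrefl mult_eq_0_iff)
qed

text \<open>If it vanished, \<open>X 1\<close> would take only the values 0 and 1 almost surely.
  Then \<open>\<kappa>' 1\<close> is the probability of the value 1, so it equals 1 and
  \<open>\<kappa> (-1) = -1\<close>, against \<open>kernel_ge_neg\<close>.\<close>

lemma second_derivative_pos:
  assumes l: "\<kappa>' 1 \<ge> 1" and f: "S.fin 1 2"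
  shows "S.K 1 2 1 > 0"
proof (rule ccontr)
  assume "\<not> S.K 1 2 1 > 0"
  then have "S.K 1 2 1 = 0" using S.K_one_nonneg[OF f] by simp
  then have z: "prb 1 l = 0" if "l \<ge> 2" for l using prb_eq_0_if_K_eq_0[OF f] that by blast
  have fin2: "(\<Sum>l. prb 1 l * h l) = prb 1 0 * h 0 + prb 1 1 * h 1" for h :: "nat \<Rightarrow> real"
  proof -
    have "(\<Sum>l. prb 1 l * h l) = (\<Sum>l\<in>{0, 1}. prb 1 l * h l)"
    proof (rule suminf_finite)
      fix l :: nat assume "l \<notin> {0, 1}"
      then have "l \<ge> 2" by auto
      then show "prb 1 l * h l = 0" using z by simp
    qed simp
    then show ?thesis by simp
  qed
  have "\<kappa>' 1 = prb 1 1"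
  proof -
    have "Gd 1 0 1 = 0" "Gd 1 1 1 = 1" unfolding Gd_1_one using d2 by simp_all
    then show ?thesis using kernel_deriv_eq[of 1] unfolding S.K_def fin2 by simp
  qed
  moreover have "prb 1 0 + prb 1 1 = 1"
    using prb_sums[of 1] fin2[of "\<lambda>_. 1"] by (simp add: sums_iff)
  moreover have "prb 1 0 \<ge> 0" by (simp add: prb_def)
  ultimately have p: "prb 1 0 = 0" "prb 1 1 = 1" using l by auto
  have "\<kappa> (-1) = -1"
  proof -
    have "S.K 1 0 (-1) = prb 1 0 * Gd 0 0 (-1) + prb 1 1 * Gd 0 1 (-1)"
      unfolding S.K_def fin2 ..
    also have "\<dots> = -1" unfolding p using gegenbauer_parity[of 1 1] G_at_1[of 1] by simp
    finally show ?thesis using iterate_eq[of 1 "-1"] by simp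
  qed
  then show False using kernel_ge_neg[of "-1"] pos by simp
qed

lemma u_1_2_pos: "\<kappa>' 1 \<ge> 1 \<Longrightarrow> S.fin 1 r \<Longrightarrow> r \<ge> 2 \<Longrightarrow> u 1 $ 2 > 0"
  using second_derivative_pos S.fin_mono[of 1 r 2] u_nth[of 1 2] by simp

section \<open>Finiteness and asymptotics of the moments\<close>

lemma finite_moment_iff: "L \<ge> 1 \<Longrightarrow> finite_moment N (X L) n \<longleftrightarrow> summable (\<lambda>l. prb L l * real l ^ n)"
  unfolding prb_def by (rule moment_series(1)[OF prob X_measurable])

lemma moment_eq: "L \<ge> 1 \<Longrightarrow> finite_moment N (X L) n \<Longrightarrow> moment N (X L) n = (\<Sum>l. prb L l * real l ^ n)"
  unfolding prb_def by (rule moment_series(2)[OF prob X_measurable])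

lemma finite_moment_if_fin:
  assumes "S.fin 1 k" "L \<ge> 1" "n \<le> 2 * k"
  shows "finite_moment N (X L) n"
  using S.summable_power[OF fin_iterate[OF assms(1,2)] assms(3)] finite_moment_iff[OF assms(2)] by simp

lemma all_moments_finite:
  assumes "\<And>k. S.fin 1 k" "L \<ge> 1" shows "finite_moment N (X L) n"
  by (rule finite_moment_if_fin[OF assms(1)[of n] assms(2)]) simp

text \<open>By Leibniz' rule, the derivative of order \<open>r\<close> of \<open>\<kappa> ^^ Suc L\<close> is \<open>\<kappa>' (\<kappa> ^^ L)\<close> times that of
  \<open>\<kappa> ^^ L\<close> plus a function dominated by its value at \<open>1\<close>, so a bound for its difference quotients
  passes to \<open>\<kappa> ^^ L\<close>.\<close>

lemma fin_Suc_descend: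
  assumes f: "S.fin 1 r" and r: "r \<ge> 1" and L: "L \<ge> 1" and l: "\<kappa>' 1 > 0" and fS: "S.fin (Suc L) (Suc r)"
  shows "S.fin L (Suc r)"
proof -
  have fL: "S.fin L r" and fSL: "S.fin (Suc L) r" using fin_iterate[OF f] L by auto
  define v where "v t = S.K 1 1 ((\<kappa> ^^ L) t)" for t
  have r1: "1 + (r - 1) = r" using r by simp
  have jL: "jet (r - 1) (\<kappa> ^^ L) (1 + u L)"
    using jet_J[OF L S.fin_mono[OF fL]] J_eq[OF L] by simp
  have jv: "jet (r - 1) v (Abs_fps (\<lambda>n. S.K 1 (1 + n) 1 / fact n) oo u L)"
    unfolding v_def by (rule jet_compose[OF S.jet_K jL iterate_image u_0]) (simp only: r1 f)
  have jw: "jet (r - 1) (S.K L 1) (Abs_fps (\<lambda>n. S.K L (1 + n) 1 / fact n))"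
    by (intro S.jet_K) (simp only: r1 fL)
  have nw: "nth_deriv_I (r - 1) (S.K L 1) (S.K L r)"
    by (rule S.nth_deriv_K[of L 1 "r - 1", unfolded r1, OF fL])
  obtain R where R: "nth_deriv_I (r - 1) (\<lambda>t. v t * S.K L 1 t) (\<lambda>t. v t * S.K L r t + R t)" "dominated_at_1 R"
    using nth_deriv_I_mult_leading[OF jv jw nw] by auto
  have nS: "nth_deriv_I (r - 1) (S.K (Suc L) 1) (S.K (Suc L) r)"
    by (rule S.nth_deriv_K[of "Suc L" 1 "r - 1", unfolded r1, OF fSL])
  have "deriv_I (\<lambda>t. \<kappa> ((\<kappa> ^^ L) t)) (\<lambda>t. \<kappa>' ((\<kappa> ^^ L) t) * S.K L 1 t)"
  proof (rule deriv_I_compose[OF deriv _ iterate_image])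
    have "deriv_I (S.K L 0) (S.K L 1)"
      using S.K_deriv[of L 0] S.fin_mono[OF fL, of 1] r by simp
    then show "deriv_I (\<kappa> ^^ L) (S.K L 1)"
      by (rule deriv_I_cong) (use iterate_eq[OF L] in simp)
  qed
  then have "deriv_I (S.K (Suc L) 0) (\<lambda>t. \<kappa>' ((\<kappa> ^^ L) t) * S.K L 1 t)"
    by (rule deriv_I_cong) (use iterate_eq[of "Suc L"] in simp)
  moreover have "deriv_I (S.K (Suc L) 0) (S.K (Suc L) 1)"
    using S.K_deriv[of "Suc L" 0] S.fin_mono[OF fSL, of 1] r by simp
  ultimately have e1: "v t * S.K L 1 t = S.K (Suc L) 1 t" if "t \<in> {-1..1}" for t
    using deriv_I_unique that kernel_deriv_eq[OF iterate_range[OF that]] unfolding v_def by metis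
  have e: "S.K (Suc L) r t = v t * S.K L r t + R t" if "t \<in> {-1..1}" for t
    using nth_deriv_I_unique[OF R(1) nS e1 that] by simp
  have v1: "v 1 = \<kappa>' 1" using kernel_deriv_eq[of 1] by (simp add: v_def iterate_1)
  have vle: "v t \<le> \<kappa>' 1" if "t \<in> {-1..1}" for t
    using S.K_dominated[OF fin_1_1] iterate_range[OF that, of L] kernel_deriv_eq[of 1]
    by (auto simp: v_def dominated_at_1_def abs_le_iff)
  show ?thesis
  proof (cases "S.K L r 1 = 0")
    \<comment> \<open>A vanishing \<open>r\<close>-th derivative at \<open>1\<close> means that
      \<open>X L\<close> stays below \<open>r\<close> almost surely, so every series is finite.
      Otherwise the derivative is positive near \<open>1\<close>, where \<open>v t\<close> may be
      replaced by its upper bound \<open>\<kappa>' 1\<close>.\<close>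
    case True
    have "prb L l = 0" if "l \<ge> r" for l using prb_eq_0_if_K_eq_0[OF fL True that] .
    then show ?thesis unfolding S.fin_def
      by (intro summable_finite[of "{..<r}"]) (auto simp: not_less)
  next
    case False
    then have K1: "S.K L r 1 > 0" using S.K_one_nonneg[OF fL] by simp
    have "(S.K L r \<longlongrightarrow> S.K L r 1) (at 1 within {-1..1})"
      using S.continuous_K[OF fL] by (simp add: continuous_on)
    then have "(S.K L r \<longlongrightarrow> S.K L r 1) (at_left 1)" by (simp add: at_within_Icc_at_left)
    then have ev1: "\<forall>\<^sub>F t in at_left 1. 0 < S.K L r t" using K1 by (rule order_tendstoD)
    have ev2: "\<forall>\<^sub>F t in at_left (1::real). t \<in> {-1<..<1}"
      by (rule eventually_at_leftI[of "-1"]) auto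
    have "(S.K (Suc L) r has_real_derivative S.K (Suc L) (Suc r) 1) (at 1 within {-1..1})"
      using S.K_deriv[OF fS] by (simp add: deriv_I_def)
    from deriv_bounded_quotient[OF this] obtain B where
      B: "\<forall>\<^sub>F t in at_left 1. (S.K (Suc L) r 1 - S.K (Suc L) r t) / (1 - t) \<le> B"
      by (auto simp: bounded_quotient_at_1_def)
    have "\<forall>\<^sub>F t in at_left 1. (S.K L r 1 - S.K L r t) / (1 - t) \<le> B / \<kappa>' 1"
      using ev1 ev2 B
    proof eventually_elim
      fix t :: real
      assume K: "0 < S.K L r t" and t: "t \<in> {-1<..<1}"
        and B: "(S.K (Suc L) r 1 - S.K (Suc L) r t) / (1 - t) \<le> B"
      have tI: "t \<in> {-1..1}" using t by simp
      have "R t \<le> R 1" using R(2) tI by (auto simp: dominated_at_1_def abs_le_iff)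
      moreover have "v t * S.K L r t \<le> \<kappa>' 1 * S.K L r t"
        using K vle[OF tI] by (intro mult_right_mono) auto
      ultimately have "\<kappa>' 1 * (S.K L r 1 - S.K L r t) \<le> S.K (Suc L) r 1 - S.K (Suc L) r t"
        using e[OF tI] e[of 1] v1 by (simp add: right_diff_distrib)
      also have "\<dots> \<le> B * (1 - t)" using B t by (simp add: pos_divide_le_eq)
      finally show "(S.K L r 1 - S.K L r t) / (1 - t) \<le> B / \<kappa>' 1"
        using l t by (simp add: field_simps)
    qed
    then show ?thesis
      by (intro S.fin_Suc_if_bounded_quotient[OF fL]) (auto simp: bounded_quotient_at_1_def)
  qed
qed

lemma lambda_0:
  assumes "\<kappa>' 1 = 0" "L \<ge> 1" "l \<ge> 1" shows "prb L l = 0"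
  using prb_eq_0_if_K_eq_0[OF fin_iterate[OF fin_1_1 assms(2)] _ assms(3)] K_1_power[OF assms(2)] assms(1,2)
  by simp

text \<open>The contrapositive of \<open>fin_Suc_descend\<close> hands the failure at order
  \<open>r + 1\<close> from \<open>\<kappa>\<close> to all iterates. Its condition
  \<open>\<kappa>' 1 > 0\<close> holds because \<open>\<kappa>' 1 = 0\<close> would make
  \<open>X 1\<close> vanish almost surely and all its series finite.\<close>

lemma only_2r:
  assumes o: "only_times_differentiable_near_1 r \<kappa>" and L: "L \<ge> 1"
  shows "only_2r_finite_moments N (X L) r"
proof -
  note r = only_times_imp[OF o]
  have "\<kappa>' 1 \<noteq> 0"
  proof
    assume "\<kappa>' 1 = 0"
    then have "S.fin 1 (Suc r)" unfolding S.fin_def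
      by (intro summable_finite[of "{0}"]) (auto simp: lambda_0)
    then show False using r(2) by simp
  qed
  then have l: "\<kappa>' 1 > 0" using lambda_nonneg by simp
  have "\<not> S.fin L (Suc r)" using L
  proof (induction L rule: dec_induct)
    case (step L)
    then show ?case using fin_Suc_descend[OF r(1,3) step.hyps(1) l] by blast
  qed (use r in simp)
  then have n: "\<not> summable (\<lambda>l. prb L l * real l ^ (2 * Suc r))" by (simp add: S.fin_iff)
  have "\<not> finite_moment N (X L) n" if "n \<ge> 2 * r + 2" for n
  proof
    assume "finite_moment N (X L) n"
    then have "summable (\<lambda>l. prb L l * real l ^ n)" using finite_moment_iff[OF L] by simp
    from S.summable_power_mono[OF this, of "2 * Suc r"] n that show False by simp
  qed
  then show ?thesis
    unfolding only_2r_finite_moments_def using finite_moment_if_fin[OF r(1) L] by auto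
qed

lemma moment_mono:
  assumes "L \<ge> 1" "1 \<le> m" "m \<le> n" "finite_moment N (X L) n"
  shows "moment N (X L) m \<le> moment N (X L) n"
proof -
  have s: "summable (\<lambda>l. prb L l * real l ^ n)" using assms finite_moment_iff by simp
  then have "summable (\<lambda>l. prb L l * real l ^ m)"
    using assms by (intro S.summable_power_mono[OF s]) auto
  then show ?thesis
    using S.suminf_power_mono[OF assms(2,3) s] assms finite_moment_iff moment_eq by simp
qed

lemma moment_nonneg: "moment N (X L) n \<ge> 0"
  by (simp add: moment_def)

text \<open>Averaging \<open>power_approx\<close> over \<open>X L\<close> leaves an error
  \<open>\<epsilon> * S.K L n 1 + C\<close>. The constant disappears after division by
  \<open>g L\<close> precisely because \<open>g\<close> tends to infinity.\<close>

lemma moment_tendsto: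
  assumes f: "S.fin 1 n" and n: "n \<ge> 1" and g: "filterlim g at_top sequentially"
    and lim: "(\<lambda>L. S.K L n 1 / g L) \<longlonglongrightarrow> c" "c > 0"
  shows "\<exists>c'>0. (\<lambda>L. moment N (X L) (2 * n) / g L) \<longlonglongrightarrow> c'"
proof -
  obtain dn where dn: "dn > 0" "(\<lambda>l. Gd n l 1 / real l ^ (2 * n)) \<longlonglongrightarrow> dn"
    using Gd_one_asymp by blast
  define m where "m L = moment N (X L) (2 * n)" for L
  have "(\<lambda>L. (dn * m L - S.K L n 1) / g L) \<longlonglongrightarrow> 0"
  proof (rule LIMSEQ_I)
    fix \<eta> :: real assume \<eta>: "\<eta> > 0"
    \<comment> \<open>Eventually \<open>S.K L n 1 / g L < c + 1\<close>, and
      \<open>\<epsilon> * (c + 1) = \<eta> / 2\<close>.\<close>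
    define \<epsilon> where "\<epsilon> = \<eta> / (2 * (c + 1))"
    have \<epsilon>: "\<epsilon> > 0" using \<eta> lim(2) by (simp add: \<epsilon>_def)
    obtain C where C: "C \<ge> 0" "\<And>l. \<bar>dn * real l ^ (2 * n) - Gd n l 1\<bar> \<le> \<epsilon> * Gd n l 1 + C"
      using power_approx[OF \<epsilon> dn(2,1)] by blast
    have ev1: "\<forall>\<^sub>F L in sequentially. S.K L n 1 / g L < c + 1"
      by (rule order_tendstoD[OF lim(1)]) simp
    have "(\<lambda>L. C / g L) \<longlonglongrightarrow> 0"
      by (intro tendsto_divide_0[OF tendsto_const] filterlim_at_top_imp_at_infinity g)
    then have ev2: "\<forall>\<^sub>F L in sequentially. C / g L < \<eta> / 2"
      by (rule order_tendstoD) (use \<eta> in simp)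
    have ev3: "\<forall>\<^sub>F L in sequentially. g L > 0" using g by (simp add: filterlim_at_top_dense)
    have "\<forall>\<^sub>F L in sequentially. norm ((dn * m L - S.K L n 1) / g L - 0) < \<eta>"
      using ev1 ev2 ev3 eventually_ge_at_top[of 1]
    proof eventually_elim
      fix L assume 1: "S.K L n 1 / g L < c + 1" and 2: "C / g L < \<eta> / 2" and g: "g L > 0" and L: "1 \<le> L"
      have fL: "S.fin L n" by (rule fin_iterate[OF f L])
      have s1: "summable (\<lambda>l. prb L l * real l ^ (2 * n))" using fL by (simp add: S.fin_iff)
      have s2: "summable (\<lambda>l. prb L l * Gd n l 1)" using fL by (simp add: S.fin_def)
      have s3: "summable (prb L)" "(\<Sum>l. prb L l) = 1" using prb_sums[OF L] by (auto simp: sums_iff)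
      have meq: "m L = (\<Sum>l. prb L l * real l ^ (2 * n))"
        unfolding m_def using s1 finite_moment_iff[OF L] moment_eq[OF L] by simp
      have bd: "\<bar>prb L l * (dn * real l ^ (2 * n) - Gd n l 1)\<bar> \<le> \<epsilon> * (prb L l * Gd n l 1) + C * prb L l" for l
      proof -
        have "\<bar>prb L l * (dn * real l ^ (2 * n) - Gd n l 1)\<bar> = prb L l * \<bar>dn * real l ^ (2 * n) - Gd n l 1\<bar>"
          using S.p_nonneg[of L l] by (simp add: abs_mult)
        also have "\<dots> \<le> prb L l * (\<epsilon> * Gd n l 1 + C)"
          by (rule mult_left_mono[OF C(2) S.p_nonneg])
        finally show ?thesis by (simp add: algebra_simps)
      qed
      have s4: "summable (\<lambda>l. \<epsilon> * (prb L l * Gd n l 1) + C * prb L l)"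
        by (intro summable_add summable_mult s2 s3)
      have s5: "summable (\<lambda>l. \<bar>prb L l * (dn * real l ^ (2 * n) - Gd n l 1)\<bar>)"
        by (rule summable_comparison_test'[OF s4]) (use bd in simp)
      have "dn * m L - S.K L n 1 = (\<Sum>l. dn * (prb L l * real l ^ (2 * n)) - prb L l * Gd n l 1)"
        unfolding meq S.K_def
        by (subst suminf_diff[symmetric]) (auto intro!: summable_mult s1 s2 simp: suminf_mult[OF s1])
      also have "\<dots> = (\<Sum>l. prb L l * (dn * real l ^ (2 * n) - Gd n l 1))"
        by (simp add: algebra_simps)
      also have "\<bar>\<dots>\<bar> \<le> (\<Sum>l. \<bar>prb L l * (dn * real l ^ (2 * n) - Gd n l 1)\<bar>)"
        by (rule summable_rabs[OF s5])
      also have "\<dots> \<le> (\<Sum>l. \<epsilon> * (prb L l * Gd n l 1) + C * prb L l)"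
        by (rule suminf_le[OF bd s5 s4])
      also have "\<dots> = \<epsilon> * S.K L n 1 + C"
        unfolding S.K_def using s3
        by (subst suminf_add[symmetric]) (auto intro!: summable_mult s2 s3 simp: suminf_mult[OF s2] suminf_mult[OF s3(1)])
      finally have "\<bar>dn * m L - S.K L n 1\<bar> / g L \<le> \<epsilon> * (S.K L n 1 / g L) + C / g L"
        using g by (simp add: field_simps)
      also have "\<dots> < \<epsilon> * (c + 1) + \<eta> / 2"
        using 1 2 \<epsilon> by (intro add_strict_mono mult_strict_left_mono) auto
      also have "\<dots> = \<eta>" using lim(2) by (simp add: \<epsilon>_def field_simps)
      finally show "norm ((dn * m L - S.K L n 1) / g L - 0) < \<eta>" using g by (simp add: abs_divide)
    qed
    then show "\<exists>no. \<forall>L\<ge>no. norm ((dn * m L - S.K L n 1) / g L - 0) < \<eta>"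
      by (simp add: eventually_sequentially)
  qed
  from tendsto_mult[OF tendsto_add[OF this lim(1)] tendsto_const[of "1 / dn"]]
  have "(\<lambda>L. m L / g L) \<longlonglongrightarrow> (0 + c) * (1 / dn)"
    using dn(1) by (simp add: diff_divide_distrib)
  then show ?thesis unfolding m_def using dn lim(2) by (intro exI[of _ "(0 + c) * (1 / dn)"]) simp
qed

lemma supercritical_moment:
  assumes l: "\<kappa>' 1 > 1" and f: "S.fin 1 n" and n: "n \<ge> 1"
  shows "\<exists>c>0. (\<lambda>L. moment N (X L) (2 * n) / \<kappa>' 1 ^ (n * L)) \<longlonglongrightarrow> c"
proof -
  interpret jet_recursion u "u 1" n by (rule recursion[OF f])
  obtain c where c: "c > 0" "(\<lambda>L. u L $ n / \<kappa>' 1 ^ (n * L)) \<longlonglongrightarrow> c"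
    using supercritical[of n] u_1_2_pos[OF _ f] l n unfolding u_1_1 by auto
  have "(\<lambda>L. fact n * (u L $ n / \<kappa>' 1 ^ (n * L))) \<longlonglongrightarrow> fact n * c"
    by (intro tendsto_intros c)
  moreover have "\<forall>\<^sub>F L in sequentially. fact n * (u L $ n / \<kappa>' 1 ^ (n * L)) = S.K L n 1 / \<kappa>' 1 ^ (n * L)"
    using eventually_ge_at_top[of 1] by eventually_elim (use n in \<open>simp add: u_nth\<close>)
  ultimately have "(\<lambda>L. S.K L n 1 / \<kappa>' 1 ^ (n * L)) \<longlonglongrightarrow> fact n * c"
    by (rule Lim_transform_eventually)
  moreover have "filterlim (\<lambda>L. \<kappa>' 1 ^ (n * L)) at_top sequentially"
  proof (rule filterlim_at_infinity_imp_filterlim_at_top)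
    show "filterlim (\<lambda>L. \<kappa>' 1 ^ (n * L)) at_infinity sequentially"
      unfolding power_mult using l n by (intro filterlim_realpow_sequentially_gt1) (simp add: one_less_power)
  qed (use l in simp)
  ultimately show ?thesis using c by (intro moment_tendsto[OF f n, where c = "fact n * c"]) auto
qed

lemma critical_moment:
  assumes l: "\<kappa>' 1 = 1" and f: "S.fin 1 n" and n: "n \<ge> 2"
  shows "\<exists>c>0. (\<lambda>L. moment N (X L) (2 * n) / real L ^ (n - 1)) \<longlonglongrightarrow> c"
proof -
  interpret jet_recursion u "u 1" n by (rule recursion[OF f])
  obtain c where c: "c > 0" "(\<lambda>L. u L $ n / real L ^ (n - 1)) \<longlonglongrightarrow> c"
    using critical[of n] u_1_2_pos[OF _ f] l n unfolding u_1_1 by auto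
  have "(\<lambda>L. fact n * (u L $ n / real L ^ (n - 1))) \<longlonglongrightarrow> fact n * c"
    by (intro tendsto_intros c)
  moreover have "\<forall>\<^sub>F L in sequentially. fact n * (u L $ n / real L ^ (n - 1)) = S.K L n 1 / real L ^ (n - 1)"
    using eventually_ge_at_top[of 1] by eventually_elim (use n in \<open>simp add: u_nth\<close>)
  ultimately have "(\<lambda>L. S.K L n 1 / real L ^ (n - 1)) \<longlonglongrightarrow> fact n * c"
    by (rule Lim_transform_eventually)
  moreover have "filterlim (\<lambda>L. real L ^ (n - 1)) at_top sequentially"
    using n by (intro filterlim_pow_at_top filterlim_real_sequentially) auto
  ultimately show ?thesis using c n by (intro moment_tendsto[OF f, where c = "fact n * c"]) auto
qed

text \<open>The moments tend to 0 here, so the additive constant of \<open>power_approx\<close> is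
  not negligible. For \<open>l \<ge> 1\<close> it is absorbed in
  \<open>C * real d * Gd 1 l 1\<close>, whose mean is a multiple of
  \<open>\<kappa>' 1 ^ L\<close>.\<close>

lemma subcritical_moment:
  assumes l: "\<kappa>' 1 < 1" and f: "S.fin 1 r" and r: "r \<ge> 1"
  shows "(\<lambda>L. moment N (X L) (2 * r)) \<in> O(\<lambda>L. \<kappa>' 1 ^ L)"
proof (cases "\<kappa>' 1 = 0")
  \<comment> \<open>The normalisation by \<open>\<kappa>' 1 ^ L\<close> is impossible here, but
    \<open>X L\<close> is 0 almost surely.\<close>
  case True
  have "\<forall>\<^sub>F L in sequentially. norm (moment N (X L) (2 * r)) \<le> 1 * norm (\<kappa>' 1 ^ L)"
    using eventually_ge_at_top[of 1]
  proof eventually_elim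
    fix L :: nat assume L: "1 \<le> L"
    have "prb L l * real l ^ (2 * r) = 0" for l
      using lambda_0[OF True L, of l] r by (cases "l = 0") auto
    then have "(\<Sum>l. prb L l * real l ^ (2 * r)) = 0" by (simp only: suminf_zero)
    then have "moment N (X L) (2 * r) = 0"
      using moment_eq[OF L finite_moment_if_fin[OF f L], of "2 * r"] r by simp
    then show "norm (moment N (X L) (2 * r)) \<le> 1 * norm (\<kappa>' 1 ^ L)" by simp
  qed
  then show ?thesis by (rule landau_o.bigI[OF zero_less_one])
next
  case False
  then have l0: "\<kappa>' 1 > 0" using lambda_nonneg by simp
  interpret jet_recursion u "u 1" r by (rule recursion[OF f])
  obtain c where "(\<lambda>L. u L $ r / \<kappa>' 1 ^ L) \<longlonglongrightarrow> c"
    using subcritical[of r] l l0 r unfolding u_1_1 by auto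
  then have "Bseq (\<lambda>L. u L $ r / \<kappa>' 1 ^ L)" by (intro convergent_imp_Bseq) (auto simp: convergent_def)
  then obtain B where B: "\<And>L. \<bar>u L $ r / \<kappa>' 1 ^ L\<bar> \<le> B" by (auto simp: Bseq_def)
  obtain dn where dn: "dn > 0" "(\<lambda>l. Gd r l 1 / real l ^ (2 * r)) \<longlonglongrightarrow> dn"
    using Gd_one_asymp by blast
  obtain C where C: "C \<ge> 0" "\<And>l. \<bar>dn * real l ^ (2 * r) - Gd r l 1\<bar> \<le> 1 * Gd r l 1 + C"
    using power_approx[OF zero_less_one dn(2,1)] by blast
  have pw: "dn * real l ^ (2 * r) \<le> 2 * Gd r l 1 + C * real d * Gd 1 l 1" for l
  proof (cases "l = 0")
    case True
    then show ?thesis using r C(1) Gd_one_nonneg[of r 0] Gd_one_nonneg[of 1 0] by (simp add: power_0_left)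
  next
    case False
    have "1 \<le> (real l)\<^sup>2" using False by simp
    then have "1 \<le> real d * Gd 1 l 1" using Gd_1_one_bounds(1)[of l] by linarith
    then have "C * 1 \<le> C * (real d * Gd 1 l 1)" using C(1) by (intro mult_left_mono) auto
    then show ?thesis using C(2)[of l] by (simp add: mult.assoc)
  qed
  define A where "A = (2 * fact r * B + C * real d) / dn"
  have "\<forall>\<^sub>F L in sequentially. norm (moment N (X L) (2 * r)) \<le> A * norm (\<kappa>' 1 ^ L)"
    using eventually_ge_at_top[of 1]
  proof eventually_elim
    fix L :: nat assume L: "1 \<le> L"
    have fL: "S.fin L r" "S.fin L 1" using fin_iterate[OF _ L] f fin_1_1 by auto
    have s1: "summable (\<lambda>l. prb L l * real l ^ (2 * r))" using fL by (simp add: S.fin_iff)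
    have s2: "summable (\<lambda>l. prb L l * Gd r l 1)" "summable (\<lambda>l. prb L l * Gd 1 l 1)"
      using fL by (simp_all add: S.fin_def)
    have "dn * moment N (X L) (2 * r) = (\<Sum>l. dn * (prb L l * real l ^ (2 * r)))"
      using moment_eq[OF L finite_moment_if_fin[OF f L], of "2 * r"] r by (simp add: suminf_mult[OF s1])
    also have "\<dots> \<le> (\<Sum>l. 2 * (prb L l * Gd r l 1) + C * real d * (prb L l * Gd 1 l 1))"
    proof (rule suminf_le)
      show "dn * (prb L l * real l ^ (2 * r)) \<le> 2 * (prb L l * Gd r l 1) + C * real d * (prb L l * Gd 1 l 1)" for l
        using mult_left_mono[OF pw[of l] S.p_nonneg[of L l]] by (simp add: algebra_simps)
    qed (intro summable_add summable_mult s1 s2)+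
    also have "\<dots> = 2 * S.K L r 1 + C * real d * S.K L 1 1"
      unfolding S.K_def
      by (simp only: suminf_add[OF summable_mult[OF s2(1)] summable_mult[OF s2(2)], symmetric]
          suminf_mult[OF s2(1)] suminf_mult[OF s2(2)])
    also have "S.K L r 1 = fact r * u L $ r" using u_nth[OF L r] by simp
    also have "u L $ r \<le> B * \<kappa>' 1 ^ L"
      using B[of L] l0 by (simp add: abs_divide pos_divide_le_eq)
    finally have "dn * moment N (X L) (2 * r) \<le> (2 * fact r * B + C * real d) * \<kappa>' 1 ^ L"
      using K_1_power[OF L] by (simp add: algebra_simps)
    then show "norm (moment N (X L) (2 * r)) \<le> A * norm (\<kappa>' 1 ^ L)"
      using dn(1) l0 moment_nonneg[of L "2 * r"] by (simp add: A_def field_simps)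
  qed
  then show ?thesis by (rule bigoI)
qed

lemma subcritical_moments:
  assumes l: "\<kappa>' 1 < 1" and f: "S.fin 1 r" and n: "1 \<le> n" "n \<le> 2 * r"
  shows "(\<lambda>L. moment N (X L) n) \<in> O(\<lambda>L. \<kappa>' 1 ^ L)"
proof -
  have "(\<lambda>L. moment N (X L) n) \<in> O(\<lambda>L. moment N (X L) (2 * r))"
  proof (rule bigoI[where c = 1], use eventually_ge_at_top[of 1] in eventually_elim)
    fix L :: nat assume L: "1 \<le> L"
    show "norm (moment N (X L) n) \<le> 1 * norm (moment N (X L) (2 * r))"
      using moment_mono[OF L n finite_moment_if_fin[OF f L, of "2 * r"]] n moment_nonneg[of L] by simp
  qed
  also have "(\<lambda>L. moment N (X L) (2 * r)) \<in> O(\<lambda>L. \<kappa>' 1 ^ L)"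
    using n by (intro subcritical_moment[OF l f]) auto
  finally show ?thesis .
qed

lemma moment_interpolate:
  assumes f: "S.fin 1 k" and "L \<ge> 1" "n + 3 \<le> 2 * k" "s > 0"
  shows "moment N (X L) (n + 1) \<le> s * moment N (X L) n + moment N (X L) (n + 3) / s\<^sup>2"
  using S.suminf_power_interpolate[OF assms(4) S.summable_power[OF fin_iterate[OF f assms(2)] assms(3)]]
    finite_moment_if_fin[OF f assms(2)] assms(3) moment_eq[OF assms(2)] by simp

end

section \<open>Limits of the iterated kernels\<close>

lemma weight_dominated_convergence:
  assumes d: "d \<ge> 2" and cont: "\<And>n. continuous_on {-1..1} (f n)"
    and bd: "\<And>n x. x \<in> {-1..1} \<Longrightarrow> \<bar>f n x\<bar> \<le> B"
    and lim: "\<And>x. x \<in> {-1..1} \<Longrightarrow> (\<lambda>n. f n x) \<longlonglongrightarrow> q x"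
  shows "set_integrable lborel {-1..1} (\<lambda>x. q x * jacobi_weight d x)"
    and "(\<lambda>n. LINT x:{-1..1}|lborel. f n x * jacobi_weight d x) \<longlonglongrightarrow> (LINT x:{-1..1}|lborel. q x * jacobi_weight d x)"
proof -
  define F where "F n x = indicator {-1..1} x *\<^sub>R f n x" for n and x :: real
  define Q where "Q x = indicator {-1..1} x *\<^sub>R q x" for x :: real
  have Fm [measurable]: "F n \<in> borel_measurable borel" for n
    using borel_measurable_continuous_on_indicator[OF _ cont[of n]] unfolding F_def by simp
  have FQ: "(\<lambda>n. F n x) \<longlonglongrightarrow> Q x" for x
    using lim[of x] by (cases "x \<in> {-1..1}") (simp_all add: F_def Q_def)
  have Qm [measurable]: "Q \<in> borel_measurable borel" by (rule borel_measurable_LIMSEQ_metric[OF Fm FQ])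
  have qb: "\<bar>q x\<bar> \<le> B" if "x \<in> {-1..1}" for x
    by (rule tendsto_upperbound[OF tendsto_rabs[OF lim[OF that]]]) (use bd that in auto)
  have w: "integrable lborel (\<lambda>x. indicator {-1..1::real} x *\<^sub>R (B * jacobi_weight d x))"
    using set_integrable_weight_continuous[OF d, of "\<lambda>_. B"] by (simp add: set_integrable_def)
  have eF: "indicator {-1..1} x *\<^sub>R (f n x * jacobi_weight d x) = F n x * jacobi_weight d x" for n x
    by (simp add: F_def)
  have eQ: "indicator {-1..1} x *\<^sub>R (q x * jacobi_weight d x) = Q x * jacobi_weight d x" for x
    by (simp add: Q_def)
  have "(\<lambda>n. F n x * jacobi_weight d x) \<longlonglongrightarrow> Q x * jacobi_weight d x" for x
    by (intro tendsto_intros FQ)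
  moreover have "norm (F n x * jacobi_weight d x) \<le> indicator {-1..1::real} x *\<^sub>R (B * jacobi_weight d x)" for n x
    using bd[of x n] jacobi_weight_nonneg[of d x]
    by (cases "x \<in> {-1..1}") (auto simp: F_def abs_mult intro: mult_right_mono)
  ultimately have "integrable lborel (\<lambda>x. Q x * jacobi_weight d x)"
    and "(\<lambda>n. \<integral>x. F n x * jacobi_weight d x \<partial>lborel) \<longlonglongrightarrow> (\<integral>x. Q x * jacobi_weight d x \<partial>lborel)"
    by - (rule integrable_dominated_convergence[where s = "\<lambda>n x. F n x * jacobi_weight d x", OF _ _ w],
      simp_all, rule integral_dominated_convergence[OF _ _ w], simp_all)
  then show "set_integrable lborel {-1..1} (\<lambda>x. q x * jacobi_weight d x)"
    and "(\<lambda>n. LINT x:{-1..1}|lborel. f n x * jacobi_weight d x) \<longlonglongrightarrow> (LINT x:{-1..1}|lborel. q x * jacobi_weight d x)"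
    unfolding set_integrable_def set_lebesgue_integral_def eF eQ by this
qed

lemma weight_integral_pos:
  assumes "d \<ge> 2" shows "(LINT x:{-1..1}|lborel. jacobi_weight d x) > 0"
proof -
  have "(LINT x:{-1..1}|lborel. jacobi_weight d x) \<noteq> 0"
  proof
    assume "(LINT x:{-1..1}|lborel. jacobi_weight d x) = 0"
    then have z: "(LINT x:{-1..1}|lborel. 1 * jacobi_weight d x) = 0" by simp
    have "set_integrable lborel {-1..1} (\<lambda>x. 1 * jacobi_weight d x)"
      by (rule set_integrable_weight_continuous[OF assms]) simp
    from weight_integral_eq_0_AE[OF this _ z] show False using not_AE_interval[of "-1" 1] by simp
  qed
  moreover have "(LINT x:{-1..1}|lborel. jacobi_weight d x) \<ge> 0"
    unfolding set_lebesgue_integral_def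
    by (intro integral_nonneg_AE AE_I2) (simp add: jacobi_weight_nonneg)
  ultimately show ?thesis by simp
qed

context deep_network
begin

section \<open>The probability of zero and the first two moments\<close>

definition total_weight :: real where
  "total_weight = (LINT x:{-1..1}|lborel. jacobi_weight d x)"

lemma continuous_iterate: "continuous_on {-1..1} (\<kappa> ^^ L)"
proof (cases "L = 0")
  case False
  then have "continuous_on {-1..1} (S.K L 0)" by (intro S.continuous_K fin_0) simp
  then show ?thesis by (rule continuous_on_cong[THEN iffD1, rotated -1]) (use iterate_eq False in auto)
qed simp

lemma iterate_abs_le: "t \<in> {-1..1} \<Longrightarrow> \<bar>(\<kappa> ^^ L) t\<bar> \<le> 1"
  using iterate_range[of t L] by (auto simp: abs_le_iff)

text \<open>All terms with \<open>l \<ge> 1\<close> are orthogonal to \<open>G 0 = 1\<close>. The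
  partial sums are bounded by 1, which permits termwise integration.\<close>

lemma weight_coefficient:
  assumes L: "L \<ge> 1"
  shows "(LINT x:{-1..1}|lborel. (\<kappa> ^^ L) x * jacobi_weight d x) = prb L 0 * total_weight"
proof (rule LIMSEQ_unique)
  define s where "s n x = (\<Sum>l<n. prb L l * poly (G l) x)" for n x
  show "(\<lambda>n. LINT x:{-1..1}|lborel. s n x * jacobi_weight d x) \<longlonglongrightarrow> (LINT x:{-1..1}|lborel. (\<kappa> ^^ L) x * jacobi_weight d x)"
  proof (rule weight_dominated_convergence(2)[OF d2, where B = 1])
    show "continuous_on {-1..1} (s n)" for n unfolding s_def by (intro continuous_intros)
    show "(\<lambda>n. s n x) \<longlonglongrightarrow> (\<kappa> ^^ L) x" if "x \<in> {-1..1}" for x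
      using expansion[OF L that] by (simp add: sums_def s_def prb_def)
    show "\<bar>s n x\<bar> \<le> 1" if "x \<in> {-1..1}" for n x
    proof -
      have "\<bar>s n x\<bar> \<le> (\<Sum>l<n. \<bar>prb L l * poly (G l) x\<bar>)" unfolding s_def by (rule sum_abs)
      also have "\<dots> \<le> (\<Sum>l<n. prb L l)"
      proof (rule sum_mono)
        fix l
        have "\<bar>poly (G l) x\<bar> \<le> 1" using Gd_bound[OF that, of 0 l] by (simp add: G_at_1)
        then show "\<bar>prb L l * poly (G l) x\<bar> \<le> prb L l"
          using S.p_nonneg[of L l] by (simp add: abs_mult mult_left_le)
      qed
      also have "\<dots> \<le> 1"
        using sum_le_suminf[of "prb L" "{..<n}"] prb_sums[OF L] S.p_nonneg[of L] by (simp add: sums_iff)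
      finally show ?thesis .
    qed
  qed
  show "(\<lambda>n. LINT x:{-1..1}|lborel. s n x * jacobi_weight d x) \<longlonglongrightarrow> prb L 0 * total_weight"
  proof (rule tendsto_eventually, use eventually_ge_at_top[of 1] in eventually_elim)
    fix n :: nat assume n: "1 \<le> n"
    have i: "set_integrable lborel {-1..1} (\<lambda>x. prb L l * (poly (G l) x * jacobi_weight d x))" for l
      by (intro set_integrable_mult_right set_integrable_weight_continuous d2 continuous_intros)
    have "(LINT x:{-1..1}|lborel. s n x * jacobi_weight d x)
        = (LINT x:{-1..1}|lborel. (\<Sum>l<n. prb L l * (poly (G l) x * jacobi_weight d x)))"
      by (simp add: s_def sum_distrib_right mult.assoc)
    also have "\<dots> = (\<Sum>l<n. LINT x:{-1..1}|lborel. prb L l * (poly (G l) x * jacobi_weight d x))"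
      using i unfolding set_lebesgue_integral_def set_integrable_def scaleR_sum_right
      by (intro Bochner_Integration.integral_sum)
    also have "\<dots> = (\<Sum>l<n. if l = 0 then prb L 0 * total_weight else 0)"
      by (intro sum.cong refl) (auto simp: G_0 total_weight_def weight_integral_G)
    also have "\<dots> = prb L 0 * total_weight" using n by simp
    finally show "(LINT x:{-1..1}|lborel. s n x * jacobi_weight d x) = prb L 0 * total_weight" .
  qed
qed

lemma total_weight_pos: "total_weight > 0"
  unfolding total_weight_def by (rule weight_integral_pos[OF d2])

lemma prb_0_tendsto:
  assumes "\<And>t. t \<in> {-1..1} \<Longrightarrow> (\<lambda>L. (\<kappa> ^^ L) t) \<longlonglongrightarrow> q t"
  shows "set_integrable lborel {-1..1} (\<lambda>x. q x * jacobi_weight d x)"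
    and "(\<lambda>L. prb L 0) \<longlonglongrightarrow> (LINT x:{-1..1}|lborel. q x * jacobi_weight d x) / total_weight"
proof -
  note dc = weight_dominated_convergence[OF d2 continuous_iterate iterate_abs_le assms]
  show "set_integrable lborel {-1..1} (\<lambda>x. q x * jacobi_weight d x)" by (rule dc(1))
  have "(\<lambda>L. (LINT x:{-1..1}|lborel. (\<kappa> ^^ L) x * jacobi_weight d x) / total_weight)
      \<longlonglongrightarrow> (LINT x:{-1..1}|lborel. q x * jacobi_weight d x) / total_weight"
    by (intro tendsto_intros dc(2) less_imp_neq[OF total_weight_pos, symmetric])
  then show "(\<lambda>L. prb L 0) \<longlonglongrightarrow> (LINT x:{-1..1}|lborel. q x * jacobi_weight d x) / total_weight"
  proof (rule Lim_transform_eventually)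
    show "\<forall>\<^sub>F L in sequentially. (LINT x:{-1..1}|lborel. (\<kappa> ^^ L) x * jacobi_weight d x) / total_weight = prb L 0"
      using eventually_ge_at_top[of 1]
      by eventually_elim (use weight_coefficient total_weight_pos in simp)
  qed
qed

lemma moment_1_ge: 
  assumes L: "L \<ge> 1" shows "1 - prb L 0 \<le> moment N (X L) 1"
proof -
  have s: "(\<lambda>l. prb L l - (if l = 0 then prb L 0 else 0)) sums (1 - prb L 0)"
    by (intro sums_diff prb_sums L sums_single)
  have f: "finite_moment N (X L) 1" by (rule finite_moment_if_fin[OF fin_1_1 L]) auto
  then have s2: "(\<lambda>l. prb L l * real l ^ 1) sums moment N (X L) 1"
    using finite_moment_iff[OF L] moment_eq[OF L f] by (simp add: summable_sums)
  show ?thesis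
  proof (rule sums_le[OF _ s s2])
    fix l
    show "prb L l - (if l = 0 then prb L 0 else 0) \<le> prb L l * real l ^ 1"
    proof (cases "l = 0")
      case False
      then have "prb L l * 1 \<le> prb L l * real l" by (intro mult_left_mono S.p_nonneg) simp
      then show ?thesis using False by simp
    qed simp
  qed
qed

text \<open>Averages \<open>x \<le> k + x^2 / k\<close> over the event that \<open>X L\<close> is
  nonzero. If its probability tends to 0 and second moments stay bounded, large \<open>k\<close>
  gives a vanishing mean.\<close>

lemma moment_1_le:
  assumes L: "L \<ge> 1" and k: "k > 0"
  shows "moment N (X L) 1 \<le> k * (1 - prb L 0) + moment N (X L) 2 / k"
proof -
  have f: "finite_moment N (X L) 1" "finite_moment N (X L) 2"
    by (rule finite_moment_if_fin[OF fin_1_1 L]; simp)+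
  have s1: "(\<lambda>l. prb L l * real l ^ 1) sums moment N (X L) 1"
    and s2: "(\<lambda>l. prb L l * real l ^ 2) sums moment N (X L) 2"
    using f finite_moment_iff[OF L] moment_eq[OF L] by (simp_all add: summable_sums)
  have s: "(\<lambda>l. k * (prb L l - (if l = 0 then prb L 0 else 0)) + prb L l * real l ^ 2 / k)
      sums (k * (1 - prb L 0) + moment N (X L) 2 / k)"
    by (intro sums_add sums_mult sums_divide sums_diff prb_sums L sums_single s2)
  show ?thesis
  proof (rule sums_le[OF _ s1 s])
    fix l
    show "prb L l * real l ^ 1 \<le> k * (prb L l - (if l = 0 then prb L 0 else 0)) + prb L l * real l ^ 2 / k"
    proof (cases "l = 0")
      case False
      have "real l \<le> k + real l ^ 2 / k"
      proof (cases "real l \<le> k")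
        case True
        then show ?thesis using k by (simp add: add_increasing2)
      next
        case False
        then have "real l * k \<le> real l * real l" by (intro mult_left_mono) auto
        then show ?thesis using k by (simp add: field_simps power2_eq_square add_increasing)
      qed
      from mult_left_mono[OF this S.p_nonneg[of L l]] False show ?thesis by (simp add: algebra_simps)
    qed simp
  qed
qed

lemma moment_2_bounds:
  assumes L: "L \<ge> 1"
  shows "\<kappa>' 1 ^ L \<le> moment N (X L) 2" "moment N (X L) 2 \<le> real d * \<kappa>' 1 ^ L"
proof -
  have f: "S.fin L 1" by (rule fin_iterate[OF fin_1_1 L])
  have s1: "(\<lambda>l. prb L l * Gd 1 l 1) sums \<kappa>' 1 ^ L"
    using f K_1_power[OF L] unfolding S.fin_def S.K_def by (metis summable_sums)
  have "finite_moment N (X L) 2" by (rule finite_moment_if_fin[OF fin_1_1 L]) auto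
  then have s2: "(\<lambda>l. prb L l * real l ^ 2) sums moment N (X L) 2"
    using finite_moment_iff[OF L] moment_eq[OF L] by (simp add: summable_sums)
  show "\<kappa>' 1 ^ L \<le> moment N (X L) 2"
    by (rule sums_le[OF _ s1 s2]) (intro mult_left_mono Gd_1_one_bounds S.p_nonneg)
  show "moment N (X L) 2 \<le> real d * \<kappa>' 1 ^ L"
  proof (rule sums_le[OF _ s2 sums_mult[OF s1]])
    show "prb L l * (real l)\<^sup>2 \<le> real d * (prb L l * Gd 1 l 1)" for l
      using mult_left_mono[OF Gd_1_one_bounds(1)[of l] S.p_nonneg[of L l]] by (simp add: mult_ac)
  qed
qed

lemma kernel_increment:
  assumes "s \<in> {-1..1}" "t \<in> {-1..1}" "s \<le> t"
  shows "\<kappa> t - \<kappa> s \<le> \<kappa>' 1 * (t - s)"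
proof (cases "s = t")
  case False
  then have st: "s < t" using assms by simp
  have "\<exists>x\<in>{s<..<t}. \<kappa> t - \<kappa> s = (\<lambda>h. h * \<kappa>' x) (t - s)"
  proof (rule mvt_simple[OF st])
    fix x assume "s \<le> x" "x \<le> t"
    then have "x \<in> {-1..1}" using assms by auto
    then have "(\<kappa> has_real_derivative \<kappa>' x) (at x within {-1..1})"
      using deriv by (simp add: deriv_I_def)
    then have "(\<kappa> has_real_derivative \<kappa>' x) (at x within {s..t})"
      by (rule DERIV_subset) (use assms in auto)
    then show "(\<kappa> has_derivative (\<lambda>h. h * \<kappa>' x)) (at x within {s..t})"
      by (simp add: has_field_derivative_def mult.commute[of _ "\<kappa>' x"])
  qed
  then obtain x where x: "x \<in> {s<..<t}" "\<kappa> t - \<kappa> s = (t - s) * \<kappa>' x" by auto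
  have xI: "x \<in> {-1..1}" using x assms by auto
  have "\<kappa>' x \<le> \<kappa>' 1"
    using S.K_dominated[OF fin_1_1] xI kernel_deriv_eq[OF xI] kernel_deriv_eq[of 1]
    by (auto simp: dominated_at_1_def abs_le_iff)
  then show ?thesis using x(2) st by (simp add: mult_left_mono mult.commute)
qed simp

lemma kernel_tendsto:
  assumes "(\<lambda>L. (\<kappa> ^^ L) t) \<longlonglongrightarrow> q" "t \<in> {-1..1}"
  shows "q \<in> {-1..1}" "\<kappa> q = q"
proof -
  show q: "q \<in> {-1..1}"
    by (rule closed_sequentially[OF closed_atLeastAtMost _ assms(1)]) (use iterate_range[OF assms(2)] in auto)
  have "(\<lambda>L. \<kappa> ((\<kappa> ^^ L) t)) \<longlonglongrightarrow> \<kappa> q"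
    using continuous_iterate[of 1]
    by (intro continuous_on_tendsto_compose[OF _ assms(1) q]) (use iterate_range[OF assms(2)] in auto)
  moreover have "(\<lambda>L. \<kappa> ((\<kappa> ^^ L) t)) \<longlonglongrightarrow> q"
    using LIMSEQ_Suc[OF assms(1)] by simp
  ultimately show "\<kappa> q = q" by (rule LIMSEQ_unique)
qed

text \<open>If \<open>\<kappa>\<close> had another fixed point in the critical case, it would be the identity near \<open>1\<close>,
  against \<open>second_derivative_pos\<close>.\<close>

lemma critical_fixed_point:
  assumes l: "\<kappa>' 1 = 1" and q: "q \<in> {-1..1}" "\<kappa> q = q"
  shows "q = 1"
proof (rule ccontr)
  assume "q \<noteq> 1"
  then have q1: "q < 1" using q by auto
  \<comment> \<open>Slopes are at most 1: measured down from the fixed point \<open>1\<close> this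
    gives \<open>\<kappa> s \<ge> s\<close>, and measured up from the fixed point \<open>q\<close>
    it gives \<open>\<kappa> s \<le> s\<close>.\<close>
  have id: "\<kappa> s = s" if s: "s \<in> {q..1}" for s
  proof -
    have "s \<in> {-1..1}" using s q by auto
    then show ?thesis
      using kernel_increment[of s 1] kernel_increment[of q s] s q l kernel_1 by auto
  qed
  \<comment> \<open>The derivatives of the identity, which make \<open>\<kappa>\<close> twice
    differentiable near \<open>1\<close> without any smoothness assumption.\<close>
  define F where "F k s = (if k = 0 then s else if k = 1 then 1 else 0)" for k :: nat and s :: real
  have "times_differentiable_near_1 2 \<kappa>"
    unfolding times_differentiable_near_1_def times_differentiable_on_def
  proof (intro exI[of _ "1 - q"] exI[of _ F] conjI ballI allI impI)
    fix k :: nat and s :: real assume "k < 2"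
    then have "k = 0 \<or> k = 1" by auto
    then show "(F k has_real_derivative F (Suc k) s) (at s within {1 - (1 - q)..1})"
      by (elim disjE) (simp_all add: F_def[abs_def])
  qed (use q q1 id in \<open>auto simp: F_def\<close>)
  then have f: "S.fin 1 2" by (simp only: times_differentiable_iff)
  have sub: "(g has_real_derivative g' s) (at s within {q..1})" if "deriv_I g g'" "s \<in> {q..1}" for g g' s
  proof -
    have "(g has_real_derivative g' s) (at s within {-1..1})"
      using that q by (simp add: deriv_I_def)
    then show ?thesis by (rule DERIV_subset) (use q in auto)
  qed
  have K1: "S.K 1 1 s = 1" if s: "s \<in> {q..1}" for s
  proof -
    have sI: "s \<in> {-1..1}" using s q by auto
    have "(\<kappa> has_real_derivative 1) (at s within {q..1})"
      by (rule has_field_derivative_transform_within[OF DERIV_ident zero_less_one s]) (use id in auto)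
    from has_real_derivative_Icc_unique[OF sub[OF deriv s] this q1 s]
    show ?thesis using kernel_deriv_eq[OF sI] by simp
  qed
  have "deriv_I (S.K 1 1) (S.K 1 2)" using S.K_deriv[of 1 1] f by (simp add: numeral_2_eq_2)
  then have "(S.K 1 1 has_real_derivative S.K 1 2 1) (at 1 within {q..1})"
    using q1 by (intro sub) auto
  moreover have "((\<lambda>_. 1) has_real_derivative 0) (at 1 within {q..1})" by simp
  then have "(S.K 1 1 has_real_derivative 0) (at 1 within {q..1})"
    by (rule has_field_derivative_transform_within[OF _ zero_less_one]) (use K1 q1 in auto)
  ultimately have "S.K 1 2 1 = 0" using q1 by (rule has_real_derivative_Icc_unique) (use q1 in auto)
  then show False using second_derivative_pos[OF _ f] l by simp
qed

lemma critical_iterate_tendsto: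
  assumes l: "\<kappa>' 1 = 1" and t: "t \<in> {-1..1}"
  shows "(\<lambda>L. (\<kappa> ^^ L) t) \<longlonglongrightarrow> 1"
proof -
  have "s \<le> \<kappa> s" if "s \<in> {-1..1}" for s
    using kernel_increment[of s 1] that l kernel_1 by auto
  then have inc: "incseq (\<lambda>L. (\<kappa> ^^ L) t)"
    using iterate_range[OF t] by (intro incseq_SucI) simp
  have "\<forall>L. (\<kappa> ^^ L) t \<le> 1" using iterate_range[OF t] by simp
  with inc obtain q where q: "(\<lambda>L. (\<kappa> ^^ L) t) \<longlonglongrightarrow> q" by (rule incseq_convergent)
  have "q = 1"
    by (rule critical_fixed_point[OF l kernel_tendsto(1)[OF q t] kernel_tendsto(2)[OF q t]])
  with q show ?thesis by simp
qed

lemma iterate_nonneg: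
  assumes "t \<in> {0..1}" shows "(\<kappa> ^^ L) t \<in> {0..1}"
proof (induction L)
  case (Suc L)
  then have "\<Gamma>b \<le> \<kappa> ((\<kappa> ^^ L) t)" by (intro kernel_ge_nonneg) auto
  moreover have "\<kappa> ((\<kappa> ^^ L) t) \<le> 1" using kernel_range[of "(\<kappa> ^^ L) t"] Suc by auto
  ultimately show ?case using pos by simp
qed (use assms in simp)

lemma iterate_convergent_nonneg:
  assumes t: "t \<in> {0..1}" shows "convergent (\<lambda>L. (\<kappa> ^^ L) t)"
proof (cases "t \<le> \<kappa> t")
  case True
  have "(\<kappa> ^^ L) t \<le> (\<kappa> ^^ Suc L) t" for L
  proof (induction L)
    case (Suc L)
    then show ?case using iterate_nonneg[OF t, of L] iterate_nonneg[OF t, of "Suc L"]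
      by (auto intro: kernel_mono)
  qed (use True in simp)
  then have inc: "incseq (\<lambda>L. (\<kappa> ^^ L) t)" by (rule incseq_SucI)
  have "\<forall>L. (\<kappa> ^^ L) t \<le> 1" using iterate_nonneg[OF t] by simp
  with inc obtain q where "(\<lambda>L. (\<kappa> ^^ L) t) \<longlonglongrightarrow> q" by (rule incseq_convergent)
  then show ?thesis by (auto simp: convergent_def)
next
  case False
  have "(\<kappa> ^^ Suc L) t \<le> (\<kappa> ^^ L) t" for L
  proof (induction L)
    case (Suc L)
    then show ?case using iterate_nonneg[OF t, of L] iterate_nonneg[OF t, of "Suc L"]
      by (auto intro: kernel_mono)
  qed (use False in simp)
  then have dec: "decseq (\<lambda>L. (\<kappa> ^^ L) t)" by (rule decseq_SucI)
  have "\<forall>L. 0 \<le> (\<kappa> ^^ L) t" using iterate_nonneg[OF t] by simp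
  with dec obtain q where "(\<lambda>L. (\<kappa> ^^ L) t) \<longlonglongrightarrow> q" by (rule decseq_convergent)
  then show ?thesis by (auto simp: convergent_def)
qed

lemma iterate_enters_nonneg:
  assumes t: "t \<in> {-1..1}" shows "\<exists>m. (\<kappa> ^^ m) t \<in> {0..1}"
proof (rule ccontr)
  assume "\<not> ?thesis"
  then have neg: "(\<kappa> ^^ m) t < 0" for m
    using iterate_range[OF t, of m] by (auto simp: not_le)
  have le: "t + real m * \<Gamma>b \<le> (\<kappa> ^^ m) t" for m
  proof (induction m)
    case (Suc m)
    have "(\<kappa> ^^ m) t + \<Gamma>b \<le> \<kappa> ((\<kappa> ^^ m) t)"
      using iterate_range[OF t, of m] neg[of m] by (intro kernel_ge_neg) auto
    then show ?case using Suc by (simp add: algebra_simps)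
  qed simp
  obtain m :: nat where "1 < real m * \<Gamma>b" using ex_less_of_nat_mult[OF pos(1)] by blast
  then show False using le[of m] neg[of m] t by simp
qed

lemma iterate_convergent:
  assumes t: "t \<in> {-1..1}" shows "convergent (\<lambda>L. (\<kappa> ^^ L) t)"
proof -
  obtain m where m: "(\<kappa> ^^ m) t \<in> {0..1}" using iterate_enters_nonneg[OF t] by blast
  obtain q where "(\<lambda>L. (\<kappa> ^^ L) ((\<kappa> ^^ m) t)) \<longlonglongrightarrow> q"
    using iterate_convergent_nonneg[OF m] by (auto simp: convergent_def)
  then have "(\<lambda>L. (\<kappa> ^^ (L + m)) t) \<longlonglongrightarrow> q" by (simp add: funpow_add)
  then show ?thesis unfolding convergent_def by (blast intro: LIMSEQ_offset)
qed

text \<open>A slope above 1 at the fixed point pushes nearby points away from it. On an interval to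
  the left of \<open>1\<close> the limit function is thus below 1, and so is its weighted
  mean.\<close>

lemma supercritical_prb_0:
  assumes l: "\<kappa>' 1 > 1"
  shows "\<exists>p<1. (\<lambda>L. prb L 0) \<longlonglongrightarrow> p"
proof -
  define q where "q t = lim (\<lambda>L. (\<kappa> ^^ L) t)" for t
  have q: "(\<lambda>L. (\<kappa> ^^ L) t) \<longlonglongrightarrow> q t" if "t \<in> {-1..1}" for t
    using iterate_convergent[OF that] by (simp add: q_def convergent_LIMSEQ_iff)
  have q1: "q t \<le> 1" if "t \<in> {-1..1}" for t using kernel_tendsto(1)[OF q[OF that] that] by simp
  have "((\<lambda>t. (\<kappa> t - \<kappa> 1) / (t - 1)) \<longlongrightarrow> \<kappa>' 1) (at_left 1)"
    using deriv unfolding deriv_I_def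
    by (auto simp: has_field_derivative_iff at_within_Icc_at_left dest!: bspec[of _ _ 1])
  then have "\<forall>\<^sub>F t in at_left 1. 1 < (\<kappa> t - \<kappa> 1) / (t - 1)" using l by (rule order_tendstoD)
  then obtain b where b: "b < 1" "\<And>t. b < t \<Longrightarrow> t < 1 \<Longrightarrow> 1 < (\<kappa> t - \<kappa> 1) / (t - 1)"
    unfolding eventually_at_left_field by blast
  \<comment> \<open>The maximum with 0 keeps orbits in \<open>[0, 1]\<close>, where
    \<open>kernel_mono\<close> applies.\<close>
  define b' where "b' = max b 0"
  have b': "b' < 1" "b' \<ge> 0" using b by (auto simp: b'_def)
  have qt: "q t < 1" if t: "t \<in> {b'<..<1}" for t
  proof -
    have t01: "t \<in> {0..1}" using t b' by auto
    have "1 < (\<kappa> t - 1) / (t - 1)" using b(2)[of t] t kernel_1 by (simp add: b'_def)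
    then have kt: "\<kappa> t \<le> t" using t by (simp add: neg_less_divide_eq)
    have "(\<kappa> ^^ L) t \<le> t" for L
    proof (induction L)
      case (Suc L)
      then have "\<kappa> ((\<kappa> ^^ L) t) \<le> \<kappa> t" using iterate_nonneg[OF t01, of L] t01 by (intro kernel_mono) auto
      then show ?case using kt by simp
    qed simp
    then have "q t \<le> t" using q[of t] t01 by (intro LIMSEQ_le_const2) auto
    then show ?thesis using t by simp
  qed
  have pq: "set_integrable lborel {-1..1} (\<lambda>x. q x * jacobi_weight d x)"
    and lim: "(\<lambda>L. prb L 0) \<longlonglongrightarrow> (LINT x:{-1..1}|lborel. q x * jacobi_weight d x) / total_weight"
    using prb_0_tendsto[of q] q by auto
  have w1: "set_integrable lborel {-1..1} (\<lambda>x. jacobi_weight d x)"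
    using set_integrable_weight_continuous[OF d2, of "\<lambda>_. 1"] by simp
  have i: "set_integrable lborel {-1..1} (\<lambda>x. (1 - q x) * jacobi_weight d x)"
    using set_integral_diff(1)[OF w1 pq] by (simp add: left_diff_distrib)
  have e: "(LINT x:{-1..1}|lborel. (1 - q x) * jacobi_weight d x) =
     total_weight - (LINT x:{-1..1}|lborel. q x * jacobi_weight d x)"
    using set_integral_diff(2)[OF w1 pq] by (simp add: left_diff_distrib total_weight_def)
  have nn: "(LINT x:{-1..1}|lborel. (1 - q x) * jacobi_weight d x) \<ge> 0"
    unfolding set_lebesgue_integral_def
    by (intro integral_nonneg_AE AE_I2) (auto simp: indicator_def jacobi_weight_nonneg q1)
  have "(LINT x:{-1..1}|lborel. (1 - q x) * jacobi_weight d x) \<noteq> 0"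
  proof
    assume z: "(LINT x:{-1..1}|lborel. (1 - q x) * jacobi_weight d x) = 0"
    have "AE x in lborel. x \<in> {-1<..<1} \<longrightarrow> 1 - q x = 0"
      by (rule weight_integral_eq_0_AE[OF i _ z]) (use q1 in auto)
    then have "AE x in lborel. x \<notin> {b'<..<1}"
    proof eventually_elim
      fix x assume x: "x \<in> {-1<..<1} \<longrightarrow> 1 - q x = 0"
      show "x \<notin> {b'<..<1}"
      proof
        assume "x \<in> {b'<..<1}"
        then show False using x qt[of x] b' by auto
      qed
    qed
    then show False using not_AE_interval[OF b'(1)] by blast
  qed
  then have "(LINT x:{-1..1}|lborel. q x * jacobi_weight d x) / total_weight < 1"
    using nn e total_weight_pos by simp
  then show ?thesis using lim by blast
qed

lemma critical_moment_1:
  assumes l: "\<kappa>' 1 = 1" shows "(\<lambda>L. moment N (X L) 1) \<longlonglongrightarrow> 0"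
proof (rule LIMSEQ_I)
  fix \<eta> :: real assume \<eta>: "\<eta> > 0"
  have "(\<lambda>L. prb L 0) \<longlonglongrightarrow> (LINT x:{-1..1}|lborel. 1 * jacobi_weight d x) / total_weight"
    by (rule prb_0_tendsto(2)[OF critical_iterate_tendsto[OF l]])
  then have p: "(\<lambda>L. prb L 0) \<longlonglongrightarrow> 1" using total_weight_pos by (simp add: total_weight_def[symmetric])
  \<comment> \<open>Chosen so that the second moment, bounded by \<open>d\<close>, contributes at
    most \<open>\<eta> / 2\<close>.\<close>
  define k where "k = 2 * real d / \<eta>"
  have k: "k > 0" "real d / k = \<eta> / 2" using \<eta> d2 by (simp_all add: k_def)
  have "(\<lambda>L. k * (1 - prb L 0)) \<longlonglongrightarrow> k * (1 - 1)" by (intro tendsto_intros p)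
  then have "\<forall>\<^sub>F L in sequentially. k * (1 - prb L 0) < \<eta> / 2"
    by (rule order_tendstoD) (use \<eta> in simp)
  then have "\<forall>\<^sub>F L in sequentially. norm (moment N (X L) 1 - 0) < \<eta>"
    using eventually_ge_at_top[of 1]
  proof eventually_elim
    fix L :: nat assume a: "k * (1 - prb L 0) < \<eta> / 2" and L: "1 \<le> L"
    have "moment N (X L) 2 / k \<le> real d / k"
      using moment_2_bounds(2)[OF L] l k by (simp add: divide_right_mono)
    then have "moment N (X L) 1 < \<eta>" using moment_1_le[OF L k(1)] a k(2) by linarith
    then show "norm (moment N (X L) 1 - 0) < \<eta>" using moment_nonneg[of L 1] by simp
  qed
  then show "\<exists>no. \<forall>L\<ge>no. norm (moment N (X L) 1 - 0) < \<eta>" by (simp add: eventually_sequentially)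
qed

text \<open>Covers odd orders as well: the third moment is bounded below by interpolation with
  orders 4 and 6 at scale \<open>h L = L\<close>, and order \<open>n\<close> is bounded above by
  order \<open>2 * n\<close>.\<close>

lemma critical_grows:
  assumes l: "\<kappa>' 1 = 1" and f: "\<And>k. S.fin 1 k" and n: "n > 2"
  shows "grows_polynomially (\<lambda>L. moment N (X L) n)"
proof -
  obtain c where c: "c > 0" "(\<lambda>L. moment N (X L) (2 * 2) / real L ^ (2 - 1)) \<longlonglongrightarrow> c"
    using critical_moment[OF l f, of 2] by auto
  obtain c' where c': "c' > 0" "(\<lambda>L. moment N (X L) (2 * 3) / real L ^ (3 - 1)) \<longlonglongrightarrow> c'"
    using critical_moment[OF l f, of 3] by auto
  have "\<exists>\<delta>>0. \<forall>\<^sub>F L in sequentially. \<delta> * sqrt (real L) \<le> moment N (X L) 3"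
  proof (rule interpolated_lower_bound)
    show "(\<lambda>L. moment N (X L) (2 * 2) / real L) \<longlonglongrightarrow> c" using c by simp
    show "(\<lambda>L. moment N (X L) (2 * 3) / (real L)\<^sup>2) \<longlonglongrightarrow> c'" using c' by simp
    show "moment N (X L) (2 * 2) \<le> s * moment N (X L) 3 + moment N (X L) (2 * 3) / s\<^sup>2" if "1 \<le> L" "0 < s" for L s
      using moment_interpolate[OF f[of 3] that(1), of 3 s] that by simp
  qed (use c c' in auto)
  then obtain \<delta> where \<delta>: "\<delta> > 0" "\<forall>\<^sub>F L in sequentially. \<delta> * sqrt (real L) \<le> moment N (X L) 3" by blast
  have "(\<lambda>L. moment N (X L) n) \<in> \<Omega>(\<lambda>L. real L powr (1 / 2))"
  proof (rule landau_omega.bigI[OF \<delta>(1)])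
    show "\<forall>\<^sub>F L in sequentially. norm (moment N (X L) n) \<ge> \<delta> * norm (real L powr (1 / 2))"
      using \<delta>(2) eventually_ge_at_top[of 1]
    proof eventually_elim
      fix L :: nat assume a: "\<delta> * sqrt (real L) \<le> moment N (X L) 3" and L: "1 \<le> L"
      have "moment N (X L) 3 \<le> moment N (X L) n"
        using n by (intro moment_mono L all_moments_finite f) auto
      then show "norm (moment N (X L) n) \<ge> \<delta> * norm (real L powr (1 / 2))"
        using a L moment_nonneg[of L n] by (simp add: powr_half_sqrt)
    qed
  qed
  moreover have "(\<lambda>L. moment N (X L) n) \<in> O(\<lambda>L. real L powr real (n - 1))"
  proof -
    obtain C where C: "C > 0" "(\<lambda>L. moment N (X L) (2 * n) / real L ^ (n - 1)) \<longlonglongrightarrow> C"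
      using critical_moment[OF l f, of n] n by auto
    have "\<forall>\<^sub>F L in sequentially. moment N (X L) (2 * n) / real L ^ (n - 1) < C + 1"
      by (rule order_tendstoD[OF C(2)]) simp
    then have "\<forall>\<^sub>F L in sequentially. norm (moment N (X L) n) \<le> (C + 1) * norm (real L powr real (n - 1))"
      using eventually_ge_at_top[of 1]
    proof eventually_elim
      fix L :: nat assume a: "moment N (X L) (2 * n) / real L ^ (n - 1) < C + 1" and L: "1 \<le> L"
      have "moment N (X L) n \<le> moment N (X L) (2 * n)"
        using n by (intro moment_mono L all_moments_finite f) auto
      also have "\<dots> \<le> (C + 1) * real L ^ (n - 1)" using a L by (simp add: pos_divide_less_eq)
      finally show "norm (moment N (X L) n) \<le> (C + 1) * norm (real L powr real (n - 1))"
        using L moment_nonneg[of L n] by (simp add: powr_realpow)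
    qed
    then show ?thesis by (rule bigoI)
  qed
  moreover have "(1 / 2 :: real) > 0" "real (n - 1) > 0" using n by auto
  ultimately show ?thesis unfolding grows_polynomially_def by blast
qed

text \<open>Interpolating the first moment with orders 2 and 4 gives the lower rate
  \<open>sqrt (\<kappa>' 1)\<close>; the upper rate is that of order \<open>2 * n\<close>.\<close>

lemma supercritical_diverges:
  assumes l: "\<kappa>' 1 > 1" and f: "\<And>k. S.fin 1 k" and n: "n \<ge> 1"
  shows "diverges_exponentially (\<lambda>L. moment N (X L) n)"
proof -
  obtain c where c: "c > 0" "(\<lambda>L. moment N (X L) (2 * 1) / \<kappa>' 1 ^ (1 * L)) \<longlonglongrightarrow> c"
    using supercritical_moment[OF l f, of 1] by auto
  obtain c' where c': "c' > 0" "(\<lambda>L. moment N (X L) (2 * 2) / \<kappa>' 1 ^ (2 * L)) \<longlonglongrightarrow> c'"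
    using supercritical_moment[OF l f, of 2] by auto
  have "\<exists>\<delta>>0. \<forall>\<^sub>F L in sequentially. \<delta> * sqrt (\<kappa>' 1 ^ L) \<le> moment N (X L) 1"
  proof (rule interpolated_lower_bound)
    show "(\<lambda>L. moment N (X L) (2 * 1) / \<kappa>' 1 ^ L) \<longlonglongrightarrow> c" using c by simp
    show "(\<lambda>L. moment N (X L) (2 * 2) / (\<kappa>' 1 ^ L)\<^sup>2) \<longlonglongrightarrow> c'"
      using c' by (simp add: power_mult[symmetric] mult.commute)
    show "moment N (X L) (2 * 1) \<le> s * moment N (X L) 1 + moment N (X L) (2 * 2) / s\<^sup>2" if "1 \<le> L" "0 < s" for L s
    proof -
      have e: "2 * 1 = (1 + 1 :: nat)" "2 * 2 = (1 + 3 :: nat)" by simp_all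
      show ?thesis unfolding e by (rule moment_interpolate[OF f[of 2] that(1)]) (use that in simp_all)
    qed
  qed (use c c' l in auto)
  then obtain \<delta> where \<delta>: "\<delta> > 0" "\<forall>\<^sub>F L in sequentially. \<delta> * sqrt (\<kappa>' 1 ^ L) \<le> moment N (X L) 1" by blast
  have "(\<lambda>L. moment N (X L) n) \<in> \<Omega>(\<lambda>L. sqrt (\<kappa>' 1) ^ L)"
  proof (rule landau_omega.bigI[OF \<delta>(1)])
    show "\<forall>\<^sub>F L in sequentially. norm (moment N (X L) n) \<ge> \<delta> * norm (sqrt (\<kappa>' 1) ^ L)"
      using \<delta>(2) eventually_ge_at_top[of 1]
    proof eventually_elim
      fix L :: nat assume a: "\<delta> * sqrt (\<kappa>' 1 ^ L) \<le> moment N (X L) 1" and L: "1 \<le> L"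
      have "moment N (X L) 1 \<le> moment N (X L) n"
        using n by (intro moment_mono L all_moments_finite f) auto
      then show "norm (moment N (X L) n) \<ge> \<delta> * norm (sqrt (\<kappa>' 1) ^ L)"
        using a l moment_nonneg[of L n] by (simp add: real_sqrt_power)
    qed
  qed
  moreover have "(\<lambda>L. moment N (X L) n) \<in> O(\<lambda>L. (\<kappa>' 1 ^ n) ^ L)"
  proof -
    obtain C where C: "C > 0" "(\<lambda>L. moment N (X L) (2 * n) / \<kappa>' 1 ^ (n * L)) \<longlonglongrightarrow> C"
      using supercritical_moment[OF l f n] by auto
    have "\<forall>\<^sub>F L in sequentially. moment N (X L) (2 * n) / \<kappa>' 1 ^ (n * L) < C + 1"
      by (rule order_tendstoD[OF C(2)]) simp
    then have "\<forall>\<^sub>F L in sequentially. norm (moment N (X L) n) \<le> (C + 1) * norm ((\<kappa>' 1 ^ n) ^ L)"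
      using eventually_ge_at_top[of 1]
    proof eventually_elim
      fix L :: nat assume a: "moment N (X L) (2 * n) / \<kappa>' 1 ^ (n * L) < C + 1" and L: "1 \<le> L"
      have "moment N (X L) n \<le> moment N (X L) (2 * n)"
        using n by (intro moment_mono L all_moments_finite f) auto
      also have "\<dots> \<le> (C + 1) * \<kappa>' 1 ^ (n * L)" using a l by (simp add: pos_divide_less_eq)
      finally show "norm (moment N (X L) n) \<le> (C + 1) * norm ((\<kappa>' 1 ^ n) ^ L)"
        using l moment_nonneg[of L n] by (simp add: power_mult)
    qed
    then show ?thesis by (rule bigoI)
  qed
  moreover have "sqrt (\<kappa>' 1) > 1" "\<kappa>' 1 ^ n > 1" using l n by (auto simp: one_less_power)
  ultimately show ?thesis unfolding diverges_exponentially_def by blast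
qed

lemma subcritical_decays:
  assumes l: "\<kappa>' 1 < 1" and f: "\<And>k. S.fin 1 k" and n: "n \<ge> 1"
  shows "decays_exponentially (\<lambda>L. moment N (X L) n)"
proof -
  \<comment> \<open>The midpoint to 1 is positive even when \<open>\<kappa>' 1 = 0\<close>, as the
    definition of exponential decay demands.\<close>
  define \<rho> where "\<rho> = (\<kappa>' 1 + 1) / 2"
  have \<rho>: "0 < \<rho>" "\<rho> < 1" "\<kappa>' 1 \<le> \<rho>" using l lambda_nonneg by (auto simp: \<rho>_def)
  have "(\<lambda>L. moment N (X L) n) \<in> O(\<lambda>L. \<kappa>' 1 ^ L)"
    using subcritical_moments[OF l f[of n], of n] n by simp
  also have "(\<lambda>L. \<kappa>' 1 ^ L) \<in> O(\<lambda>L. \<rho> ^ L)"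
    using \<rho> lambda_nonneg by (intro bigoI[where c = 1] always_eventually allI) (simp add: power_mono)
  finally show ?thesis using \<rho> unfolding decays_exponentially_def by blast
qed

lemma supercritical_leading:
  assumes l: "\<kappa>' 1 > 1" and f: "S.fin 1 n" and n: "n \<ge> 1"
  shows "leading_order (\<lambda>L. moment N (X L) (2 * n)) (\<lambda>L. \<kappa>' 1 ^ (n * L))"
  using supercritical_moment[OF assms] l by (auto intro: leading_orderI)

lemma critical_leading:
  assumes l: "\<kappa>' 1 = 1" and f: "S.fin 1 n" and n: "n \<ge> 2"
  shows "leading_order (\<lambda>L. moment N (X L) (2 * n)) (\<lambda>L. real L ^ (n - 1))"
  using critical_moment[OF assms] by (auto intro: leading_orderI)

lemma supercritical_liminf:
  assumes l: "\<kappa>' 1 > 1"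
  shows "liminf (\<lambda>L. ereal (moment N (X L) 1)) > 0"
proof -
  obtain p where p: "p < 1" "(\<lambda>L. prb L 0) \<longlonglongrightarrow> p" using supercritical_prb_0[OF l] by blast
  have "(\<lambda>L. ereal (1 - prb L 0)) \<longlonglongrightarrow> ereal (1 - p)"
    by (intro tendsto_intros p)
  then have "liminf (\<lambda>L. ereal (1 - prb L 0)) = ereal (1 - p)" by (intro lim_imp_Liminf) auto
  moreover have "liminf (\<lambda>L. ereal (1 - prb L 0)) \<le> liminf (\<lambda>L. ereal (moment N (X L) 1))"
    by (rule Liminf_mono, use eventually_ge_at_top[of 1] in eventually_elim) (use moment_1_ge in auto)
  moreover have "0 < ereal (1 - p)" using p by simp
  ultimately show ?thesis by (metis less_le_trans)
qed

section \<open>The three regimes\<close>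

proposition low_disorder:
  assumes l: "\<kappa>' 1 < 1"
  shows "(infinitely_differentiable_near_1 \<kappa> \<longrightarrow>
          (\<forall>L\<ge>1. \<forall>n. finite_moment N (X L) n) \<and>
          (\<forall>n\<ge>1. decays_exponentially (\<lambda>L. moment N (X L) n)) \<and>
          (\<forall>n\<ge>1. (\<lambda>L. moment N (X L) n) \<in> O(\<lambda>L. \<kappa>' 1 ^ L))) \<and>
        (\<forall>r. only_times_differentiable_near_1 r \<kappa> \<longrightarrow>
          (\<forall>L\<ge>1. only_2r_finite_moments N (X L) r) \<and>
          (\<forall>n\<in>{1..2 * r}. (\<lambda>L. moment N (X L) n) \<in> O(\<lambda>L. \<kappa>' 1 ^ L)))"
proof (intro conjI impI allI ballI)
  fix n :: nat assume i: "infinitely_differentiable_near_1 \<kappa>" and n: "1 \<le> n"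
  show "(\<lambda>L. moment N (X L) n) \<in> O(\<lambda>L. \<kappa>' 1 ^ L)"
    using subcritical_moments[OF l infinitely_differentiable_imp[OF i, of n], of n] n by simp
qed (auto intro: all_moments_finite subcritical_decays l infinitely_differentiable_imp only_2r
    subcritical_moments[OF l only_times_imp(1)])

proposition sparse:
  assumes l: "\<kappa>' 1 = 1"
  shows "(\<forall>L\<ge>1. finite_moment N (X L) 1 \<and> finite_moment N (X L) 2) \<and>
        (\<lambda>L. moment N (X L) 1) \<longlonglongrightarrow> 0 \<and>
        (\<forall>L\<ge>1. 1 \<le> moment N (X L) 2 \<and> moment N (X L) 2 \<le> real d) \<and>
        (infinitely_differentiable_near_1 \<kappa> \<longrightarrow>
          (\<forall>L\<ge>1. \<forall>n. finite_moment N (X L) n) \<and>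
          (\<forall>n>2. grows_polynomially (\<lambda>L. moment N (X L) n)) \<and>
          (\<forall>n\<ge>2. leading_order (\<lambda>L. moment N (X L) (2 * n)) (\<lambda>L. real L ^ (n - 1)))) \<and>
        (\<forall>r. only_times_differentiable_near_1 r \<kappa> \<longrightarrow>
          (\<forall>L\<ge>1. only_2r_finite_moments N (X L) r) \<and>
          (\<forall>n\<in>{2..r}. leading_order (\<lambda>L. moment N (X L) (2 * n)) (\<lambda>L. real L ^ (n - 1))))"
proof (intro conjI impI allI ballI)
  fix L :: nat assume L: "1 \<le> L"
  show "finite_moment N (X L) 1" "finite_moment N (X L) 2"
    by (rule finite_moment_if_fin[OF fin_1_1 L]; simp)+
  show "1 \<le> moment N (X L) 2" "moment N (X L) 2 \<le> real d"
    using moment_2_bounds[OF L] l by simp_all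
next
  fix r n assume o: "only_times_differentiable_near_1 r \<kappa>" and n: "n \<in> {2..r}"
  show "leading_order (\<lambda>L. moment N (X L) (2 * n)) (\<lambda>L. real L ^ (n - 1))"
    using S.fin_mono[OF only_times_imp(1)[OF o], of n] n by (intro critical_leading l) auto
qed (auto intro: all_moments_finite critical_moment_1 critical_grows critical_leading l
    infinitely_differentiable_imp only_2r simp del: One_nat_def)

proposition high_disorder:
  assumes l: "\<kappa>' 1 > 1"
  shows "(\<exists>p<1. (\<lambda>L. measure N {\<omega> \<in> space N. X L \<omega> = 0}) \<longlonglongrightarrow> p) \<and>
        (\<forall>L\<ge>1. finite_moment N (X L) 1) \<and>
        liminf (\<lambda>L. ereal (moment N (X L) 1)) > 0 \<and>
        (infinitely_differentiable_near_1 \<kappa> \<longrightarrow>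
          (\<forall>L\<ge>1. \<forall>n. finite_moment N (X L) n) \<and>
          (\<forall>n\<ge>1. diverges_exponentially (\<lambda>L. moment N (X L) n)) \<and>
          (\<forall>n\<ge>1. leading_order (\<lambda>L. moment N (X L) (2 * n)) (\<lambda>L. \<kappa>' 1 ^ (n * L)))) \<and>
        (\<forall>r. only_times_differentiable_near_1 r \<kappa> \<longrightarrow>
          (\<forall>L\<ge>1. only_2r_finite_moments N (X L) r) \<and>
          (\<forall>n\<in>{1..r}. leading_order (\<lambda>L. moment N (X L) (2 * n)) (\<lambda>L. \<kappa>' 1 ^ (n * L))))"
proof (intro conjI impI allI ballI)
  show "\<exists>p<1. (\<lambda>L. measure N {\<omega> \<in> space N. X L \<omega> = 0}) \<longlonglongrightarrow> p"
    using supercritical_prb_0[OF l] by (simp add: prb_def)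
next
  fix L :: nat assume L: "1 \<le> L"
  show "finite_moment N (X L) 1"
    by (rule finite_moment_if_fin[OF fin_1_1 L]; simp)
next
  show "liminf (\<lambda>L. ereal (moment N (X L) 1)) > 0" by (rule supercritical_liminf[OF l])
next
  fix r n assume o: "only_times_differentiable_near_1 r \<kappa>" and n: "n \<in> {1..r}"
  show "leading_order (\<lambda>L. moment N (X L) (2 * n)) (\<lambda>L. \<kappa>' 1 ^ (n * L))"
    using S.fin_mono[OF only_times_imp(1)[OF o], of n] n by (intro supercritical_leading l) auto
qed (auto intro: all_moments_finite supercritical_diverges supercritical_leading l
    infinitely_differentiable_imp only_2r simp del: One_nat_def)

end

text \<open>An isotropic covariance fixes its kernel only at inner products of unit vectors; two
  orthogonal axes realise every value in \<open>[-1, 1]\<close>.\<close>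

lemma sphere_inner_surj:
  assumes "CARD('n::finite) \<ge> 2" "t \<in> {-1..1}"
  shows "\<exists>x\<in>sphere (0 :: real ^ 'n) 1. \<exists>y\<in>sphere 0 1. x \<bullet> y = t"
proof -
  obtain i j :: 'n where ij: "i \<noteq> j"
    using assms(1) card_le_Suc0_iff_eq[of "UNIV :: 'n set"] by auto
  define s where "s = sqrt (1 - t\<^sup>2)"
  have s: "s * s = 1 - t * t"
    using assms(2) by (simp add: s_def abs_square_le_1 abs_le_iff flip: power2_eq_square)
  define x y :: "real ^ 'n" where "x = axis i 1" and "y = t *\<^sub>R axis i 1 + s *\<^sub>R axis j 1"
  have "x \<bullet> x = 1" by (simp add: x_def inner_axis_axis)
  moreover have "y \<bullet> y = 1" using ij s by (simp add: y_def inner_axis_axis inner_add_left inner_add_right)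
  moreover have "x \<bullet> y = t" using ij by (simp add: x_def y_def inner_axis_axis inner_add_right)
  ultimately show ?thesis by (intro bexI[of _ x] bexI[of _ y]) (simp_all add: norm_eq_1)
qed

theorem theorem3p1:
  fixes d :: nat
    and \<sigma> \<kappa> \<kappa>' :: "real \<Rightarrow> real"
    and \<Gamma>b \<Gamma>W0 :: real
    and G :: "nat \<Rightarrow> real poly"
    and M :: "'a measure"
    and T :: "nat \<Rightarrow> real ^ 'n \<Rightarrow> 'a \<Rightarrow> real"
    and N :: "'b measure"
    and X :: "nat \<Rightarrow> 'b \<Rightarrow> nat"
  assumes "d \<ge> 2" and "CARD('n) = d + 1"
    and "admissible_activation \<sigma>"
    and "\<Gamma>b > 0" and "\<Gamma>W0 > 0" and "\<Gamma>b + \<Gamma>W0 = 1"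
    and "\<kappa> = network_kernel \<sigma> \<Gamma>b \<Gamma>W0"
    and T_gaussian: "\<And>L. L \<ge> 1 \<Longrightarrow> centered_gaussian_field M (sphere 0 1) (T L)"
    and T_covariance: "\<And>L. L \<ge> 1 \<Longrightarrow> isotropic_covariance M (T L) (\<kappa> ^^ L)"
    and \<kappa>_derivative:
      "\<And>t. t \<in> {-1..1} \<Longrightarrow> (\<kappa> has_real_derivative \<kappa>' t) (at t within {-1..1})"
    and \<kappa>_C1: "continuous_on {-1..1} \<kappa>'"
    and "normalized_gegenbauer d G"
    and "prob_space N"
    and X_spectral: "\<And>L. L \<ge> 1 \<Longrightarrow> spectral_random_variable G M (T L) N (X L)"
  shows
    "(\<kappa>' 1 < 1 \<longrightarrow>
        (infinitely_differentiable_near_1 \<kappa> \<longrightarrow>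
          (\<forall>L\<ge>1. \<forall>n. finite_moment N (X L) n) \<and>
          (\<forall>n\<ge>1. decays_exponentially (\<lambda>L. moment N (X L) n)) \<and>
          (\<forall>n\<ge>1. (\<lambda>L. moment N (X L) n) \<in> O(\<lambda>L. \<kappa>' 1 ^ L))) \<and>
        (\<forall>r. only_times_differentiable_near_1 r \<kappa> \<longrightarrow>
          (\<forall>L\<ge>1. only_2r_finite_moments N (X L) r) \<and>
          (\<forall>n\<in>{1..2 * r}. (\<lambda>L. moment N (X L) n) \<in> O(\<lambda>L. \<kappa>' 1 ^ L)))) \<and>
     (\<kappa>' 1 = 1 \<longrightarrow>
        (\<forall>L\<ge>1. finite_moment N (X L) 1 \<and> finite_moment N (X L) 2) \<and>
        (\<lambda>L. moment N (X L) 1) \<longlonglongrightarrow> 0 \<and>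
        (\<forall>L\<ge>1. 1 \<le> moment N (X L) 2 \<and> moment N (X L) 2 \<le> real d) \<and>
        (infinitely_differentiable_near_1 \<kappa> \<longrightarrow>
          (\<forall>L\<ge>1. \<forall>n. finite_moment N (X L) n) \<and>
          (\<forall>n>2. grows_polynomially (\<lambda>L. moment N (X L) n)) \<and>
          (\<forall>n\<ge>2. leading_order (\<lambda>L. moment N (X L) (2 * n)) (\<lambda>L. real L ^ (n - 1)))) \<and>
        (\<forall>r. only_times_differentiable_near_1 r \<kappa> \<longrightarrow>
          (\<forall>L\<ge>1. only_2r_finite_moments N (X L) r) \<and>
          (\<forall>n\<in>{2..r}. leading_order (\<lambda>L. moment N (X L) (2 * n)) (\<lambda>L. real L ^ (n - 1))))) \<and>
     (\<kappa>' 1 > 1 \<longrightarrow>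
        (\<exists>p<1. (\<lambda>L. measure N {\<omega> \<in> space N. X L \<omega> = 0}) \<longlonglongrightarrow> p) \<and>
        (\<forall>L\<ge>1. finite_moment N (X L) 1) \<and>
        liminf (\<lambda>L. ereal (moment N (X L) 1)) > 0 \<and>
        (infinitely_differentiable_near_1 \<kappa> \<longrightarrow>
          (\<forall>L\<ge>1. \<forall>n. finite_moment N (X L) n) \<and>
          (\<forall>n\<ge>1. diverges_exponentially (\<lambda>L. moment N (X L) n)) \<and>
          (\<forall>n\<ge>1. leading_order (\<lambda>L. moment N (X L) (2 * n)) (\<lambda>L. \<kappa>' 1 ^ (n * L)))) \<and>
        (\<forall>r. only_times_differentiable_near_1 r \<kappa> \<longrightarrow>
          (\<forall>L\<ge>1. only_2r_finite_moments N (X L) r) \<and>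
          (\<forall>n\<in>{1..r}. leading_order (\<lambda>L. moment N (X L) (2 * n)) (\<lambda>L. \<kappa>' 1 ^ (n * L)))))"
proof -
  have card: "CARD('n) \<ge> 2" using assms(1,2) by simp
  interpret D: deep_network \<sigma> \<Gamma>b \<Gamma>W0 d G \<kappa>' N X
  proof (intro deep_network.intro network.intro gegenbauer.intro deep_network_axioms.intro)
    show "deriv_I (network_kernel \<sigma> \<Gamma>b \<Gamma>W0) \<kappa>'"
      using \<kappa>_derivative unfolding assms(7) deriv_I_def by blast
    fix L :: nat assume L: "L \<ge> 1"
    show "X L \<in> measurable N (count_space UNIV)"
      using X_spectral[OF L] by (simp add: spectral_random_variable_def)
    fix t :: real assume t: "t \<in> {-1..1}"
    obtain k where k: "isotropic_covariance M (T L) k"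
      "\<And>t. t \<in> {-1..1} \<Longrightarrow> (\<lambda>l. measure N {\<omega> \<in> space N. X L \<omega> = l} * poly (G l) t) sums k t"
      using X_spectral[OF L] unfolding spectral_random_variable_def by blast
    \<comment> \<open>The kernel \<open>k\<close> is known only to exist. Evaluated at points with
      inner product \<open>t\<close>, it represents the same covariance as
      \<open>\<kappa> ^^ L\<close>, so the two agree at \<open>t\<close>.\<close>
    obtain x y :: "real ^ 'n" where xy: "x \<in> sphere 0 1" "y \<in> sphere 0 1" "x \<bullet> y = t"
      using sphere_inner_surj[OF card t] by blast
    then have "k t = (\<kappa> ^^ L) t"
      using k(1) T_covariance[OF L] unfolding isotropic_covariance_def by metis
    with k(2)[OF t] show "(\<lambda>l. measure N {\<omega> \<in> space N. X L \<omega> = l} * poly (G l) t) sums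
        (network_kernel \<sigma> \<Gamma>b \<Gamma>W0 ^^ L) t"
      unfolding assms(7) by simp
  qed (use assms in simp_all)
  show ?thesis
    using D.low_disorder D.sparse D.high_disorder unfolding assms(7) by blast
qed

end
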